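(* Let $\mathcal{X}=[X_1,\dots,X_p]\in\mathbb{R}^{m\times ps}$ with blocks $X_j\in\mathbb{R}^{m\times s}$. Let $\widehat{\mathcal{Q}}$ and $\widehat{\mathcal{R}}$ denote the results computed in floating-point arithmetic by the adaptive algorithm BCGSI+P-1S-2S (given in the context) applied to $\mathcal{X}$. Assume that for all $X\in\mathbb{R}^{m\times s}$ with $\kappa(X)\le\kappa(\mathcal{X})$, the computed output $[\widehat Q,\widehat R]=\mathrm{IO}_A(X)$ of the routine used in the BCGSI+P-1S phase satisfies $$X+\Delta X=\widehat Q\widehat R,\quad \|\Delta X\|\le O(u)\|X\|,\qquad \|I-\widehat Q^T\widehat Q\|\le O(u).$$ Likewise, assume that for $[\widehat Q,\widehat R]=\mathrm{IO}_1(X)$ (for all such $X$) it holds that $$X+\Delta X=\widehat Q\widehat R,\quad \|\Delta X\|\le O(u)\|X\|,\qquad \|I-\widehat Q^T\widehat Q\|\le O(u)\,\kappa^{\alpha_1}(X)$$ with $\alpha_1\le1$. If $O(u)\,\kappa(\mathcal{X})\le1/2$, then there is a matrix $\Delta\mathcal{X}$ such that $$\mathcal{X}+\Delta\mathcal{X}=\widehat{\mathcal{Q}}\widehat{\mathcal{R}},\quad \|\Delta\mathcal{X}\|\le O(u)\|\mathcal{X}\|,$$ and $$\|I-\widehat{\mathcal{Q}}^T\widehat{\mathcal{Q}}\|\le O(u).$$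
   Context: Conventions. $\|\cdot\|$ is the 2-norm; $\kappa(M)=\sigma_{\max}(M)/\sigma_{\min}(M)$ for $\sigma_{\min}(M)>0$. $u$ is the unit roundoff, computations follow the standard model of floating-point arithmetic, and hats denote computed quantities. $O(u)$ denotes a quantity bounded by $c\,u$, where $c$ depends only on the dimensions (a modest polynomial in $m,s,p$), not on condition numbers, and may differ at each occurrence. A hypothesis such as "$O(u)\kappa\le 1/2$" means this inequality for a suitable such $c$. $\mathrm{chol}(M)$ returns the upper triangular Cholesky factor $C$ with $C^TC=M$. $\mathrm{IO}_A$ and $\mathrm{IO}_1$ are routines ("intraorthogonalizations") that compute a thin QR factorization $X=QR$ of an $m\times s$ block. Notation for the algorithms: $S_{1:k,k+1}$, $Y_{1:k,k+1}$, $R_{1:k,k+1}$ denote block columns with $k$ blocks of size $s\times s$; $\mathcal{X}_k=[X_1,\dots,X_k]$, $\mathcal{Q}_k=[Q_1,\dots,Q_k]$; $\mathcal{R}_k=(R_{ij})_{1\le i,j\le k}$ is block upper triangular. Initialization: $[Q_1,R_{11}]=\mathrm{IO}_A(X_1)$; $S_{12}=Q_1^TX_2$; $T_2=X_2^TX_2$. Step $k$ ($1\le k\le p-1$), which produces $Q_{k+1}$ and the $(k+1)$-st block column of $\mathcal{R}$: (a) if $k\ge2$, set $S_{1:k,k+1}=\begin{bmatrix} Z_{k-1}\\ Y_{kk}^{-T}\,(P_k-Y_{1:k-1,k}^TZ_{k-1})\end{bmatrix}$ (for $k=1$ use $S_{12}$); (b) compute $U_{k+1}$ and $S_{k+1,k+1}$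 in one of two ways. 1S version: $S_{k+1,k+1}=\mathrm{chol}(T_{k+1}-S_{1:k,k+1}^TS_{1:k,k+1})$, $U_{k+1}=(X_{k+1}-\mathcal{Q}_kS_{1:k,k+1})S_{k+1,k+1}^{-1}$. 2S version: $[U_{k+1},S_{k+1,k+1}]=\mathrm{IO}_1(X_{k+1}-\mathcal{Q}_kS_{1:k,k+1})$; (c) compute $Y_{1:k,k+1}=\mathcal{Q}_k^TU_{k+1}$ and $\Omega_{k+1}=U_{k+1}^TU_{k+1}$; if $k<p-1$, also $Z_k=\mathcal{Q}_k^TX_{k+2}$, $P_{k+1}=U_{k+1}^TX_{k+2}$ and (1S version only) $T_{k+2}=X_{k+2}^TX_{k+2}$; (d) $Y_{k+1,k+1}=\mathrm{chol}(\Omega_{k+1}-Y_{1:k,k+1}^TY_{1:k,k+1})$; (e) $Q_{k+1}=(U_{k+1}-\mathcal{Q}_kY_{1:k,k+1})Y_{k+1,k+1}^{-1}$; (f) $R_{1:k,k+1}=S_{1:k,k+1}+Y_{1:k,k+1}S_{k+1,k+1}$ and $R_{k+1,k+1}=Y_{k+1,k+1}S_{k+1,k+1}$. BCGSI+P-1S is the initialization followed by the 1S version of all steps $k=1,\dots,p-1$. BCGSI+P-2S is the initialization (without $T_2$) followed by the 2S version of all steps. Adaptive algorithm BCGSI+P-1S-2S. Fix a constant $\mathrm{const}$ that is independent of $s$, $m$ and the condition numbers. Run BCGSI+P-1S and, as soon as $\Omega_d$ has been computed, test whether $$\mathrm{const}^2\,\lambda_{\min}(\Omega_d)\le\lambda_{\max}(\Omega_d),$$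 that is, whether $\mathrm{const}^2\sigma_{\min}^2(U_d)\le\|U_d\|^2$. Let $d$ be the first index at which this holds. Keep the factorization $\mathcal{X}_{d-1}=\mathcal{Q}_{d-1}\mathcal{R}_{d-1}$ obtained so far from BCGSI+P-1S, and compute all the remaining block columns $Q_d,\dots,Q_p$ with the 2S version of the steps, i.e. steps $k=d-1,\dots,p-1$. If the test is never satisfied, BCGSI+P-1S is used throughout. Return $\mathcal{Q}=\mathcal{Q}_p$, $\mathcal{R}=\mathcal{R}_p$.
   Formalization: The accuracy of IO_1 is assumed for all blocks X with κ(X) ≤ τκ(𝒳), for an arbitrary fixed τ > 1, instead of κ(X) ≤ κ(𝒳): IO_1 is applied to a computed block whose condition number may slightly exceed κ(𝒳), and the statement then fails. *)

theory Defs
  imports "Jordan_Normal_Form.Spectral_Radius"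
begin

section \<open>Norms and singular values\<close>

definition vnorm :: "real vec \<Rightarrow> real" where
  "vnorm v = sqrt (v \<bullet> v)"

definition mnorm :: "real mat \<Rightarrow> real" where
  "mnorm A = Sup {vnorm (A *\<^sub>v v) | v. v \<in> carrier_vec (dim_col A) \<and> vnorm v = 1}"

text \<open>Only applied to symmetric matrices, whose spectrum over the reals is the full spectrum.\<close>

definition lambda_max :: "real mat \<Rightarrow> real" where
  "lambda_max A = Max (spectrum A)"

definition lambda_min :: "real mat \<Rightarrow> real" where
  "lambda_min A = Min (spectrum A)"

text \<open>The singular values of a matrix with at least as many rows as columns. With fewer rows
  than columns, this \<open>sigma_min\<close> is 0, so \<open>0 < sigma_min A\<close> always means full column rank.\<close>

definition sigma_max :: "real mat \<Rightarrow> real" where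
  "sigma_max A = sqrt (lambda_max (A\<^sup>T * A))"

definition sigma_min :: "real mat \<Rightarrow> real" where
  "sigma_min A = sqrt (lambda_min (A\<^sup>T * A))"

text \<open>Meaningful only if \<open>0 < sigma_min A\<close>; this is always required separately.\<close>

definition kappa :: "real mat \<Rightarrow> real" where
  "kappa A = sigma_max A / sigma_min A"

section \<open>Constants depending only on the dimensions\<close>

text \<open>\<open>O(u)\<close> stands for \<open>c m s p * u\<close> with such a \<open>c\<close>. Every polynomial in three
  positive integers is bounded by some \<open>K * (m * s * p) ^ N\<close>, which is itself a polynomial.\<close>

definition poly_const :: "(nat \<Rightarrow> nat \<Rightarrow> nat \<Rightarrow> real) \<Rightarrow> bool" where
  "poly_const c \<longleftrightarrow> (\<exists>K N. \<forall>m s p. 0 < m \<and> 0 < s \<and> 0 < p \<longrightarrow>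
     0 \<le> c m s p \<and> c m s p \<le> K * real (m * s * p) ^ N)"

section \<open>Standard model of floating-point arithmetic\<close>

text \<open>\<open>fl u x y\<close>: \<open>y\<close> is an admissible computed value of a single operation (sum, product,
  quotient, square root) whose exact result is \<open>x\<close>. The computed quantities below are relations,
  since the model bounds the rounding errors but does not determine them.\<close>

definition fl :: "real \<Rightarrow> real \<Rightarrow> real \<Rightarrow> bool" where
  "fl u x y \<longleftrightarrow> (\<exists>\<delta>. \<bar>\<delta>\<bar> \<le> u \<and> y = x * (1 + \<delta>))"

text \<open>Summation in an arbitrary order. A one-term sum involves no operation.\<close>

inductive fl_sum :: "real \<Rightarrow> real multiset \<Rightarrow> real \<Rightarrow> bool" for u where
  single: "fl_sum u {#x#} x"
| add: "fl_sum u A a \<Longrightarrow> fl_sum u B b \<Longrightarrow> fl u (a + b) c \<Longrightarrow> fl_sum u (A + B) c"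

definition fl_dot :: "real \<Rightarrow> real vec \<Rightarrow> real vec \<Rightarrow> real \<Rightarrow> bool" where
  "fl_dot u v w y \<longleftrightarrow> (\<exists>t. (\<forall>l<dim_vec v. fl u (v $ l * w $ l) (t l)) \<and>
     fl_sum u (image_mset t (mset_set {..<dim_vec v})) y)"

text \<open>Computed \<open>a - (\<Sum>l<n. b l * c l)\<close>, the inner loop of substitution and of Cholesky.\<close>

definition fl_resid ::
  "real \<Rightarrow> real \<Rightarrow> nat \<Rightarrow> (nat \<Rightarrow> real) \<Rightarrow> (nat \<Rightarrow> real) \<Rightarrow> real \<Rightarrow> bool" where
  "fl_resid u a n b c y \<longleftrightarrow> (\<exists>t. (\<forall>l<n. fl u (b l * c l) (t l)) \<and>
     fl_sum u (add_mset a (image_mset (\<lambda>l. - t l) (mset_set {..<n}))) y)"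

definition fl_mult :: "real \<Rightarrow> real mat \<Rightarrow> real mat \<Rightarrow> real mat \<Rightarrow> bool" where
  "fl_mult u A B C \<longleftrightarrow> C \<in> carrier_mat (dim_row A) (dim_col B) \<and>
     (\<forall>i<dim_row A. \<forall>j<dim_col B. fl_dot u (row A i) (col B j) (C $$ (i, j)))"

definition fl_plus :: "real \<Rightarrow> real mat \<Rightarrow> real mat \<Rightarrow> real mat \<Rightarrow> bool" where
  "fl_plus u A B C \<longleftrightarrow> C \<in> carrier_mat (dim_row A) (dim_col A) \<and>
     (\<forall>i<dim_row A. \<forall>j<dim_col A. fl u (A $$ (i, j) + B $$ (i, j)) (C $$ (i, j)))"

definition fl_minus :: "real \<Rightarrow> real mat \<Rightarrow> real mat \<Rightarrow> real mat \<Rightarrow> bool" where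
  "fl_minus u A B C \<longleftrightarrow> C \<in> carrier_mat (dim_row A) (dim_col A) \<and>
     (\<forall>i<dim_row A. \<forall>j<dim_col A. fl u (A $$ (i, j) - B $$ (i, j)) (C $$ (i, j)))"

text \<open>Computed \<open>A\<^sup>T * A\<close>: one triangle is computed and mirrored.\<close>

definition fl_gram :: "real \<Rightarrow> real mat \<Rightarrow> real mat \<Rightarrow> bool" where
  "fl_gram u A G \<longleftrightarrow> G \<in> carrier_mat (dim_col A) (dim_col A) \<and>
     (\<forall>j<dim_col A. \<forall>i\<le>j. fl_dot u (col A i) (col A j) (G $$ (i, j)) \<and>
        G $$ (j, i) = G $$ (i, j))"

text \<open>Computed \<open>W * C\<inverse>\<close> for upper triangular \<open>C\<close>: row-wise substitution for \<open>V * C = W\<close>.\<close>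

definition fl_solve :: "real \<Rightarrow> real mat \<Rightarrow> real mat \<Rightarrow> real mat \<Rightarrow> bool" where
  "fl_solve u C W V \<longleftrightarrow> V \<in> carrier_mat (dim_row W) (dim_col W) \<and>
     (\<forall>i<dim_row W. \<forall>j<dim_col W. \<exists>r.
        fl_resid u (W $$ (i, j)) j (\<lambda>l. V $$ (i, l)) (\<lambda>l. C $$ (l, j)) r \<and>
        fl u (r / C $$ (j, j)) (V $$ (i, j)))"

text \<open>Computed upper triangular Cholesky factor of \<open>A\<close>. Only the upper triangle of \<open>A\<close> is read.
  There is no result if a computed pivot is not positive (breakdown).\<close>

definition fl_chol :: "real \<Rightarrow> real mat \<Rightarrow> real mat \<Rightarrow> bool" where
  "fl_chol u A C \<longleftrightarrow> C \<in> carrier_mat (dim_row A) (dim_row A) \<and> upper_triangular C \<and>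
     (\<forall>j<dim_row A.
        (\<forall>i<j. \<exists>r. fl_resid u (A $$ (i, j)) i (\<lambda>l. C $$ (l, i)) (\<lambda>l. C $$ (l, j)) r \<and>
           fl u (r / C $$ (i, i)) (C $$ (i, j))) \<and>
        (\<exists>r>0. fl_resid u (A $$ (j, j)) j (\<lambda>l. C $$ (l, j)) (\<lambda>l. C $$ (l, j)) r \<and>
           fl u (sqrt r) (C $$ (j, j))))"

section \<open>Accuracy of an intraorthogonalization\<close>

definition approx_qr :: "real mat \<Rightarrow> real mat \<times> real mat \<Rightarrow> real \<Rightarrow> real \<Rightarrow> bool" where
  "approx_qr X QR \<epsilon> \<omega> \<longleftrightarrow> (case QR of (Q, R) \<Rightarrow>
     Q \<in> carrier_mat (dim_row X) (dim_col X) \<and> R \<in> carrier_mat (dim_col X) (dim_col X) \<and>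
     upper_triangular R \<and>
     (\<exists>\<Delta>X \<in> carrier_mat (dim_row X) (dim_col X). X + \<Delta>X = Q * R \<and> mnorm \<Delta>X \<le> \<epsilon> * mnorm X) \<and>
     mnorm (1\<^sub>m (dim_col X) - Q\<^sup>T * Q) \<le> \<omega>)"

section \<open>The algorithms\<close>

text \<open>Block indices start at 1, matrix indices at 0. For the block column \<open>k + 1\<close> the fields
  store \<open>qb (k+1) = Q\<^bsub>k+1\<^esub>\<close>, \<open>ub (k+1) = U\<^bsub>k+1\<^esub>\<close>, \<open>sc (k+1) = S\<^bsub>1:k,k+1\<^esub>\<close>, \<open>sd (k+1) = S\<^bsub>k+1,k+1\<^esub>\<close>,
  \<open>yc (k+1) = Y\<^bsub>1:k,k+1\<^esub>\<close>, \<open>yd (k+1) = Y\<^bsub>k+1,k+1\<^esub>\<close>, \<open>rc (k+1) = R\<^bsub>1:k,k+1\<^esub>\<close>, \<open>rd (k+1) = R\<^bsub>k+1,k+1\<^esub>\<close>.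
  The quantities \<open>Z\<close>, \<open>P\<close>, \<open>T\<close> are used in a single step and are introduced where they are
  used.\<close>

record bgs =
  qb :: "nat \<Rightarrow> real mat"
  ub :: "nat \<Rightarrow> real mat"
  sc :: "nat \<Rightarrow> real mat"
  sd :: "nat \<Rightarrow> real mat"
  yc :: "nat \<Rightarrow> real mat"
  yd :: "nat \<Rightarrow> real mat"
  rc :: "nat \<Rightarrow> real mat"
  rd :: "nat \<Rightarrow> real mat"

definition block_col :: "nat \<Rightarrow> real mat \<Rightarrow> nat \<Rightarrow> real mat" where
  "block_col s X k = mat (dim_row X) s (\<lambda>(i, j). X $$ (i, (k - 1) * s + j))"

definition qcat :: "nat \<Rightarrow> nat \<Rightarrow> bgs \<Rightarrow> nat \<Rightarrow> real mat" where
  "qcat m s a k = mat m (k * s) (\<lambda>(i, j). qb a (j div s + 1) $$ (i, j mod s))"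

definition rcat :: "nat \<Rightarrow> bgs \<Rightarrow> nat \<Rightarrow> real mat" where
  "rcat s a k = mat (k * s) (k * s) (\<lambda>(i, j).
     if i div s < j div s then rc a (j div s + 1) $$ (i, j mod s)
     else if i div s = j div s then rd a (j div s + 1) $$ (i mod s, j mod s)
     else 0)"

text \<open>Part (a) of step \<open>k\<close>. Here \<open>V = Y\<^bsub>kk\<^esub>\<^sup>-\<^sup>T W\<close> is obtained from \<open>V\<^sup>T Y\<^bsub>kk\<^esub> = W\<^sup>T\<close>.\<close>

definition step_S :: "real \<Rightarrow> nat \<Rightarrow> nat \<Rightarrow> real mat \<Rightarrow> bgs \<Rightarrow> nat \<Rightarrow> bool" where
  "step_S u m s X a k \<longleftrightarrow>
     (if k = 1 then fl_mult u ((qb a 1)\<^sup>T) (block_col s X 2) (sc a 2)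
      else \<exists>Z P G W V.
        fl_mult u ((qcat m s a (k - 1))\<^sup>T) (block_col s X (k + 1)) Z \<and>
        fl_mult u ((ub a k)\<^sup>T) (block_col s X (k + 1)) P \<and>
        fl_mult u ((yc a k)\<^sup>T) Z G \<and>
        fl_minus u P G W \<and>
        fl_solve u (yd a k) (W\<^sup>T) (V\<^sup>T) \<and>
        sc a (k + 1) = Z @\<^sub>r V)"

text \<open>Computed \<open>X\<^bsub>k+1\<^esub> - [Q\<^bsub>1\<^esub>,\<dots>,Q\<^bsub>k\<^esub>] S\<^bsub>1:k,k+1\<^esub>\<close>.\<close>

definition step_W :: "real \<Rightarrow> nat \<Rightarrow> nat \<Rightarrow> real mat \<Rightarrow> bgs \<Rightarrow> nat \<Rightarrow> real mat \<Rightarrow> bool" where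
  "step_W u m s X a k W \<longleftrightarrow> (\<exists>G.
     fl_mult u (qcat m s a k) (sc a (k + 1)) G \<and> fl_minus u (block_col s X (k + 1)) G W)"

text \<open>Part (b) of step \<open>k\<close> in the two versions, with results \<open>U\<close> and \<open>C = S\<^bsub>k+1,k+1\<^esub>\<close>.\<close>

definition step_1S ::
  "real \<Rightarrow> nat \<Rightarrow> nat \<Rightarrow> real mat \<Rightarrow> bgs \<Rightarrow> nat \<Rightarrow> real mat \<Rightarrow> real mat \<Rightarrow> bool" where
  "step_1S u m s X a k U C \<longleftrightarrow> (\<exists>T H D W.
     fl_gram u (block_col s X (k + 1)) T \<and>
     fl_gram u (sc a (k + 1)) H \<and>
     fl_minus u T H D \<and>
     fl_chol u D C \<and>
     step_W u m s X a k W \<and>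
     fl_solve u C W U)"

definition step_2S ::
  "real \<Rightarrow> nat \<Rightarrow> nat \<Rightarrow> (real mat \<Rightarrow> real mat \<times> real mat) \<Rightarrow> real mat \<Rightarrow> bgs \<Rightarrow> nat \<Rightarrow>
   real mat \<Rightarrow> real mat \<Rightarrow> bool" where
  "step_2S u m s IO1 X a k U C \<longleftrightarrow> (\<exists>W. step_W u m s X a k W \<and> IO1 W = (U, C))"

text \<open>The rest of step \<open>k\<close>, where \<open>\<Omega>\<close> is the computed Gram matrix of \<open>U\<^bsub>k+1\<^esub>\<close>.\<close>

definition step_finish :: "real \<Rightarrow> nat \<Rightarrow> nat \<Rightarrow> bgs \<Rightarrow> nat \<Rightarrow> real mat \<Rightarrow> bool" where
  "step_finish u m s a k \<Omega> \<longleftrightarrow>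
     fl_mult u ((qcat m s a k)\<^sup>T) (ub a (k + 1)) (yc a (k + 1)) \<and>
     fl_gram u (ub a (k + 1)) \<Omega> \<and>
     (\<exists>H D. fl_gram u (yc a (k + 1)) H \<and> fl_minus u \<Omega> H D \<and> fl_chol u D (yd a (k + 1))) \<and>
     (\<exists>G W. fl_mult u (qcat m s a k) (yc a (k + 1)) G \<and> fl_minus u (ub a (k + 1)) G W \<and>
        fl_solve u (yd a (k + 1)) W (qb a (k + 1))) \<and>
     (\<exists>G. fl_mult u (yc a (k + 1)) (sd a (k + 1)) G \<and>
        fl_plus u (sc a (k + 1)) G (rc a (k + 1))) \<and>
     fl_mult u (yd a (k + 1)) (sd a (k + 1)) (rd a (k + 1))"

definition switch_test :: "real \<Rightarrow> real mat \<Rightarrow> bool" where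
  "switch_test cst \<Omega> \<longleftrightarrow> cst\<^sup>2 * lambda_min \<Omega> \<le> lambda_max \<Omega>"

text \<open>\<open>Q\<close>, \<open>R\<close> are a possible computed result of BCGSI+P-1S-2S, with \<open>d\<close> the first index at
  which the test holds (\<open>d = p + 1\<close> if there is none). The 1S quantities of step \<open>d - 1\<close> that
  trigger the switch are discarded.\<close>

definition bcgsi_p_1s_2s ::
  "real \<Rightarrow> real \<Rightarrow> nat \<Rightarrow> nat \<Rightarrow> nat \<Rightarrow> (real mat \<Rightarrow> real mat \<times> real mat) \<Rightarrow>
   (real mat \<Rightarrow> real mat \<times> real mat) \<Rightarrow> real mat \<Rightarrow> real mat \<Rightarrow> real mat \<Rightarrow> bool" where
  "bcgsi_p_1s_2s u cst m s p IOA IO1 X Q R \<longleftrightarrow> (\<exists>a d.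
     2 \<le> d \<and> d \<le> p + 1 \<and>
     IOA (block_col s X 1) = (qb a 1, rd a 1) \<and>
     (\<forall>k\<in>{1..<p}. step_S u m s X a k \<and>
        (if k + 1 < d
         then step_1S u m s X a k (ub a (k + 1)) (sd a (k + 1)) \<and>
              (\<exists>\<Omega>. step_finish u m s a k \<Omega> \<and> \<not> switch_test cst \<Omega>)
         else step_2S u m s IO1 X a k (ub a (k + 1)) (sd a (k + 1)) \<and>
              (\<exists>\<Omega>. step_finish u m s a k \<Omega>))) \<and>
     (d \<le> p \<longrightarrow> (\<exists>U C \<Omega>. step_1S u m s X a (d - 1) U C \<and> fl_gram u U \<Omega> \<and> switch_test cst \<Omega>)) \<and>
     Q = qcat m s a p \<and> R = rcat s a p)"

end

theory Submission
  imports Defs "HOL-Analysis.L2_Norm"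
begin

text \<open>
  Let \<open>Q\<^sub>k\<close>, \<open>R\<^sub>k\<close> be the computed factors of the first \<open>k\<close> block columns. The proof is an induction over
  \<open>k\<close> with three invariants: the residual \<open>[X\<^sub>1,...,X\<^sub>k] - Q\<^sub>k R\<^sub>k\<close> is \<open>O(k u) \<parallel>X\<parallel>\<close>, the loss of
  orthogonality \<open>\<omega>\<^sub>k\<close> of \<open>Q\<^sub>k\<close> is \<open>O(k u)\<close>, and \<open>S = S\<^bsub>1:k,k+1\<^esub>\<close> equals \<open>Q\<^sub>k\<^sup>T X\<^bsub>k+1\<^esub>\<close> up to \<open>O(u) \<parallel>X\<parallel>\<close>.

  The accuracy of the Cholesky factor \<open>S\<^bsub>k+1,k+1\<^esub>\<close> plays no role. All that matters about part (b) of
  a step is that \<open>U S\<^bsub>k+1,k+1\<^esub> = W + O(u) \<parallel>X\<parallel>\<close> for the computed \<open>W = X\<^bsub>k+1\<^esub> - Q\<^sub>k S\<close> and that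
  \<open>\<kappa>(U)\<close> is at most a constant \<open>K\<close>; the size of \<open>U\<close> is irrelevant, because everything that follows
  is invariant under scaling of \<open>U\<close>. In the 1S version \<open>\<kappa>(U) \<le> K\<close> is what a failing switching test
  says, and the triangular solve then has a small residual. In the 2S version both come from the
  hypothesis on \<open>IO\<^sub>1\<close>, which applies because \<open>\<kappa>(W)\<close> exceeds \<open>\<kappa>(X)\<close> by a factor close to 1 only.

  Since \<open>\<sigma>\<^sub>m\<^sub>i\<^sub>n(W)\<close> is almost \<open>\<sigma>\<^sub>m\<^sub>i\<^sub>n(X)\<close>, it follows that \<open>\<parallel>Q\<^sub>k\<^sup>T U\<parallel> \<le> \<eta> \<parallel>U\<parallel>\<close> with \<open>\<eta> = O(u) \<kappa>(X)\<close>. This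
  makes the second orthogonalization increase \<open>\<omega>\<^sub>k\<close> by \<open>O(u) + O(\<eta>) \<omega>\<^sub>k\<close> only; with \<open>\<eta> = O(1/p)\<close> the
  growth stays linear in \<open>k\<close> and all constants stay polynomial.
\<close>

section \<open>Finitely supported matrices\<close>

text \<open>The obstacle is compounding. A recursion in which \<open>\<omega>\<close> grows by a
  fixed factor per step would be exponential in p. The old \<open>\<omega>\<close> reaches the new
  block only through Y, so it arrives multiplied by \<open>\<eta>\<close>, which is itself of order
  K^3 p \<open>\<epsilon>\<close> \<kappa>(X). Requiring K^2 p times this quantity to be small turns
  the contribution of one step into a fixed multiple of K^3 \<open>\<epsilon>\<close>; this is where
  K^5 p^2 in the smallness condition comes from. The lower bound on the smallest singular value of W
  must not lose a constant factor either, since \<kappa>(W) has to stay near \<kappa>(X). It comes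
  from writing W v, up to small errors, as X y for some y that contains v as one of its blocks.
  Backward errors of triangular solves are relative to the computed solution. Each time, that
  solution is bounded first by absorbing a small multiple of its own norm. Positive Cholesky pivots
  are part of the data of a completed run, since a breakdown produces no result.\<close>

text \<open>Matrices of all sizes live in one normed algebra with involution, so that the error analysis
  is free of dimension side conditions. Block columns and identity matrices become the elements
  \<open>sel\<close> and \<open>pr\<close> below.\<close>

typedef fmat = "{f :: nat \<Rightarrow> nat \<Rightarrow> real. \<exists>n. \<forall>i j. n \<le> i \<or> n \<le> j \<longrightarrow> f i j = 0}"
  morphisms ent Fmat
  by (rule exI[of _ "\<lambda>i j. 0"]) auto

setup_lifting type_definition_fmat

definition supp_le :: "nat \<Rightarrow> fmat \<Rightarrow> bool" where
  "supp_le n a \<longleftrightarrow> (\<forall>i j. n \<le> i \<or> n \<le> j \<longrightarrow> ent a i j = 0)"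

lemma ex_supp: "\<exists>n. supp_le n a"
  using ent[of a] by (auto simp: supp_le_def)

lemma supp_le_mono: "supp_le n a \<Longrightarrow> n \<le> k \<Longrightarrow> supp_le k a"
  unfolding supp_le_def by (meson le_trans)

lemma ex_supp2: "\<exists>n. supp_le n a \<and> supp_le n b"
  by (metis ex_supp supp_le_mono nle_le)

lemma ex_supp3: "\<exists>n. supp_le n a \<and> supp_le n b \<and> supp_le n c"
  by (metis ex_supp ex_supp2 supp_le_mono nle_le)

lemma fmat_eqI: "(\<And>i j. ent a i j = ent b i j) \<Longrightarrow> a = b"
  by (metis ent_inject ext)

instantiation fmat :: ring
begin

lift_definition zero_fmat :: fmat is "\<lambda>i j. 0" by auto

lift_definition plus_fmat :: "fmat \<Rightarrow> fmat \<Rightarrow> fmat" is "\<lambda>f g i j. f i j + g i j"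
proof -
  fix f g :: "nat \<Rightarrow> nat \<Rightarrow> real"
  assume "\<exists>n. \<forall>i j. n \<le> i \<or> n \<le> j \<longrightarrow> f i j = 0" "\<exists>n. \<forall>i j. n \<le> i \<or> n \<le> j \<longrightarrow> g i j = 0"
  then obtain n k where "\<forall>i j. n \<le> i \<or> n \<le> j \<longrightarrow> f i j = 0" "\<forall>i j. k \<le> i \<or> k \<le> j \<longrightarrow> g i j = 0"
    by auto
  then show "\<exists>n. \<forall>i j. n \<le> i \<or> n \<le> j \<longrightarrow> f i j + g i j = 0"
    by (intro exI[of _ "max n k"]) auto
qed

lift_definition uminus_fmat :: "fmat \<Rightarrow> fmat" is "\<lambda>f i j. - f i j" by auto

definition minus_fmat :: "fmat \<Rightarrow> fmat \<Rightarrow> fmat" where "minus_fmat a b = a + - b"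

text \<open>Summing over the nonzero entries of a row of the left factor keeps the sum finite
  without fixing a size; \<open>ent_mult_cols\<close> replaces it by any initial range that contains
  them.\<close>

lift_definition times_fmat :: "fmat \<Rightarrow> fmat \<Rightarrow> fmat"
  is "\<lambda>f g i j. \<Sum>k | f i k \<noteq> 0. f i k * g k j"
proof -
  fix f g :: "nat \<Rightarrow> nat \<Rightarrow> real"
  assume "\<exists>n. \<forall>i j. n \<le> i \<or> n \<le> j \<longrightarrow> f i j = 0" "\<exists>n. \<forall>i j. n \<le> i \<or> n \<le> j \<longrightarrow> g i j = 0"
  then obtain n k where "\<forall>i j. n \<le> i \<or> n \<le> j \<longrightarrow> f i j = 0" "\<forall>i j. k \<le> i \<or> k \<le> j \<longrightarrow> g i j = 0"
    by auto
  then show "\<exists>n. \<forall>i j. n \<le> i \<or> n \<le> j \<longrightarrow> (\<Sum>k | f i k \<noteq> 0. f i k * g k j) = 0"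
    by (intro exI[of _ "max n k"]) auto
qed

lemma ent_mult_cols:
  "(\<And>k. n \<le> k \<Longrightarrow> ent a i k = 0) \<Longrightarrow> ent (a * b) i j = (\<Sum>k<n. ent a i k * ent b k j)"
  unfolding times_fmat.rep_eq
  by (rule sum.mono_neutral_left) (auto simp: not_less[symmetric])

lemma ent_mult: "supp_le n a \<Longrightarrow> ent (a * b) i j = (\<Sum>k<n. ent a i k * ent b k j)"
  by (rule ent_mult_cols) (simp add: supp_le_def)

instance
proof
  fix a b c :: fmat
  show "a + b + c = a + (b + c)" "a + b = b + a" "0 + a = a" "- a + a = 0" "a - b = a + - b"
    by (auto intro!: fmat_eqI simp: plus_fmat.rep_eq zero_fmat.rep_eq uminus_fmat.rep_eq minus_fmat_def)
  obtain n where n: "supp_le n a" "supp_le n b" "supp_le n c"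
    using ex_supp3 by blast
  have ab: "supp_le n (a * b)"
    using n by (auto simp: supp_le_def ent_mult[OF n(1)])
  have apb: "supp_le n (a + b)"
    using n by (auto simp: supp_le_def plus_fmat.rep_eq)
  show "a * b * c = a * (b * c)"
  proof (rule fmat_eqI)
    fix i j
    have "ent (a * b * c) i j = (\<Sum>k<n. \<Sum>l<n. ent a i l * ent b l k * ent c k j)"
      by (simp add: ent_mult[OF ab] ent_mult[OF n(1)] sum_distrib_right)
    also have "\<dots> = (\<Sum>l<n. \<Sum>k<n. ent a i l * ent b l k * ent c k j)"
      by (rule sum.swap)
    also have "\<dots> = ent (a * (b * c)) i j"
      by (simp add: ent_mult[OF n(1)] ent_mult[OF n(2)] sum_distrib_left mult.assoc)
    finally show "ent (a * b * c) i j = ent (a * (b * c)) i j" .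
  qed
  show "(a + b) * c = a * c + b * c"
    by (rule fmat_eqI) (simp add: ent_mult[OF apb] ent_mult[OF n(1)] ent_mult[OF n(2)]
        plus_fmat.rep_eq ring_distribs sum.distrib)
  show "a * (b + c) = a * b + a * c"
    by (rule fmat_eqI) (simp add: ent_mult[OF n(1)] plus_fmat.rep_eq ring_distribs sum.distrib)
qed

end

lemma ent_plus [simp]: "ent (a + b) i j = ent a i j + ent b i j"
  by (rule plus_fmat.rep_eq[THEN fun_cong, THEN fun_cong])

lemma ent_uminus [simp]: "ent (- a) i j = - ent a i j"
  by (rule uminus_fmat.rep_eq[THEN fun_cong, THEN fun_cong])

lemma ent_minus [simp]: "ent (a - b) i j = ent a i j - ent b i j"
  unfolding minus_fmat_def by (simp only: ent_plus ent_uminus)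

lemma ent_zero [simp]: "ent 0 i j = 0"
  by (simp add: zero_fmat.rep_eq)

section \<open>Action on truncated sequences and the operator norm\<close>

definition app :: "fmat \<Rightarrow> nat \<Rightarrow> (nat \<Rightarrow> real) \<Rightarrow> nat \<Rightarrow> real" where
  "app a n x i = (\<Sum>j<n. ent a i j * x j)"

text \<open>This is the bound for the operator on square-summable sequences, with argument and
  result truncated independently so that only finite sums occur.\<close>

definition fbound :: "fmat \<Rightarrow> real \<Rightarrow> bool" where
  "fbound a c \<longleftrightarrow> 0 \<le> c \<and>
     (\<forall>x N n. L2_set (app a n x) {..<N} \<le> c * L2_set x {..<n})"

lemma app_mult_cols:
  assumes "\<And>i k. n \<le> k \<Longrightarrow> ent a i k = 0"
  shows "app (a * b) l x = app a n (app b l x)"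
proof (rule ext)
  fix i
  have "app (a * b) l x i = (\<Sum>j<l. \<Sum>k<n. ent a i k * (ent b k j * x j))"
    by (simp add: app_def ent_mult_cols[of n, OF assms] sum_distrib_right mult.assoc)
  also have "\<dots> = app a n (app b l x) i"
    by (subst sum.swap) (simp add: app_def sum_distrib_left)
  finally show "app (a * b) l x i = app a n (app b l x) i" .
qed

lemma app_mult: "supp_le k a \<Longrightarrow> app (a * b) n x = app a k (app b n x)"
  by (rule app_mult_cols) (simp add: supp_le_def)

lemma fboundD: "fbound a c \<Longrightarrow> L2_set (app a n x) {..<N} \<le> c * L2_set x {..<n}"
  by (simp add: fbound_def)

lemma sum_lessThan_support:
  fixes f :: "nat \<Rightarrow> real"
  assumes "\<And>i. 0 \<le> f i" and "\<And>i. k \<le> i \<Longrightarrow> f i = 0"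
  shows "sum f {..<N} \<le> sum f {..<k}"
proof -
  have "sum f {..<N} \<le> sum f {..<max N k}"
    using assms by (intro sum_mono2) auto
  also have "\<dots> = sum f {..<k}"
    using assms(2) by (intro sum.mono_neutral_right) (auto simp: not_less)
  finally show ?thesis .
qed

text \<open>The factor n k is cruder than the Frobenius bound, which is harmless as long as
  constants only have to be polynomial. The lemma serves twice: for finiteness of the norm and for
  turning entrywise rounding errors into norm errors.\<close>

lemma fbound_entries:
  assumes out: "\<And>i j. n \<le> i \<or> k \<le> j \<Longrightarrow> ent a i j = 0"
    and ent: "\<And>i j. i < n \<Longrightarrow> j < k \<Longrightarrow> \<bar>ent a i j\<bar> \<le> c" and "0 \<le> c"
  shows "fbound a (real n * real k * c)"
  unfolding fbound_def
proof (intro conjI allI)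
  show "0 \<le> real n * real k * c" using \<open>0 \<le> c\<close> by simp
  fix x :: "nat \<Rightarrow> real" and N l :: nat
  let ?x = "L2_set x {..<l}"
  have app: "\<bar>app a l x i\<bar> \<le> real k * c * ?x" if "i < n" for i
  proof -
    have "\<bar>app a l x i\<bar> \<le> (\<Sum>j<l. \<bar>ent a i j\<bar> * \<bar>x j\<bar>)"
      unfolding app_def by (rule order_trans[OF sum_abs]) (simp add: abs_mult)
    also have "\<dots> \<le> (\<Sum>j<l. \<bar>ent a i j\<bar> * ?x)"
    proof (intro sum_mono mult_left_mono)
      fix j assume "j \<in> {..<l}"
      then have "\<bar>x j\<bar> \<le> L2_set (\<lambda>j. \<bar>x j\<bar>) {..<l}" by (intro member_le_L2_set) auto
      then show "\<bar>x j\<bar> \<le> ?x" by (simp add: L2_set_def)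
    qed auto
    also have "\<dots> = (\<Sum>j<l. \<bar>ent a i j\<bar>) * ?x"
      by (simp add: sum_distrib_right)
    also have "\<dots> \<le> (\<Sum>j<k. \<bar>ent a i j\<bar>) * ?x"
      using out by (intro mult_right_mono sum_lessThan_support) auto
    also have "\<dots> \<le> (\<Sum>j<k. c) * ?x"
      using ent that by (intro mult_right_mono sum_mono) auto
    finally show ?thesis by simp
  qed
  have "L2_set (app a l x) {..<N} \<le> (\<Sum>i<N. \<bar>app a l x i\<bar>)"
    by (rule L2_set_le_sum_abs)
  also have "\<dots> \<le> (\<Sum>i<n. \<bar>app a l x i\<bar>)"
    using out by (intro sum_lessThan_support) (auto simp: app_def)
  also have "\<dots> \<le> (\<Sum>i<n. real k * c * ?x)"
    using app by (intro sum_mono) auto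
  finally show "L2_set (app a l x) {..<N} \<le> real n * real k * c * ?x" by simp
qed

lemma ex_fbound: "\<exists>c. fbound a c"
proof -
  obtain n where n: "supp_le n a" using ex_supp by blast
  define c where "c = (\<Sum>i<n. \<Sum>j<n. \<bar>ent a i j\<bar>)"
  have "\<bar>ent a i j\<bar> \<le> c" if "i < n" "j < n" for i j
  proof -
    have "\<bar>ent a i j\<bar> \<le> (\<Sum>j<n. \<bar>ent a i j\<bar>)" using that by (intro member_le_sum) auto
    also have "\<dots> \<le> c" unfolding c_def
      using that by (intro member_le_sum[where f = "\<lambda>i. \<Sum>j<n. \<bar>ent a i j\<bar>"]) (auto intro: sum_nonneg)
    finally show ?thesis .
  qed
  moreover have "0 \<le> c" by (simp add: c_def sum_nonneg)
  ultimately have "fbound a (real n * real n * c)"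
    using n by (intro fbound_entries) (auto simp: supp_le_def)
  then show ?thesis by blast
qed

instantiation fmat :: real_normed_algebra
begin

lift_definition scaleR_fmat :: "real \<Rightarrow> fmat \<Rightarrow> fmat" is "\<lambda>r f i j. r * f i j" by auto

definition norm_fmat :: "fmat \<Rightarrow> real" where "norm_fmat a = Inf {c. fbound a c}"

definition dist_fmat :: "fmat \<Rightarrow> fmat \<Rightarrow> real" where "dist_fmat a b = norm (a - b)"

definition sgn_fmat :: "fmat \<Rightarrow> fmat" where "sgn_fmat a = inverse (norm a) *\<^sub>R a"

definition uniformity_fmat :: "(fmat \<times> fmat) filter" where
  "uniformity_fmat = (INF e\<in>{0<..}. principal {(x, y). dist x y < e})"

definition open_fmat :: "fmat set \<Rightarrow> bool" where
  "open_fmat U = (\<forall>x\<in>U. eventually (\<lambda>(x', y). x' = x \<longrightarrow> y \<in> U) uniformity)"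

lemma norm_fmat_le: "fbound a c \<Longrightarrow> norm a \<le> c"
  unfolding norm_fmat_def by (intro cInf_lower bdd_belowI[of _ 0]) (auto simp: fbound_def)

text \<open>The infimum is attained: each inequality survives passing to the infimum after division
  by the norm of the argument. For an argument of norm zero any admissible bound gives the
  claim.\<close>

lemma fbound_norm: "fbound a (norm a)"
  unfolding fbound_def
proof (intro conjI allI)
  show "0 \<le> norm a" unfolding norm_fmat_def
    using ex_fbound[of a] by (intro cInf_greatest) (auto simp: fbound_def)
  fix x N n
  show "L2_set (app a n x) {..<N} \<le> norm a * L2_set x {..<n}"
  proof (cases "L2_set x {..<n} = 0")
    case True
    obtain c where "fbound a c" using ex_fbound by blast
    then show ?thesis using fboundD[of a c n x N] True by simp
  next
    case False
    then have pos: "0 < L2_set x {..<n}" by (simp add: order_less_le)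
    have "L2_set (app a n x) {..<N} / L2_set x {..<n} \<le> norm a"
      unfolding norm_fmat_def using ex_fbound[of a] pos
      by (intro cInf_greatest) (auto simp: fbound_def divide_simps)
    then show ?thesis using pos by (simp add: divide_simps)
  qed
qed

lemma fbound_mult:
  assumes a: "fbound a c" and b: "fbound b d" shows "fbound (a * b) (c * d)"
  unfolding fbound_def
proof (intro conjI allI)
  show "0 \<le> c * d" using assms by (simp add: fbound_def)
  obtain k where k: "supp_le k a" using ex_supp by blast
  fix x N n
  have "app (a * b) n x = app a k (app b n x)"
    by (rule app_mult[OF k])
  then have "L2_set (app (a * b) n x) {..<N} \<le> c * L2_set (app b n x) {..<k}"
    using a by (simp add: fboundD)
  also have "\<dots> \<le> c * (d * L2_set x {..<n})"
    using a b by (intro mult_left_mono fboundD) (auto simp: fbound_def)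
  finally show "L2_set (app (a * b) n x) {..<N} \<le> c * d * L2_set x {..<n}" by simp
qed

lemma fbound_add:
  assumes "fbound a c" "fbound b d" shows "fbound (a + b) (c + d)"
  unfolding fbound_def
proof (intro conjI allI)
  show "0 \<le> c + d" using assms by (simp add: fbound_def)
  fix x N n
  have "app (a + b) n x = (\<lambda>i. app a n x i + app b n x i)"
    by (auto simp: app_def ring_distribs sum.distrib)
  then have "L2_set (app (a + b) n x) {..<N} \<le> L2_set (app a n x) {..<N} + L2_set (app b n x) {..<N}"
    by (simp add: L2_set_triangle_ineq)
  also have "\<dots> \<le> (c + d) * L2_set x {..<n}"
    using fboundD[OF assms(1), of n x N] fboundD[OF assms(2), of n x N] by (simp add: ring_distribs)
  finally show "L2_set (app (a + b) n x) {..<N} \<le> (c + d) * L2_set x {..<n}" .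
qed

lemma fbound_scaleR:
  assumes "fbound a c" shows "fbound (r *\<^sub>R a) (\<bar>r\<bar> * c)"
  unfolding fbound_def
proof (intro conjI allI)
  show "0 \<le> \<bar>r\<bar> * c" using assms by (simp add: fbound_def)
  fix x N n
  have "app (r *\<^sub>R a) n x = (\<lambda>i. r * app a n x i)"
    by (auto simp: app_def scaleR_fmat.rep_eq sum_distrib_left mult.assoc)
  moreover have "L2_set (\<lambda>i. r * app a n x i) {..<N} = \<bar>r\<bar> * L2_set (app a n x) {..<N}"
    by (simp add: L2_set_def power_mult_distrib real_sqrt_mult flip: sum_distrib_left)
  ultimately show "L2_set (app (r *\<^sub>R a) n x) {..<N} \<le> \<bar>r\<bar> * c * L2_set x {..<n}"
    using fboundD[OF assms] by (simp add: mult.assoc mult_left_mono)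
qed

lemma ent_le_norm_fmat: "\<bar>ent a i j\<bar> \<le> norm a"
proof -
  define x where "x = (\<lambda>k. if k = j then 1 else 0 :: real)"
  have "\<bar>ent a i j\<bar> = \<bar>app a (Suc j) x i\<bar>"
    by (simp add: app_def x_def)
  also have "\<dots> \<le> L2_set (app a (Suc j) x) {..<Suc i}"
    using member_le_L2_set[of "{..<Suc i}" i "\<lambda>i. \<bar>app a (Suc j) x i\<bar>"] by (simp add: L2_set_def)
  also have "\<dots> \<le> norm a * L2_set x {..<Suc j}" by (rule fboundD[OF fbound_norm])
  also have "L2_set x {..<Suc j} = 1"
    by (simp add: L2_set_def x_def if_distrib[of "\<lambda>x. x ^ 2"] cong: if_cong)
  finally show ?thesis by simp
qed

instance
proof
  fix a b c :: fmat and r t :: real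
  show "dist a b = norm (a - b)" "sgn a = inverse (norm a) *\<^sub>R a"
    by (simp_all add: dist_fmat_def sgn_fmat_def)
  show "uniformity = (INF e\<in>{0<..}. principal {(x, y :: fmat). dist x y < e})"
    by (rule uniformity_fmat_def)
  show "open U = (\<forall>x\<in>U. eventually (\<lambda>(x', y). x' = x \<longrightarrow> y \<in> U) uniformity)" for U :: "fmat set"
    by (rule open_fmat_def)
  show "r *\<^sub>R (a + b) = r *\<^sub>R a + r *\<^sub>R b" "(r + t) *\<^sub>R a = r *\<^sub>R a + t *\<^sub>R a"
    "r *\<^sub>R t *\<^sub>R a = (r * t) *\<^sub>R a" "1 *\<^sub>R a = a"
    by (auto intro!: fmat_eqI simp: scaleR_fmat.rep_eq ring_distribs)
  obtain n where n: "supp_le n a" using ex_supp by blast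
  then have n': "supp_le n (r *\<^sub>R a)" by (auto simp: supp_le_def scaleR_fmat.rep_eq)
  show "r *\<^sub>R a * b = r *\<^sub>R (a * b)" "a * r *\<^sub>R b = r *\<^sub>R (a * b)"
    by (auto intro!: fmat_eqI sum.cong simp: ent_mult[OF n] ent_mult[OF n'] scaleR_fmat.rep_eq sum_distrib_left)
  show "norm (a + b) \<le> norm a + norm b"
    by (intro norm_fmat_le fbound_add fbound_norm)
  show "norm (a * b) \<le> norm a * norm b"
    by (intro norm_fmat_le fbound_mult fbound_norm)
  show "norm a = 0 \<longleftrightarrow> a = 0"
  proof
    assume "norm a = 0"
    then show "a = 0" using ent_le_norm_fmat[of a] by (auto intro!: fmat_eqI)
  next
    assume "a = 0"
    then have "fbound a 0" by (simp add: fbound_def app_def L2_set_def)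
    then show "norm a = 0" using norm_fmat_le[of a 0] fbound_norm[of a] by (simp add: fbound_def)
  qed
  have le: "norm (r *\<^sub>R a) \<le> \<bar>r\<bar> * norm a" for r :: real and a :: fmat
    by (intro norm_fmat_le fbound_scaleR fbound_norm)
  show "norm (r *\<^sub>R a) = \<bar>r\<bar> * norm a"
  proof (cases "r = 0")
    case True
    then have "fbound (r *\<^sub>R a) 0" by (simp add: fbound_def app_def L2_set_def scaleR_fmat.rep_eq)
    then have "norm (r *\<^sub>R a) = 0"
      using norm_fmat_le[of "r *\<^sub>R a" 0] fbound_norm[of "r *\<^sub>R a"] by (simp add: fbound_def)
    then show ?thesis using True by simp
  next
    case False
    have "(1 / r) *\<^sub>R r *\<^sub>R a = a" using False
      by (auto intro!: fmat_eqI simp: scaleR_fmat.rep_eq)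
    then have "norm a \<le> \<bar>1 / r\<bar> * norm (r *\<^sub>R a)" using le[of "1 / r" "r *\<^sub>R a"] by simp
    then have "\<bar>r\<bar> * norm a \<le> norm (r *\<^sub>R a)" using False by (simp add: divide_simps mult.commute)
    then show ?thesis using le[of r a] by simp
  qed
qed

end

section \<open>Embedding matrices of arbitrary size\<close>

lift_definition star :: "fmat \<Rightarrow> fmat" is "\<lambda>f i j. f j i" by (erule ex_forward) simp

lemma ent_star [simp]: "ent (star a) i j = ent a j i"
  by (simp add: star.rep_eq)

lemma supp_le_star: "supp_le n a \<Longrightarrow> supp_le n (star a)"
  by (auto simp: supp_le_def)

lemma star_simps [simp]:
  "star (a + b) = star a + star b" "star (a - b) = star a - star b" "star (- a) = - star a"
  "star (star a) = a" "star 0 = 0"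
  by (auto intro!: fmat_eqI)

lemma star_mult [simp]: "star (a * b) = star b * star a"
proof -
  obtain n where n: "supp_le n a" "supp_le n b" using ex_supp2 by blast
  show ?thesis
    by (rule fmat_eqI) (simp add: ent_mult[OF n(1)] ent_mult[OF supp_le_star[OF n(2)]] mult.commute)
qed

text \<open>With z the image of x under \<open>star a\<close>, the squared length of z is the inner
  product of x with the image of z under \<open>a\<close>. By Cauchy-Schwarz it is at most c times
  the lengths of x and z, and one length of z cancels.\<close>

lemma fbound_star:
  assumes a: "fbound a c" shows "fbound (star a) c"
  unfolding fbound_def
proof (intro conjI allI)
  show c: "0 \<le> c" using a by (simp add: fbound_def)
  fix x N n
  define z where "z = app (star a) n x"
  define w where "w = app a N z"
  have "(L2_set z {..<N})\<^sup>2 = (\<Sum>j<N. z j * z j)"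
    by (simp add: L2_set_def sum_nonneg power2_eq_square)
  also have "\<dots> = (\<Sum>j<N. \<Sum>i<n. x i * (ent a i j * z j))"
    by (auto simp: z_def app_def sum_distrib_right intro!: sum.cong)
  also have "\<dots> = (\<Sum>i<n. x i * w i)"
    by (subst sum.swap) (simp add: w_def app_def sum_distrib_left)
  also have "\<dots> \<le> (\<Sum>i<n. \<bar>x i\<bar> * \<bar>w i\<bar>)"
    by (intro sum_mono) (metis abs_ge_self abs_mult)
  also have "\<dots> \<le> L2_set x {..<n} * L2_set w {..<n}"
    by (rule L2_set_mult_ineq)
  also have "\<dots> \<le> L2_set x {..<n} * (c * L2_set z {..<N})"
    unfolding w_def by (intro mult_left_mono fboundD a) auto
  finally have le: "L2_set z {..<N} * L2_set z {..<N} \<le> (c * L2_set x {..<n}) * L2_set z {..<N}"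
    by (simp add: power2_eq_square mult_ac)
  show "L2_set (app (star a) n x) {..<N} \<le> c * L2_set x {..<n}"
  proof (cases "L2_set z {..<N} = 0")
    case True
    then show ?thesis using c by (simp add: z_def)
  next
    case False
    then have "0 < L2_set z {..<N}" by (simp add: order_less_le)
    then show ?thesis using le by (simp add: z_def)
  qed
qed

lemma norm_star [simp]: "norm (star a) = norm a"
proof (rule antisym)
  show "norm (star a) \<le> norm a" for a
    by (intro norm_fmat_le fbound_star fbound_norm)
  from this[of "star a"] show "norm a \<le> norm (star a)" by (simp only: star_simps)
qed

text \<open>The C*-identity; the nontrivial half rewrites the squared length of \<open>a\<close> x
  as the inner product of x with \<open>star a * a\<close> applied to x. It is the bridge between
  bounds on Gram matrices and bounds on the matrices themselves.\<close>

lemma norm_star_mult: "norm (star a * a) = (norm a)\<^sup>2"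
proof (rule antisym)
  show "norm (star a * a) \<le> (norm a)\<^sup>2"
    using norm_mult_ineq[of "star a" a] by (simp add: power2_eq_square)
  obtain k where k: "supp_le k a" using ex_supp by blast
  have "fbound a (sqrt (norm (star a * a)))" unfolding fbound_def
  proof (intro conjI allI)
    fix x N n
    let ?w = "app a n x"
    have "(L2_set ?w {..<N})\<^sup>2 = (\<Sum>i<N. (?w i)\<^sup>2)"
      by (simp add: L2_set_def sum_nonneg)
    also have "\<dots> \<le> (\<Sum>i<k. (?w i)\<^sup>2)"
      using k by (intro sum_lessThan_support) (auto simp: supp_le_def app_def)
    also have "\<dots> = (\<Sum>i<k. \<Sum>j<n. x j * (ent a i j * ?w i))"
      by (auto simp: app_def power2_eq_square sum_distrib_right intro!: sum.cong)
    also have "\<dots> = (\<Sum>j<n. x j * (\<Sum>i<k. ent a i j * ?w i))"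
      by (subst sum.swap) (simp add: sum_distrib_left)
    also have "\<dots> = (\<Sum>j<n. x j * app (star a * a) n x j)"
      by (simp add: app_mult[OF supp_le_star[OF k]] app_def[of "star a"])
    also have "\<dots> \<le> (\<Sum>j<n. \<bar>x j\<bar> * \<bar>app (star a * a) n x j\<bar>)"
      by (intro sum_mono) (metis abs_ge_self abs_mult)
    also have "\<dots> \<le> L2_set x {..<n} * L2_set (app (star a * a) n x) {..<n}"
      by (rule L2_set_mult_ineq)
    also have "\<dots> \<le> L2_set x {..<n} * (norm (star a * a) * L2_set x {..<n})"
      by (intro mult_left_mono fboundD fbound_norm) auto
    also have "\<dots> = (sqrt (norm (star a * a)) * L2_set x {..<n})\<^sup>2"
      by (simp add: power_mult_distrib power2_eq_square)
    finally show "L2_set ?w {..<N} \<le> sqrt (norm (star a * a)) * L2_set x {..<n}"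
      by (rule power2_le_imp_le) auto
  qed simp
  then have "norm a \<le> sqrt (norm (star a * a))" by (rule norm_fmat_le)
  then show "(norm a)\<^sup>2 \<le> norm (star a * a)"
    using power_mono[of "norm a" "sqrt (norm (star a * a))" 2] by simp
qed


section \<open>The embedding and truncated identities\<close>

lift_definition emb :: "real mat \<Rightarrow> fmat"
  is "\<lambda>A i j. if i < dim_row A \<and> j < dim_col A then A $$ (i, j) else 0"
proof -
  fix A :: "real mat"
  show "\<exists>n. \<forall>i j. n \<le> i \<or> n \<le> j \<longrightarrow> (if i < dim_row A \<and> j < dim_col A then A $$ (i, j) else 0) = 0"
    by (rule exI[of _ "max (dim_row A) (dim_col A)"]) auto
qed

lemma ent_emb: "ent (emb A) i j = (if i < dim_row A \<and> j < dim_col A then A $$ (i, j) else 0)"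
  by (simp add: emb.rep_eq)

lemma emb_add: "A \<in> carrier_mat n k \<Longrightarrow> B \<in> carrier_mat n k \<Longrightarrow> emb (A + B) = emb A + emb B"
  by (rule fmat_eqI) (auto simp: ent_emb)

lemma emb_minus: "A \<in> carrier_mat n k \<Longrightarrow> B \<in> carrier_mat n k \<Longrightarrow> emb (A - B) = emb A - emb B"
  by (rule fmat_eqI) (auto simp: ent_emb)

lemma emb_transpose: "emb (A\<^sup>T) = star (emb A)"
  by (rule fmat_eqI) (auto simp: ent_emb)

lemma emb_mult:
  assumes "A \<in> carrier_mat n k" "B \<in> carrier_mat k l" shows "emb (A * B) = emb A * emb B"
proof (rule fmat_eqI)
  fix i j
  have "ent (emb A * emb B) i j = (\<Sum>h<k. ent (emb A) i h * ent (emb B) h j)"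
    using assms by (intro ent_mult_cols) (auto simp: ent_emb)
  also have "\<dots> = ent (emb (A * B)) i j"
    using assms by (auto simp: ent_emb scalar_prod_def lessThan_atLeast0)
  finally show "ent (emb (A * B)) i j = ent (emb A * emb B) i j" by simp
qed

definition pr :: "nat \<Rightarrow> fmat" where "pr n = emb (1\<^sub>m n)"

lemma ent_pr: "ent (pr n) i j = (if i = j \<and> i < n then 1 else 0)"
  by (auto simp: pr_def ent_emb)

lemma ent_pr_mult [simp]: "ent (pr n * a) i j = (if i < n then ent a i j else 0)"
  by (subst ent_mult_cols[of n])
    (auto simp: ent_pr if_distrib[of "\<lambda>x. x * _"] sum.delta cong: if_cong)

lemma star_pr [simp]: "star (pr n) = pr n"
  by (rule fmat_eqI) (auto simp: ent_pr)

lemma ent_mult_pr [simp]: "ent (a * pr n) i j = (if j < n then ent a i j else 0)"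
proof -
  have "ent (a * pr n) i j = ent (pr n * star a) j i"
    by (metis ent_star star_mult star_pr)
  then show ?thesis by simp
qed

lemma pr_mult_pr [simp]: "pr n * pr n = pr n"
  by (rule fmat_eqI) (auto simp: ent_pr)

text \<open>A selfadjoint idempotent: the C*-identity forces its norm t to satisfy t = t^2.\<close>

lemma norm_pr_le: "norm (pr n) \<le> 1"
proof -
  have "norm (pr n) = (norm (pr n))\<^sup>2" using norm_star_mult[of "pr n"] by simp
  then show ?thesis by (cases "norm (pr n) = 0") (simp_all add: power2_eq_square)
qed

lemma norm_pr: "0 < n \<Longrightarrow> norm (pr n) = 1"
  using norm_pr_le[of n] ent_le_norm_fmat[of "pr n" 0 0] by (simp add: ent_pr)

lemma pr_emb: "A \<in> carrier_mat n k \<Longrightarrow> pr n * emb A = emb A"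
  and emb_pr: "A \<in> carrier_mat n k \<Longrightarrow> emb A * pr k = emb A"
  by (auto intro!: fmat_eqI simp: ent_emb)

section \<open>Comparison with vector and matrix norms\<close>

lemma vnorm_L2: "vnorm v = L2_set (($) v) {..<dim_vec v}"
  by (simp add: vnorm_def L2_set_def scalar_prod_def power2_eq_square lessThan_atLeast0)

lemma mult_vec_app:
  assumes "A \<in> carrier_mat n k" "v \<in> carrier_vec k" "i < n"
  shows "(A *\<^sub>v v) $ i = app (emb A) k (($) v) i"
  using assms by (auto simp: app_def ent_emb scalar_prod_def lessThan_atLeast0 intro!: sum.cong)

lemma L2_set_cong': "(\<And>i. i \<in> A \<Longrightarrow> f i = g i) \<Longrightarrow> L2_set f A = L2_set g A"
  by (rule L2_set_cong) auto

lemma vnorm_mult_app: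
  assumes "A \<in> carrier_mat n k" "v \<in> carrier_vec k"
  shows "vnorm (A *\<^sub>v v) = L2_set (app (emb A) k (($) v)) {..<n}"
  unfolding vnorm_L2 using assms mult_vec_app[OF assms]
  by (auto simp del: index_mult_mat_vec intro!: L2_set_cong')

lemma vnorm_nonneg [simp]: "0 \<le> vnorm v" by (simp add: vnorm_L2)

lemma vnorm_sq: "(vnorm v)\<^sup>2 = v \<bullet> v"
  by (simp add: vnorm_def scalar_prod_def sum_nonneg)

lemma vnorm_mult_le:
  assumes "A \<in> carrier_mat n k" "v \<in> carrier_vec k"
  shows "vnorm (A *\<^sub>v v) \<le> norm (emb A) * vnorm v"
  unfolding vnorm_mult_app[OF assms] using fboundD[OF fbound_norm, of "emb A" k "($) v" n] assms
  by (simp add: vnorm_L2)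

lemma norm_emb_le:
  assumes A: "A \<in> carrier_mat n k" and c: "0 \<le> c"
    and le: "\<And>v. v \<in> carrier_vec k \<Longrightarrow> vnorm (A *\<^sub>v v) \<le> c * vnorm v"
  shows "norm (emb A) \<le> c"
proof (rule norm_fmat_le)
  show "fbound (emb A) c" unfolding fbound_def
  proof (intro conjI allI c)
    fix x :: "nat \<Rightarrow> real" and N l :: nat
    \<comment> \<open>The first l coordinates of x, cut or padded to length k. Columns of
      \<open>A\<close> beyond k are zero, so the image is the same, while the length can only
      drop.\<close>
    define v where "v = vec k (\<lambda>j. if j < l then x j else 0)"
    have v: "v \<in> carrier_vec k" by (simp add: v_def)
    have app: "app (emb A) l x i = app (emb A) k (($) v) i" for i
    proof -
      have "app (emb A) l x i = (\<Sum>j\<in>{..<l} \<inter> {..<k}. ent (emb A) i j * x j)"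
        unfolding app_def using A by (intro sum.mono_neutral_right) (auto simp: ent_emb)
      also have "\<dots> = (\<Sum>j\<in>{..<l} \<inter> {..<k}. ent (emb A) i j * v $ j)"
        by (intro sum.cong) (auto simp: v_def)
      also have "\<dots> = app (emb A) k (($) v) i"
        unfolding app_def by (intro sum.mono_neutral_left) (auto simp: v_def)
      finally show ?thesis .
    qed
    have "L2_set (app (emb A) l x) {..<N} = sqrt (\<Sum>i<N. (app (emb A) k (($) v) i)\<^sup>2)"
      by (simp add: L2_set_def app)
    also have "\<dots> \<le> sqrt (\<Sum>i<n. (app (emb A) k (($) v) i)\<^sup>2)"
      using A by (intro real_sqrt_le_mono sum_lessThan_support) (auto simp: app_def ent_emb)
    also have "\<dots> = vnorm (A *\<^sub>v v)"
      by (simp add: vnorm_mult_app[OF A v] L2_set_def)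
    also have "\<dots> \<le> c * vnorm v" by (rule le[OF v])
    also have "vnorm v \<le> L2_set x {..<l}"
    proof -
      have "(\<Sum>j<k. (v $ j)\<^sup>2) = (\<Sum>j<k. (if j < l then x j else 0)\<^sup>2)"
        by (simp add: v_def)
      also have "\<dots> \<le> (\<Sum>j<l. (if j < l then x j else 0)\<^sup>2)"
        by (intro sum_lessThan_support) auto
      finally show ?thesis by (simp add: vnorm_L2 L2_set_def v_def)
    qed
    finally show "L2_set (app (emb A) l x) {..<N} \<le> c * L2_set x {..<l}"
      using c by (simp add: mult_left_mono)
  qed
qed

lemma vnorm_smult: "vnorm (c \<cdot>\<^sub>v v) = \<bar>c\<bar> * vnorm v"
  by (simp add: vnorm_def real_sqrt_mult flip: mult.assoc)

lemma vnorm_0_iff: "v \<in> carrier_vec n \<Longrightarrow> vnorm v = 0 \<longleftrightarrow> v = 0\<^sub>v n"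
  by (auto simp: vnorm_L2 L2_set_def sum_nonneg_eq_0_iff intro!: eq_vecI)

text \<open>Without columns there is no unit vector and \<open>mnorm\<close> is the supremum of the
  empty set, hence the assumption on k.\<close>

lemma mnorm_eq:
  assumes A: "A \<in> carrier_mat n k" and k: "0 < k"
  shows "mnorm A = norm (emb A)"
proof -
  let ?S = "{vnorm (A *\<^sub>v v) | v. v \<in> carrier_vec (dim_col A) \<and> vnorm v = 1}"
  have le: "x \<le> norm (emb A)" if "x \<in> ?S" for x
    using that vnorm_mult_le[OF A] A by fastforce
  then have bdd: "bdd_above ?S" by (meson bdd_aboveI)
  have "vnorm (unit_vec k 0) = 1" using k by (simp add: vnorm_def)
  then have ne: "?S \<noteq> {}" using A by fastforce
  have "mnorm A \<le> norm (emb A)"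
    unfolding mnorm_def using le ne by (intro cSup_least) auto
  moreover have "norm (emb A) \<le> mnorm A"
  proof (rule norm_emb_le[OF A])
    show "0 \<le> mnorm A"
      using ne cSup_upper[OF _ bdd] vnorm_nonneg unfolding mnorm_def
      by (smt (verit, ccfv_SIG) Collect_empty_eq mem_Collect_eq)
    fix v :: "real vec" assume v: "v \<in> carrier_vec k"
    show "vnorm (A *\<^sub>v v) \<le> mnorm A * vnorm v"
    proof (cases "vnorm v = 0")
      case True
      then show ?thesis using vnorm_mult_le[OF A v] by simp
    next
      case False
      then have pos: "0 < vnorm v" using vnorm_nonneg[of v] by linarith
      have "vnorm (A *\<^sub>v ((1 / vnorm v) \<cdot>\<^sub>v v)) \<le> mnorm A"
        unfolding mnorm_def using pos v A by (intro cSup_upper bdd) (auto simp: vnorm_smult intro!: exI[of _ "(1 / vnorm v) \<cdot>\<^sub>v v"])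
      moreover have "A *\<^sub>v ((1 / vnorm v) \<cdot>\<^sub>v v) = (1 / vnorm v) \<cdot>\<^sub>v (A *\<^sub>v v)"
        using A v by (intro mult_mat_vec)
      ultimately show ?thesis using pos by (simp add: vnorm_smult divide_simps)
    qed
  qed
  ultimately show ?thesis by simp
qed

section \<open>Vectors as columns, lower bounds and inverses\<close>

definition colv :: "real vec \<Rightarrow> fmat" where "colv v = emb (mat_of_cols (dim_vec v) [v])"

lemma ent_colv: "ent (colv v) i j = (if i < dim_vec v \<and> j = 0 then v $ i else 0)"
  by (auto simp: colv_def ent_emb mat_of_cols_def)

lemma emb_colv:
  assumes "A \<in> carrier_mat n k" "v \<in> carrier_vec k" shows "emb A * colv v = colv (A *\<^sub>v v)"
proof (rule fmat_eqI)
  fix i j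
  have "ent (emb A * colv v) i j = (\<Sum>h<k. ent (emb A) i h * ent (colv v) h j)"
    using assms by (intro ent_mult_cols) (auto simp: ent_emb)
  also have "\<dots> = ent (colv (A *\<^sub>v v)) i j"
    using assms by (auto simp: ent_emb ent_colv scalar_prod_def lessThan_atLeast0 intro!: sum.cong)
  finally show "ent (emb A * colv v) i j = ent (colv (A *\<^sub>v v)) i j" .
qed

lemma pr_colv: "v \<in> carrier_vec n \<Longrightarrow> pr n * colv v = colv v"
  by (rule fmat_eqI) (auto simp: ent_colv)

lemma norm_colv: "norm (colv v) = vnorm v"
proof -
  obtain n where n: "dim_vec v = n" by blast
  have "norm (colv v) \<le> vnorm v"
    unfolding colv_def
  proof (rule norm_emb_le)
    show "mat_of_cols (dim_vec v) [v] \<in> carrier_mat n 1" using n by (simp add: mat_of_cols_def)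
    show "0 \<le> vnorm v" by simp
    fix x :: "real vec" assume x: "x \<in> carrier_vec 1"
    have "mat_of_cols (dim_vec v) [v] *\<^sub>v x = x $ 0 \<cdot>\<^sub>v v"
      using x by (intro eq_vecI) (auto simp: mat_of_cols_def scalar_prod_def)
    moreover have "vnorm x = \<bar>x $ 0\<bar>" using x by (simp add: vnorm_def scalar_prod_def)
    ultimately show "vnorm (mat_of_cols (dim_vec v) [v] *\<^sub>v x) \<le> vnorm v * vnorm x"
      by (simp add: vnorm_smult)
  qed
  moreover have "vnorm v \<le> norm (colv v)"
  proof -
    have "vnorm v = L2_set (app (colv v) 1 (\<lambda>_. 1)) {..<n}"
      unfolding vnorm_L2 n by (intro L2_set_cong) (auto simp: app_def ent_colv n)
    also have "\<dots> \<le> norm (colv v) * L2_set (\<lambda>_. 1) {..<1::nat}"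
      by (rule fboundD[OF fbound_norm])
    finally show ?thesis by (simp add: L2_set_def)
  qed
  ultimately show ?thesis by simp
qed

text \<open>The smallest singular value on the range of \<open>pr k\<close> is at least \<open>c\<close>; quantifying over matrices
  instead of vectors keeps the statement inside the algebra.\<close>

definition low :: "nat \<Rightarrow> fmat \<Rightarrow> real \<Rightarrow> bool" where
  "low k a c \<longleftrightarrow> (\<forall>v. pr k * v = v \<longrightarrow> c * norm v \<le> norm (a * v))"

lemma lowD: "low k a c \<Longrightarrow> pr k * v = v \<Longrightarrow> c * norm v \<le> norm (a * v)"
  by (simp add: low_def)

text \<open>From matrices to vectors, a vector is taken as a single column. Conversely, for a matrix
  v the vector inequality is applied to every image y of v, which shows that
  \<open>norm (emb A * v) / c\<close> bounds v as an operator.\<close>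

lemma low_emb_iff:
  assumes A: "A \<in> carrier_mat n k"
  shows "low k (emb A) c \<longleftrightarrow> (\<forall>v\<in>carrier_vec k. c * vnorm v \<le> vnorm (A *\<^sub>v v))"
proof
  assume "low k (emb A) c"
  then show "\<forall>v\<in>carrier_vec k. c * vnorm v \<le> vnorm (A *\<^sub>v v)"
    using lowD pr_colv by (metis norm_colv emb_colv[OF A])
next
  assume le: "\<forall>v\<in>carrier_vec k. c * vnorm v \<le> vnorm (A *\<^sub>v v)"
  show "low k (emb A) c"
    unfolding low_def
  proof (intro allI impI)
    fix v assume v: "pr k * v = v"
    show "c * norm v \<le> norm (emb A * v)"
    proof (cases "c \<le> 0")
      case True
      then show ?thesis by (meson mult_nonpos_nonneg norm_ge_zero order_trans)
    next
      case False
      have "fbound v (norm (emb A * v) / c)" unfolding fbound_def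
      proof (intro conjI allI)
        show "0 \<le> norm (emb A * v) / c" using False by simp
        fix x :: "nat \<Rightarrow> real" and N l :: nat
        define y where "y = vec k (app v l x)"
        have y: "y \<in> carrier_vec k" by (simp add: y_def)
        have v0: "ent v i j = 0" if "k \<le> i" for i j
          using that arg_cong[OF v, of "\<lambda>a. ent a i j"] by simp
        have "L2_set (app v l x) {..<N} \<le> vnorm y"
          unfolding vnorm_L2 L2_set_def using v0
          by (auto intro!: real_sqrt_le_mono order_trans[OF sum_lessThan_support[of _ k]] sum_mono
              simp: app_def y_def)
        also have "vnorm y \<le> vnorm (A *\<^sub>v y) / c"
          using le y False by (simp add: divide_simps mult.commute)
        also have "vnorm (A *\<^sub>v y) = L2_set (app (emb A * v) l x) {..<n}"
          unfolding vnorm_mult_app[OF A y]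
        proof (intro L2_set_cong)
          fix i
          have "app (emb A * v) l x i = app (emb A) k (app v l x) i"
            using A by (subst app_mult_cols[of k]) (auto simp: ent_emb)
          then show "app (emb A) k (($) y) i = app (emb A * v) l x i"
            by (simp add: app_def y_def)
        qed simp
        also have "\<dots> \<le> norm (emb A * v) * L2_set x {..<l}"
          by (rule fboundD[OF fbound_norm])
        finally show "L2_set (app v l x) {..<N} \<le> norm (emb A * v) / c * L2_set x {..<l}"
          using False by (simp add: divide_right_mono)
      qed
      then have "norm v \<le> norm (emb A * v) / c" by (rule norm_fmat_le)
      then show ?thesis using False by (simp add: divide_simps mult.commute)
    qed
  qed
qed

text \<open>The lower bound makes the kernel of the square matrix trivial. Once the inverse exists,
  the bound is applied to the inverse itself in place of v, and this yields its norm.\<close>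

lemma low_inverse:
  assumes C: "C \<in> carrier_mat s s" and low: "low s (emb C) c" and c: "0 < c"
  shows "\<exists>d. d * emb C = pr s \<and> emb C * d = pr s \<and> pr s * d = d \<and> d * pr s = d \<and> norm d \<le> 1 / c"
proof -
  have "det C \<noteq> 0"
  proof
    assume "det C = 0"
    then obtain v where v: "v \<in> carrier_vec s" "v \<noteq> 0\<^sub>v s" "C *\<^sub>v v = 0\<^sub>v s"
      using det_0_iff_vec_prod_zero_field[OF C] by blast
    have "c * vnorm v \<le> vnorm (C *\<^sub>v v)" using low v low_emb_iff[OF C] by blast
    also have "\<dots> = 0" using v(3) by (simp add: vnorm_def)
    finally have "vnorm v = 0" using c vnorm_nonneg[of v] by (simp add: mult_le_0_iff)
    then show False using v vnorm_0_iff by blast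
  qed
  from det_non_zero_imp_unit[OF C this, of "()"]
  obtain D where D: "D \<in> carrier_mat s s" "D * C = 1\<^sub>m s" "C * D = 1\<^sub>m s"
    by (auto simp: Units_def ring_mat_def)
  have "emb D * emb C = pr s" "emb C * emb D = pr s"
    using emb_mult[OF D(1) C] emb_mult[OF C D(1)] D by (simp_all add: pr_def)
  moreover have "c * norm (emb D) \<le> norm (emb C * emb D)"
    using lowD[OF low] pr_emb[OF D(1)] by blast
  then have "c * norm (emb D) \<le> 1" using norm_pr_le[of s] calculation(2) by simp
  then have "norm (emb D) \<le> 1 / c" using c by (simp add: divide_simps mult.commute)
  ultimately show ?thesis using pr_emb[OF D(1)] emb_pr[OF D(1)] by blast
qed

section \<open>Extreme eigenvalues and singular values\<close>

text \<open>This replaces compactness of the unit sphere: if the infimum \<open>\<mu>\<close> of the Rayleigh quotient were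
  not an eigenvalue, then \<open>A - \<mu> I\<close> would be nonsingular and the infimum larger.\<close>

lemma quad_form_pos_definite:
  fixes B :: "real mat"
  assumes B: "B \<in> carrier_mat n n" and sym: "B\<^sup>T = B"
    and psd: "\<And>v. v \<in> carrier_vec n \<Longrightarrow> 0 \<le> v \<bullet> (B *\<^sub>v v)" and det: "det B \<noteq> 0"
  shows "\<exists>c>0. \<forall>v\<in>carrier_vec n. c * (v \<bullet> v) \<le> v \<bullet> (B *\<^sub>v v)"
proof -
  from det_non_zero_imp_unit[OF B det, of "()"]
  obtain D where D: "D \<in> carrier_mat n n" "B * D = 1\<^sub>m n"
    by (auto simp: Units_def ring_mat_def)
  define K where "K = norm (emb D) + 1"
  have K: "K > 0" unfolding K_def by (smt (verit) norm_ge_zero)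
  have "(1 / K) * (v \<bullet> v) \<le> v \<bullet> (B *\<^sub>v v)" if v: "v \<in> carrier_vec n" for v
  proof -
    define w where "w = D *\<^sub>v v"
    have w: "w \<in> carrier_vec n" using D v by (simp add: w_def)
    have Bw: "B *\<^sub>v w = v"
      using assoc_mult_mat_vec[OF B D(1) v] D(2) v by (simp add: w_def)
    \<comment> \<open>The form is tested on u = v - t w, where B w = v. Nonnegativity there gives v
      . B v \<ge> 2 t (v . v) - t^2 (w . v), and t = 1/K is chosen so that the last term costs only
      one of the two multiples of t.\<close>
    define t where "t = 1 / K"
    define u where "u = v - t \<cdot>\<^sub>v w"
    have u: "u \<in> carrier_vec n" using v w by (simp add: u_def)
    have Bv: "B *\<^sub>v v \<in> carrier_vec n" using B v by simp
    have Bu: "B *\<^sub>v u = B *\<^sub>v v - t \<cdot>\<^sub>v v"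
      unfolding u_def using mult_minus_distrib_mat_vec[OF B v, of "t \<cdot>\<^sub>v w"] mult_mat_vec[OF B w, of t] w Bw
      by simp
    have wBv: "w \<bullet> (B *\<^sub>v v) = v \<bullet> v"
      using transpose_vec_mult_scalar[OF B v w] sym Bw by simp
    have "u \<bullet> (B *\<^sub>v u) = v \<bullet> (B *\<^sub>v v) - t * (v \<bullet> v) - (t * (w \<bullet> (B *\<^sub>v v)) - t * (t * (w \<bullet> v)))"
      unfolding Bu using v w Bv unfolding u_def
      by (simp add: minus_scalar_prod_distrib[of _ n] scalar_prod_minus_distrib[of _ n] right_diff_distrib)
    then have "0 \<le> v \<bullet> (B *\<^sub>v v) - 2 * t * (v \<bullet> v) + t\<^sup>2 * (w \<bullet> v)"
      using psd[OF u] wBv by (simp add: power2_eq_square algebra_simps)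
    moreover have "w \<bullet> v \<le> K * (v \<bullet> v)"
    proof -
      have "w \<bullet> v \<le> (\<Sum>i<n. \<bar>w $ i\<bar> * \<bar>v $ i\<bar>)"
        using v w unfolding scalar_prod_def
        by (auto simp: lessThan_atLeast0 intro!: sum_mono) (metis abs_ge_self abs_mult)
      also have "\<dots> \<le> vnorm w * vnorm v"
        using L2_set_mult_ineq[of "($) w" "($) v" "{..<n}"] v w by (simp add: vnorm_L2)
      also have "\<dots> \<le> norm (emb D) * vnorm v * vnorm v"
        using vnorm_mult_le[OF D(1) v] by (intro mult_right_mono) (auto simp: w_def)
      also have "\<dots> = norm (emb D) * (v \<bullet> v)"
        by (simp add: mult.assoc flip: power2_eq_square vnorm_sq)
      also have "\<dots> \<le> K * (v \<bullet> v)"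
        by (intro mult_right_mono) (auto simp: K_def simp flip: vnorm_sq)
      finally show ?thesis .
    qed
    then have "t\<^sup>2 * (w \<bullet> v) \<le> t\<^sup>2 * (K * (v \<bullet> v))" by (intro mult_left_mono) auto
    moreover have "t\<^sup>2 * (K * (v \<bullet> v)) = t * (v \<bullet> v)"
      using K by (simp add: t_def power2_eq_square)
    ultimately show ?thesis by (simp add: t_def)
  qed
  then show ?thesis using K by (intro exI[of _ "1 / K"]) auto
qed

lemma abs_quad_form_le:
  assumes A: "A \<in> carrier_mat n n" and v: "v \<in> carrier_vec n"
  shows "\<bar>v \<bullet> (A *\<^sub>v v)\<bar> \<le> norm (emb A) * (v \<bullet> v)"
proof -
  have "\<bar>v \<bullet> (A *\<^sub>v v)\<bar> \<le> (\<Sum>i<n. \<bar>v $ i\<bar> * \<bar>(A *\<^sub>v v) $ i\<bar>)"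
    using A v unfolding scalar_prod_def[of v]
    by (auto simp: lessThan_atLeast0 abs_mult intro!: order_trans[OF sum_abs] sum_mono)
  also have "\<dots> \<le> vnorm v * vnorm (A *\<^sub>v v)"
    using L2_set_mult_ineq[of "($) v" "($) (A *\<^sub>v v)" "{..<n}"] v A by (simp add: vnorm_L2)
  also have "\<dots> \<le> vnorm v * (norm (emb A) * vnorm v)"
    using vnorm_mult_le[OF A v] by (intro mult_left_mono) auto
  also have "\<dots> = norm (emb A) * (v \<bullet> v)"
    by (simp add: power2_eq_square flip: vnorm_sq)
  finally show ?thesis .
qed

lemma symmetric_min_eigenvalue:
  fixes A :: "real mat"
  assumes A: "A \<in> carrier_mat n n" and sym: "A\<^sup>T = A" and n: "0 < n"
  shows "\<exists>\<mu>. eigenvalue A \<mu> \<and> (\<forall>v\<in>carrier_vec n. \<mu> * (v \<bullet> v) \<le> v \<bullet> (A *\<^sub>v v))"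
proof -
  define S where "S = {v \<bullet> (A *\<^sub>v v) | v. v \<in> carrier_vec n \<and> v \<bullet> v = 1}"
  define \<mu> where "\<mu> = Inf S"
  have ne: "S \<noteq> {}"
    using n unfolding S_def by (auto intro!: exI[of _ "unit_vec n 0"])
  have bdd: "bdd_below S"
    using abs_quad_form_le[OF A] unfolding S_def
    by (intro bdd_belowI[of _ "- norm (emb A)"]) fastforce
  have le: "\<mu> * (v \<bullet> v) \<le> v \<bullet> (A *\<^sub>v v)" if v: "v \<in> carrier_vec n" for v
  proof (cases "vnorm v = 0")
    case True
    then show ?thesis using vnorm_0_iff[OF v] A v by simp
  next
    case False
    then have pos: "0 < vnorm v" using vnorm_nonneg[of v] by linarith
    define w where "w = (1 / vnorm v) \<cdot>\<^sub>v v"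
    have w: "w \<in> carrier_vec n" using v by (simp add: w_def)
    have "w \<bullet> w = 1" using pos by (simp add: w_def vnorm_smult flip: vnorm_sq)
    then have "\<mu> \<le> w \<bullet> (A *\<^sub>v w)"
      unfolding \<mu>_def using w by (intro cInf_lower bdd) (auto simp: S_def)
    also have "\<dots> = (v \<bullet> (A *\<^sub>v v)) / (vnorm v)\<^sup>2"
      unfolding w_def mult_mat_vec[OF A v] using A v
      by (simp add: power2_eq_square)
    finally show ?thesis using pos by (simp add: vnorm_sq[symmetric] divide_simps)
  qed
  have "eigenvalue A \<mu>"
  proof (rule ccontr)
    assume "\<not> eigenvalue A \<mu>"
    then have det: "det (char_matrix A \<mu>) \<noteq> 0" using eigenvalue_det[OF A] by simp
    let ?B = "char_matrix A \<mu>"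
    have B: "?B \<in> carrier_mat n n" using A by simp
    have symB: "?B\<^sup>T = ?B"
    proof (rule eq_matI)
      fix i j assume "i < dim_row ?B" "j < dim_col ?B"
      then have ij: "i < n" "j < n" using B by auto
      have "A $$ (i, j) = A $$ (j, i)"
        using arg_cong[OF sym, of "\<lambda>M. M $$ (i, j)"] ij A by simp
      then show "?B\<^sup>T $$ (i, j) = ?B $$ (i, j)" using ij A by (auto simp: char_matrix_def)
    qed (use B in auto)
    have quad: "v \<bullet> (?B *\<^sub>v v) = v \<bullet> (A *\<^sub>v v) - \<mu> * (v \<bullet> v)" if v: "v \<in> carrier_vec n" for v
    proof -
      have one: "((- \<mu>) \<cdot>\<^sub>m 1\<^sub>m n) *\<^sub>v v = (- \<mu>) \<cdot>\<^sub>v v"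
        using v by (intro eq_vecI) (auto simp: row_smult)
      have "?B *\<^sub>v v = A *\<^sub>v v + (- \<mu>) \<cdot>\<^sub>v v"
        unfolding char_matrix_def using A v one by (simp add: add_mult_distrib_mat_vec[of _ n n])
      then show ?thesis using A v by (simp add: scalar_prod_add_distrib[of _ n])
    qed
    obtain c where c: "c > 0" "\<forall>v\<in>carrier_vec n. c * (v \<bullet> v) \<le> v \<bullet> (?B *\<^sub>v v)"
      using quad_form_pos_definite[OF B symB _ det] le quad by force
    have "\<mu> + c \<le> x" if "x \<in> S" for x
      using that c(2) quad by (fastforce simp: S_def)
    then have "\<mu> + c \<le> \<mu>" unfolding \<mu>_def by (intro cInf_greatest ne)
    then show False using c by simp
  qed
  then show ?thesis using le by blast
qed

lemma eigenvalue_quad_form: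
  fixes A :: "real mat"
  assumes A: "A \<in> carrier_mat n n" and ev: "eigenvalue A e"
  shows "\<exists>v\<in>carrier_vec n. 0 < v \<bullet> v \<and> v \<bullet> (A *\<^sub>v v) = e * (v \<bullet> v)"
proof -
  obtain v where v: "v \<in> carrier_vec n" "v \<noteq> 0\<^sub>v n" "A *\<^sub>v v = e \<cdot>\<^sub>v v"
    using ev A by (auto simp: eigenvalue_def eigenvector_def)
  then have "0 < (vnorm v)\<^sup>2" using vnorm_0_iff[OF v(1)] by (simp add: zero_less_power2)
  then show ?thesis using v by (intro bexI[of _ v]) (auto simp: vnorm_sq)
qed

text \<open>Together these say that \<open>lambda_min\<close> is the greatest lower bound of the
  Rayleigh quotient. They and their counterparts for \<open>lambda_max\<close> are the form in which
  the later arguments use spectra.\<close>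

lemma lambda_min_properties:
  assumes A: "A \<in> carrier_mat n n" and sym: "A\<^sup>T = A" and n: "0 < n"
  shows lambda_min_le: "\<And>v. v \<in> carrier_vec n \<Longrightarrow> lambda_min A * (v \<bullet> v) \<le> v \<bullet> (A *\<^sub>v v)"
    and le_lambda_min: "\<And>c. (\<And>v. v \<in> carrier_vec n \<Longrightarrow> c * (v \<bullet> v) \<le> v \<bullet> (A *\<^sub>v v)) \<Longrightarrow> c \<le> lambda_min A"
proof -
  obtain \<mu> where \<mu>: "eigenvalue A \<mu>" and le: "\<And>v. v \<in> carrier_vec n \<Longrightarrow> \<mu> * (v \<bullet> v) \<le> v \<bullet> (A *\<^sub>v v)"
    using symmetric_min_eigenvalue[OF assms] by blast
  have eq: "lambda_min A = \<mu>" unfolding lambda_min_def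
  proof (rule Min_eqI)
    show "finite (spectrum A)" by (rule card_finite_spectrum[OF A])
    show "\<mu> \<in> spectrum A" using \<mu> by (simp add: spectrum_def)
    fix e assume "e \<in> spectrum A"
    then obtain v where "v \<in> carrier_vec n" "0 < v \<bullet> v" "v \<bullet> (A *\<^sub>v v) = e * (v \<bullet> v)"
      using eigenvalue_quad_form[OF A] by (auto simp: spectrum_def)
    then show "\<mu> \<le> e" using le by (metis mult_le_cancel_right_pos)
  qed
  show "\<And>v. v \<in> carrier_vec n \<Longrightarrow> lambda_min A * (v \<bullet> v) \<le> v \<bullet> (A *\<^sub>v v)" using le eq by simp
  fix c assume c: "\<And>v. v \<in> carrier_vec n \<Longrightarrow> c * (v \<bullet> v) \<le> v \<bullet> (A *\<^sub>v v)"
  obtain v where "v \<in> carrier_vec n" "0 < v \<bullet> v" "v \<bullet> (A *\<^sub>v v) = \<mu> * (v \<bullet> v)"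
    using eigenvalue_quad_form[OF A \<mu>] by auto
  then show "c \<le> lambda_min A" using c eq by (metis mult_le_cancel_right_pos)
qed

lemma uminus_mult_vec: "A \<in> carrier_mat n k \<Longrightarrow> v \<in> carrier_vec k \<Longrightarrow> (- A :: real mat) *\<^sub>v v = - (A *\<^sub>v v)"
  by (intro eq_vecI) (auto simp: scalar_prod_def sum_negf)

lemma eigenvalue_uminus:
  assumes A: "(A :: real mat) \<in> carrier_mat n n" shows "eigenvalue (- A) e \<longleftrightarrow> eigenvalue A (- e)"
proof -
  have "eigenvector (- A) v e \<longleftrightarrow> eigenvector A v (- e)" for v
  proof (cases "v \<in> carrier_vec n")
    case True
    then have "(- A) *\<^sub>v v = e \<cdot>\<^sub>v v \<longleftrightarrow> A *\<^sub>v v = (- e) \<cdot>\<^sub>v v"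
      using A by (auto simp: uminus_mult_vec[OF A] vec_eq_iff)
    then show ?thesis using A by (simp add: eigenvector_def)
  qed (use A in \<open>simp add: eigenvector_def\<close>)
  then show ?thesis by (simp add: eigenvalue_def)
qed

lemma lambda_max_uminus:
  assumes A: "(A :: real mat) \<in> carrier_mat n n" and sym: "A\<^sup>T = A" and n: "0 < n"
  shows "lambda_max A = - lambda_min (- A)"
proof -
  have m: "spectrum (- A) = uminus ` spectrum A"
    using eigenvalue_uminus[OF A] by (force simp: spectrum_def image_iff)
  obtain \<mu> where "eigenvalue A \<mu>" using symmetric_min_eigenvalue[OF assms] by blast
  then have "spectrum A \<noteq> {}" by (auto simp: spectrum_def)
  then show ?thesis
    unfolding lambda_max_def lambda_min_def m using card_finite_spectrum(1)[OF A]
    by (simp flip: minus_Max_eq_Min)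
qed

lemma lambda_max_properties:
  assumes A: "A \<in> carrier_mat n n" and sym: "A\<^sup>T = A" and n: "0 < n"
  shows le_lambda_max: "\<And>v. v \<in> carrier_vec n \<Longrightarrow> v \<bullet> (A *\<^sub>v v) \<le> lambda_max A * (v \<bullet> v)"
    and lambda_max_le: "\<And>c. (\<And>v. v \<in> carrier_vec n \<Longrightarrow> v \<bullet> (A *\<^sub>v v) \<le> c * (v \<bullet> v)) \<Longrightarrow> lambda_max A \<le> c"
proof -
  have A': "- A \<in> carrier_mat n n" using A by simp
  have sym': "(- A)\<^sup>T = - A"
    using sym by (metis transpose_uminus)
  have q: "v \<bullet> ((- A) *\<^sub>v v) = - (v \<bullet> (A *\<^sub>v v))" if v: "v \<in> carrier_vec n" for v
    using A v uminus_mult_vec[OF A v] by (simp add: scalar_prod_uminus_right)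
  show "v \<bullet> (A *\<^sub>v v) \<le> lambda_max A * (v \<bullet> v)" if "v \<in> carrier_vec n" for v
    using lambda_min_le[OF A' sym' n that] q[OF that] lambda_max_uminus[OF assms] by simp
  show "lambda_max A \<le> c" if c: "\<And>v. v \<in> carrier_vec n \<Longrightarrow> v \<bullet> (A *\<^sub>v v) \<le> c * (v \<bullet> v)" for c
    using le_lambda_min[OF A' sym' n, of "- c"] c q lambda_max_uminus[OF assms] by fastforce
qed

lemma gram_quad_form:
  assumes A: "A \<in> carrier_mat m k" and v: "v \<in> carrier_vec k"
  shows "v \<bullet> ((A\<^sup>T * A) *\<^sub>v v) = (vnorm (A *\<^sub>v v))\<^sup>2"
proof -
  have At: "A\<^sup>T \<in> carrier_mat k m" using A by simp
  have "v \<bullet> ((A\<^sup>T * A) *\<^sub>v v) = v \<bullet> (A\<^sup>T *\<^sub>v (A *\<^sub>v v))"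
    using assoc_mult_mat_vec[OF At A v] by simp
  also have "\<dots> = (A *\<^sub>v v) \<bullet> (A *\<^sub>v v)"
    using transpose_vec_mult_scalar[OF A v, of "A *\<^sub>v v"] A v
    by (simp add: comm_scalar_prod[of v k])
  finally show ?thesis by (simp add: vnorm_sq)
qed

section \<open>Singular values of a rectangular matrix\<close>

context
  fixes A :: "real mat" and m k :: nat
  assumes A: "A \<in> carrier_mat m k" and k: "0 < k"
begin

lemma gram_props: "A\<^sup>T * A \<in> carrier_mat k k" "(A\<^sup>T * A)\<^sup>T = A\<^sup>T * A"
  using A transpose_mult[of "A\<^sup>T" k m A k] by auto

lemma lambda_min_gram_nonneg: "0 \<le> lambda_min (A\<^sup>T * A)"
  by (rule le_lambda_min[OF gram_props k]) (simp add: gram_quad_form[OF A])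

lemma low_sigma_min: "low k (emb A) (sigma_min A)"
  unfolding low_emb_iff[OF A]
proof
  fix v :: "real vec" assume v: "v \<in> carrier_vec k"
  have "(sigma_min A * vnorm v)\<^sup>2 \<le> (vnorm (A *\<^sub>v v))\<^sup>2"
    using lambda_min_le[OF gram_props k v] lambda_min_gram_nonneg
    by (simp add: gram_quad_form[OF A v] sigma_min_def power_mult_distrib vnorm_sq)
  then show "sigma_min A * vnorm v \<le> vnorm (A *\<^sub>v v)"
    by (rule power2_le_imp_le) simp
qed

text \<open>With \<open>low_sigma_min\<close> this makes \<open>sigma_min A\<close> the best
  constant in \<open>low\<close>, so that perturbation results for \<open>low\<close> become results
  on singular values.\<close>

lemma le_sigma_min:
  assumes "low k (emb A) c" shows "c \<le> sigma_min A"
proof (cases "0 \<le> c")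
  case True
  have "c\<^sup>2 \<le> lambda_min (A\<^sup>T * A)"
  proof (rule le_lambda_min[OF gram_props k])
    fix v :: "real vec" assume v: "v \<in> carrier_vec k"
    have "(c * vnorm v)\<^sup>2 \<le> (vnorm (A *\<^sub>v v))\<^sup>2"
      using assms v True unfolding low_emb_iff[OF A] by (intro power_mono) auto
    then show "c\<^sup>2 * (v \<bullet> v) \<le> v \<bullet> ((A\<^sup>T * A) *\<^sub>v v)"
      by (simp add: gram_quad_form[OF A v] power_mult_distrib vnorm_sq)
  qed
  then show ?thesis unfolding sigma_min_def by (rule real_le_rsqrt)
next
  case False
  then show ?thesis using lambda_min_gram_nonneg by (simp add: sigma_min_def order_trans[of c 0])
qed

lemma lambda_max_gram: "lambda_max (A\<^sup>T * A) = (norm (emb A))\<^sup>2"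
proof (rule antisym)
  show "lambda_max (A\<^sup>T * A) \<le> (norm (emb A))\<^sup>2"
  proof (rule lambda_max_le[OF gram_props k])
    fix v :: "real vec" assume v: "v \<in> carrier_vec k"
    have "(vnorm (A *\<^sub>v v))\<^sup>2 \<le> (norm (emb A) * vnorm v)\<^sup>2"
      using vnorm_mult_le[OF A v] by (intro power_mono) auto
    then show "v \<bullet> ((A\<^sup>T * A) *\<^sub>v v) \<le> (norm (emb A))\<^sup>2 * (v \<bullet> v)"
      by (simp add: gram_quad_form[OF A v] power_mult_distrib vnorm_sq)
  qed
  have le: "vnorm (A *\<^sub>v v) \<le> sqrt (lambda_max (A\<^sup>T * A)) * vnorm v" if v: "v \<in> carrier_vec k" for v
    using real_sqrt_le_mono[OF le_lambda_max[OF gram_props k v]]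
    by (simp add: gram_quad_form[OF A v] real_sqrt_mult vnorm_def)
  have nn: "0 \<le> lambda_max (A\<^sup>T * A)"
  proof -
    have "0 \<le> unit_vec k 0 \<bullet> ((A\<^sup>T * A) *\<^sub>v unit_vec k 0)"
      by (simp only: gram_quad_form[OF A unit_vec_carrier] zero_le_power2)
    also have "\<dots> \<le> lambda_max (A\<^sup>T * A) * (unit_vec k 0 \<bullet> unit_vec k 0)"
      by (intro le_lambda_max[OF gram_props k] unit_vec_carrier)
    finally show ?thesis using k by simp
  qed
  have "norm (emb A) \<le> sqrt (lambda_max (A\<^sup>T * A))"
    using nn le by (intro norm_emb_le[OF A]) auto
  then show "(norm (emb A))\<^sup>2 \<le> lambda_max (A\<^sup>T * A)"
    using nn power_mono[of "norm (emb A)" "sqrt (lambda_max (A\<^sup>T * A))" 2] by simp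
qed

lemma sigma_max_eq: "sigma_max A = norm (emb A)"
  by (simp add: sigma_max_def lambda_max_gram)

end

section \<open>Rounding errors of scalar operations\<close>

lemma power_one_plus_le:
  fixes u :: real
  assumes "0 \<le> u" "real n * u \<le> 1"
  shows "(1 + u) ^ n - 1 \<le> 2 * real n * u"
proof -
  have "(1 + u) ^ n \<le> exp u ^ n"
    using assms by (intro power_mono) (auto simp: exp_ge_add_one_self)
  also have "\<dots> = exp (real n * u)" by (simp add: exp_of_nat_mult)
  also have "\<dots> \<le> 1 + real n * u + (real n * u)\<^sup>2"
    using assms by (intro exp_bound) auto
  also have "(real n * u)\<^sup>2 \<le> real n * u"
    using assms by (simp add: power2_eq_square mult_left_le)
  finally show ?thesis by linarith
qed

lemma flD:
  assumes "fl u x y" shows "\<bar>y - x\<bar> \<le> u * \<bar>x\<bar>"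
proof -
  obtain \<delta> where \<delta>: "\<bar>\<delta>\<bar> \<le> u" "y = x * (1 + \<delta>)" using assms by (auto simp: fl_def)
  have "y - x = \<delta> * x" unfolding \<delta>(2) by (simp add: algebra_simps)
  then show ?thesis using \<delta>(1) by (simp add: abs_mult mult_right_mono)
qed

lemma abs_sum_mset_le: "\<bar>\<Sum>\<^sub># A\<bar> \<le> (\<Sum>x\<in>#A. \<bar>x\<bar>)" for A :: "real multiset"
  by (induction A) (auto intro: order_trans[OF abs_triangle_ineq])

lemma abs_sum_mset_nonneg: "0 \<le> (\<Sum>x\<in>#A. \<bar>x\<bar>)" for A :: "real multiset"
  by (induction A) auto

lemma fl_sum_nonempty: "fl_sum u A y \<Longrightarrow> 1 \<le> size A"
  by (induction rule: fl_sum.induct) auto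

text \<open>Any summation tree with n leaves has n - 1 additions, so no term collects more than n -
  1 factors 1 + \<delta>, whatever the order.\<close>

lemma fl_sum_error:
  assumes "fl_sum u A y" "0 \<le> u"
  shows "\<bar>y - \<Sum>\<^sub># A\<bar> \<le> ((1 + u) ^ (size A - 1) - 1) * (\<Sum>x\<in>#A. \<bar>x\<bar>)"
  using assms
proof (induction rule: fl_sum.induct)
  case (single x)
  then show ?case by simp
next
  case (add A a B b c)
  define k l where "k = size A - 1" and "l = size B - 1"
  have kl: "size (A + B) - 1 = Suc (k + l)"
    using fl_sum_nonempty[OF add(1)] fl_sum_nonempty[OF add(2)] by (simp add: k_def l_def)
  define sA sB where "sA = (\<Sum>x\<in>#A. \<bar>x\<bar>)" and "sB = (\<Sum>x\<in>#B. \<bar>x\<bar>)"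
  have s: "0 \<le> sA" "0 \<le> sB" "\<bar>\<Sum>\<^sub># A\<bar> \<le> sA" "\<bar>\<Sum>\<^sub># B\<bar> \<le> sB"
    unfolding sA_def sB_def by (rule abs_sum_mset_nonneg abs_sum_mset_le)+
  have mono: "(1 + u) ^ k \<le> (1 + u) ^ (k + l)" "(1 + u) ^ l \<le> (1 + u) ^ (k + l)"
    using add.prems by (auto intro: power_increasing)
  \<comment> \<open>One power serves both subtrees and leaves exactly one factor 1 + u for the final
    addition.\<close>
  define G where "G = (1 + u) ^ (k + l)"
  have A: "\<bar>a - \<Sum>\<^sub># A\<bar> \<le> (G - 1) * sA" and B: "\<bar>b - \<Sum>\<^sub># B\<bar> \<le> (G - 1) * sB"
    using add.IH add.prems mono s
      mult_right_mono[of "(1 + u) ^ k - 1" "G - 1" sA] mult_right_mono[of "(1 + u) ^ l - 1" "G - 1" sB]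
    unfolding sA_def sB_def k_def l_def G_def by linarith+
  have "\<bar>a + b\<bar> \<le> G * (sA + sB)"
    using A B s by (simp add: algebra_simps)
  then have "u * \<bar>a + b\<bar> \<le> u * (G * (sA + sB))"
    using add.prems by (intro mult_left_mono)
  then have "\<bar>c - (a + b)\<bar> \<le> u * (G * (sA + sB))"
    using flD[OF add(3)] by linarith
  then have "\<bar>c - (\<Sum>\<^sub># A + \<Sum>\<^sub># B)\<bar> \<le> u * (G * (sA + sB)) + (G - 1) * sA + (G - 1) * sB"
    using A B by linarith
  then show ?case
    unfolding kl by (simp add: sA_def sB_def G_def algebra_simps)
qed

lemma fl_products_error:
  assumes t: "\<And>l. l < n \<Longrightarrow> fl u (b l * c l) (t l)" and u: "0 \<le> u"
  shows "\<bar>(\<Sum>l<n. t l) - (\<Sum>l<n. b l * c l)\<bar> \<le> u * (\<Sum>l<n. \<bar>b l\<bar> * \<bar>c l\<bar>)"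
    and "(\<Sum>l<n. \<bar>t l\<bar>) \<le> (1 + u) * (\<Sum>l<n. \<bar>b l\<bar> * \<bar>c l\<bar>)"
proof -
  have err: "\<bar>t l - b l * c l\<bar> \<le> u * (\<bar>b l\<bar> * \<bar>c l\<bar>)" if "l < n" for l
    using flD[OF t[OF that]] by (simp add: abs_mult)
  have "\<bar>\<Sum>l<n. t l - b l * c l\<bar> \<le> (\<Sum>l<n. u * (\<bar>b l\<bar> * \<bar>c l\<bar>))"
    using err by (intro order_trans[OF sum_abs] sum_mono) auto
  then show "\<bar>(\<Sum>l<n. t l) - (\<Sum>l<n. b l * c l)\<bar> \<le> u * (\<Sum>l<n. \<bar>b l\<bar> * \<bar>c l\<bar>)"
    by (simp add: sum_subtractf sum_distrib_left)
  have "(\<Sum>l<n. \<bar>t l\<bar>) \<le> (\<Sum>l<n. (1 + u) * (\<bar>b l\<bar> * \<bar>c l\<bar>))"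
  proof (intro sum_mono)
    fix l assume "l \<in> {..<n}"
    then have "\<bar>t l\<bar> \<le> \<bar>b l * c l\<bar> + u * (\<bar>b l\<bar> * \<bar>c l\<bar>)" using err[of l] by auto
    then show "\<bar>t l\<bar> \<le> (1 + u) * (\<bar>b l\<bar> * \<bar>c l\<bar>)" by (simp add: ring_distribs abs_mult)
  qed
  then show "(\<Sum>l<n. \<bar>t l\<bar>) \<le> (1 + u) * (\<Sum>l<n. \<bar>b l\<bar> * \<bar>c l\<bar>)" by (simp add: sum_distrib_left)
qed

lemma fl_dot_error:
  assumes "fl_dot u v w y" "0 \<le> u" and w: "dim_vec w = dim_vec v" and n: "real (dim_vec v) * u \<le> 1"
  shows "\<bar>y - v \<bullet> w\<bar> \<le> 2 * real (dim_vec v) * u * (\<Sum>l<dim_vec v. \<bar>v $ l\<bar> * \<bar>w $ l\<bar>)"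
proof -
  let ?n = "dim_vec v"
  obtain t where t: "\<And>l. l < ?n \<Longrightarrow> fl u (v $ l * w $ l) (t l)"
    and y: "fl_sum u (image_mset t (mset_set {..<?n})) y"
    using assms(1) by (auto simp: fl_dot_def)
  define S where "S = (\<Sum>l<?n. \<bar>v $ l\<bar> * \<bar>w $ l\<bar>)"
  have S: "0 \<le> S" by (auto simp: S_def intro: sum_nonneg)
  have pos: "1 \<le> ?n" using fl_sum_nonempty[OF y] by simp
  define G where "G = (1 + u) ^ (?n - 1)"
  have G: "1 \<le> G" using assms(2) by (simp add: G_def)
  note prods = fl_products_error[of ?n u "($) v" "($) w" t, OF t assms(2), folded S_def]
  have "\<bar>y - (\<Sum>l<?n. t l)\<bar> \<le> (G - 1) * (\<Sum>l<?n. \<bar>t l\<bar>)"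
    using fl_sum_error[OF y assms(2)] by (simp add: G_def sum_unfold_sum_mset image_mset.compositionality comp_def)
  also have "\<dots> \<le> (G - 1) * ((1 + u) * S)"
    using prods(2) G by (intro mult_left_mono) auto
  finally have "\<bar>y - v \<bullet> w\<bar> \<le> (G - 1) * ((1 + u) * S) + u * S"
    using prods(1) by (simp add: scalar_prod_def w lessThan_atLeast0)
  \<comment> \<open>The n - 1 additions contribute G and the product contributes the remaining
    factor: (G - 1)(1 + u) + u = G (1 + u) - 1.\<close>
  also have "\<dots> = ((1 + u) ^ ?n - 1) * S"
    using power_Suc[of "1 + u" "?n - 1"] pos by (simp add: G_def algebra_simps)
  also have "\<dots> \<le> (2 * real ?n * u) * S"
    using power_one_plus_le[OF assms(2) n] S by (intro mult_right_mono)
  finally show ?thesis by (simp add: S_def)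
qed

lemma fl_resid_error:
  assumes "fl_resid u a n b c y" "0 \<le> u" and n: "real (Suc n) * u \<le> 1"
  shows "\<bar>y - (a - (\<Sum>l<n. b l * c l))\<bar> \<le> 2 * real (Suc n) * u * (\<bar>a\<bar> + (\<Sum>l<n. \<bar>b l\<bar> * \<bar>c l\<bar>))"
proof -
  obtain t where t: "\<And>l. l < n \<Longrightarrow> fl u (b l * c l) (t l)"
    and y: "fl_sum u (add_mset a (image_mset (\<lambda>l. - t l) (mset_set {..<n}))) y"
    using assms(1) by (auto simp: fl_resid_def)
  define S where "S = (\<Sum>l<n. \<bar>b l\<bar> * \<bar>c l\<bar>)"
  have S: "0 \<le> S" by (auto simp: S_def intro: sum_nonneg)
  define G where "G = (1 + u) ^ n"
  have G: "1 \<le> G" using assms(2) by (simp add: G_def)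
  note prods = fl_products_error[of n u b c t, OF t assms(2), folded S_def]
  have "\<bar>y - (a - (\<Sum>l<n. t l))\<bar> \<le> (G - 1) * (\<bar>a\<bar> + (\<Sum>l<n. \<bar>t l\<bar>))"
    using fl_sum_error[OF y assms(2)]
    by (simp add: G_def sum_unfold_sum_mset image_mset.compositionality comp_def sum_negf flip: sum_unfold_sum_mset)
  also have "\<dots> \<le> (G - 1) * (\<bar>a\<bar> + (1 + u) * S)"
    using prods(2) G by (intro mult_left_mono) auto
  finally have "\<bar>y - (a - (\<Sum>l<n. b l * c l))\<bar> \<le> (G - 1) * (\<bar>a\<bar> + (1 + u) * S) + u * S"
    using prods(1) by linarith
  \<comment> \<open>The term a undergoes no multiplication; granting it the factor 1 + u as well
    makes the bound uniform in all terms.\<close>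
  also have "\<dots> \<le> (G - 1) * ((1 + u) * \<bar>a\<bar> + (1 + u) * S) + u * S + u * \<bar>a\<bar>"
    using G assms(2) by (intro add_increasing2[of "u * \<bar>a\<bar>"] add_right_mono mult_left_mono) (auto simp: algebra_simps)
  also have "\<dots> = ((1 + u) ^ Suc n - 1) * (\<bar>a\<bar> + S)"
    by (simp add: G_def algebra_simps)
  also have "\<dots> \<le> (2 * real (Suc n) * u) * (\<bar>a\<bar> + S)"
    using power_one_plus_le[OF assms(2) n] S by (intro mult_right_mono) auto
  finally show ?thesis by (simp add: S_def)
qed

text \<open>A backward error: it is measured against the products of computed quantities rather than
  against a. In matrix form this becomes a residual relative to the norms of the two
  factors.\<close>

lemma fl_resid_quotient_error:
  assumes res: "fl_resid u a n b c r" and x: "fl u (r / d) x" and d: "d \<noteq> 0"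
    and u: "0 \<le> u" and n: "real (Suc n) \<le> M" and M: "32 * M * u \<le> 1"
  shows "\<bar>(\<Sum>l<n. b l * c l) + x * d - a\<bar> \<le> 8 * M * u * ((\<Sum>l<n. \<bar>b l\<bar> * \<bar>c l\<bar>) + \<bar>x\<bar> * \<bar>d\<bar>)"
proof -
  define S where "S = (\<Sum>l<n. \<bar>b l\<bar> * \<bar>c l\<bar>)"
  define h where "h = M * u"
  define P where "P = (\<Sum>l<n. b l * c l)"
  have S: "0 \<le> S" by (auto simp: S_def intro: sum_nonneg)
  have P: "\<bar>P\<bar> \<le> S" unfolding P_def S_def
    by (rule order_trans[OF sum_abs]) (simp add: abs_mult)
  have nu: "real (Suc n) * u \<le> h" unfolding h_def using n u by (rule mult_right_mono)
  have h: "u \<le> h" "32 * h \<le> 1"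
    using nu u M mult_right_mono[of 1 "real (Suc n)" u] by (auto simp: h_def)
  have "real (Suc n) * u \<le> 1" using nu h by linarith
  from fl_resid_error[OF res u this]
  have "\<bar>r - (a - P)\<bar> \<le> 2 * (real (Suc n) * u) * (\<bar>a\<bar> + S)"
    unfolding S_def P_def by (simp only: mult.assoc)
  also have "\<dots> \<le> 2 * h * (\<bar>a\<bar> + S)"
    using nu S by (intro mult_right_mono) auto
  finally have 1: "\<bar>r - (a - P)\<bar> \<le> 2 * h * (\<bar>a\<bar> + S)" .
  obtain \<delta> where \<delta>: "\<bar>\<delta>\<bar> \<le> u" "x = r / d * (1 + \<delta>)" using x by (auto simp: fl_def)
  then have xd: "x * d = r * (1 + \<delta>)" using d by simp
  have "\<bar>r\<bar> * (31 / 32) \<le> \<bar>r\<bar> * \<bar>1 + \<delta>\<bar>"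
    using \<delta> h by (intro mult_left_mono) auto
  then have r: "\<bar>r\<bar> \<le> 2 * (\<bar>x\<bar> * \<bar>d\<bar>)" using xd by (simp add: abs_mult[symmetric])
  have "x * d - r = \<delta> * r" unfolding xd by (simp add: algebra_simps)
  then have "\<bar>x * d - r\<bar> = \<bar>\<delta>\<bar> * \<bar>r\<bar>" by (simp add: abs_mult)
  also have "\<dots> \<le> h * (2 * (\<bar>x\<bar> * \<bar>d\<bar>))" using \<delta> h r by (intro mult_mono) auto
  finally have 2: "\<bar>x * d - r\<bar> \<le> h * (2 * (\<bar>x\<bar> * \<bar>d\<bar>))" .
  define E where "E = \<bar>P + x * d - a\<bar>"
  define T where "T = S + \<bar>x\<bar> * \<bar>d\<bar>"
  have E: "E \<le> 2 * h * (\<bar>a\<bar> + T)" using 1 2 by (simp add: E_def T_def algebra_simps)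
  \<comment> \<open>This removes a from the bound at the price of E reappearing on the right with
    the factor 2 h \<le> 1/16, where it is absorbed.\<close>
  have "\<bar>a\<bar> \<le> E + T" using P abs_mult[of x d] unfolding E_def T_def by linarith
  then have "2 * h * (\<bar>a\<bar> + T) \<le> 2 * h * (E + T + T)" using h u by (intro mult_left_mono) auto
  moreover have "h * E \<le> 1 / 32 * E" using h by (intro mult_right_mono) (auto simp: E_def)
  moreover have "0 \<le> h * T" using h u S by (simp add: T_def)
  ultimately have "E \<le> 8 * h * T" using E by (simp add: algebra_simps)
  then show ?thesis by (simp add: E_def T_def h_def P_def S_def)
qed

text \<open>The diagonal counterpart: all products are squares, so the right-hand side is a diagonal
  entry of the Gram matrix of the computed factor.\<close>

lemma fl_resid_sqrt_error:
  assumes res: "fl_resid u a n b b r" and x: "fl u (sqrt r) x" and r: "0 < r"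
    and u: "0 \<le> u" and n: "real (Suc n) \<le> M" and M: "32 * M * u \<le> 1"
  shows "\<bar>(\<Sum>l<n. b l * b l) + x * x - a\<bar> \<le> 16 * M * u * ((\<Sum>l<n. b l * b l) + x * x)"
    and "0 < x"
proof -
  define S where "S = (\<Sum>l<n. b l * b l)"
  define h where "h = M * u"
  have S: "0 \<le> S" by (auto simp: S_def intro: sum_nonneg)
  have nu: "real (Suc n) * u \<le> h" unfolding h_def using n u by (rule mult_right_mono)
  have h: "u \<le> h" "32 * h \<le> 1"
    using nu u M mult_right_mono[of 1 "real (Suc n)" u] by (auto simp: h_def)
  have "real (Suc n) * u \<le> 1" using nu h by linarith
  from fl_resid_error[OF res u this]
  have "\<bar>r - (a - S)\<bar> \<le> 2 * (real (Suc n) * u) * (\<bar>a\<bar> + S)"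
    unfolding S_def by (simp only: mult.assoc abs_mult_self_eq flip: abs_mult)
  also have "\<dots> \<le> 2 * h * (\<bar>a\<bar> + S)"
    using nu S by (intro mult_right_mono) auto
  finally have 1: "\<bar>r - (a - S)\<bar> \<le> 2 * h * (\<bar>a\<bar> + S)" .
  obtain \<delta> where \<delta>: "\<bar>\<delta>\<bar> \<le> u" "x = sqrt r * (1 + \<delta>)" using x by (auto simp: fl_def)
  show "0 < x" using \<delta> h r by (auto intro!: mult_pos_pos)
  have xx: "x * x = r * (1 + \<delta>)\<^sup>2" using \<delta>(2) r by (simp add: power2_eq_square)
  have d2: "\<bar>(1 + \<delta>)\<^sup>2 - 1\<bar> \<le> 3 * h"
  proof -
    have "\<bar>\<delta>\<bar> * \<bar>2 + \<delta>\<bar> \<le> h * 3" using \<delta> h by (intro mult_mono) auto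
    then show ?thesis by (simp add: power2_eq_square algebra_simps flip: abs_mult)
  qed
  have "r * (3 / 4) \<le> r * (1 + \<delta>)\<^sup>2" using d2 h r by (intro mult_left_mono) auto
  then have "r \<le> 4 / 3 * (x * x)" using xx by simp
  moreover have "\<bar>x * x - r\<bar> \<le> r * (3 * h)"
  proof -
    have "x * x - r = r * ((1 + \<delta>)\<^sup>2 - 1)" by (simp add: xx algebra_simps)
    then have "\<bar>x * x - r\<bar> = r * \<bar>(1 + \<delta>)\<^sup>2 - 1\<bar>" using r by (simp add: abs_mult)
    then show ?thesis using d2 r by simp
  qed
  moreover have "r * (3 * h) \<le> 4 / 3 * (x * x) * (3 * h)" if "r \<le> 4 / 3 * (x * x)"
    using that h u by (intro mult_right_mono) auto
  ultimately have 2: "\<bar>x * x - r\<bar> \<le> 4 * h * (x * x)" by (simp add: mult_ac)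
  define E where "E = \<bar>S + x * x - a\<bar>"
  define T where "T = S + x * x"
  have xxn: "0 \<le> x * x" by simp
  then have "0 \<le> h * (x * x)" "0 \<le> h * S" "0 \<le> h * \<bar>a\<bar>" using h u S by auto
  then have E: "E \<le> 4 * h * (\<bar>a\<bar> + T)" using 1 2 by (simp add: E_def T_def algebra_simps)
  have "\<bar>a\<bar> \<le> E + T" using S xxn unfolding E_def T_def by linarith
  then have "4 * h * (\<bar>a\<bar> + T) \<le> 4 * h * (E + T + T)" using h u by (intro mult_left_mono) auto
  moreover have "h * E \<le> 1 / 32 * E" using h by (intro mult_right_mono) (auto simp: E_def)
  moreover have "0 \<le> h * T" using h u S by (simp add: T_def)
  ultimately have "E \<le> 16 * h * T" using E by (simp add: algebra_simps)
  then show "\<bar>(\<Sum>l<n. b l * b l) + x * x - a\<bar> \<le> 16 * M * u * ((\<Sum>l<n. b l * b l) + x * x)"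
    by (simp add: E_def T_def h_def S_def)
qed

section \<open>Rounding errors of matrix operations\<close>

text \<open>\<open>M\<close> bounds all dimensions. The factor \<open>65 * M ^ 4\<close> is dictated by Cholesky, with an entrywise
  error of \<open>65 * M * u\<close>, and by products, with \<open>2 * M\<^sup>2 * u\<close>; passing from entries to the norm costs
  another \<open>M\<^sup>2\<close>.\<close>

locale fp_model =
  fixes u M \<epsilon> :: real
  assumes u: "0 \<le> u" and M: "1 \<le> M" and eps: "65 * M ^ 4 * u \<le> \<epsilon>" and eps1: "\<epsilon> \<le> 1"
begin

lemma Mu: "32 * M * u \<le> 1"
proof -
  have "M * u \<le> M ^ 4 * u"
    using u M power_increasing[of 1 4 M] by (intro mult_right_mono) auto
  then show ?thesis using eps eps1 by simp
qed

lemma dim_u: "real n \<le> M \<Longrightarrow> real n * u \<le> 1"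
  using mult_right_mono[of "real n" M u] u Mu M by (auto simp: mult.assoc)

lemma eps_nonneg: "0 \<le> \<epsilon>"
  using u M eps by (meson mult_nonneg_nonneg order_trans zero_le_numeral zero_le_one zero_le_power)

lemma norm_error_le:
  assumes out: "\<And>i j. n \<le> i \<or> k \<le> j \<Longrightarrow> ent a i j = 0" and nk: "real n \<le> M" "real k \<le> M"
    and ent: "\<And>i j. i < n \<Longrightarrow> j < k \<Longrightarrow> \<bar>ent a i j\<bar> \<le> 65 * M\<^sup>2 * u * c" and c: "0 \<le> c"
  shows "norm a \<le> \<epsilon> * c"
proof -
  have "norm a \<le> real n * real k * (65 * M\<^sup>2 * u * c)"
    using out ent c u by (intro norm_fmat_le fbound_entries) auto
  also have "\<dots> \<le> M * M * (65 * M\<^sup>2 * u * c)"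
    using nk M c u by (intro mult_right_mono mult_mono) auto
  also have "\<dots> = 65 * M ^ 4 * u * c" by (simp add: power2_eq_square power4_eq_xxxx mult_ac)
  also have "\<dots> \<le> \<epsilon> * c" using eps c by (rule mult_right_mono)
  finally show ?thesis .
qed

lemma entry_le: "A \<in> carrier_mat n k \<Longrightarrow> i < n \<Longrightarrow> j < k \<Longrightarrow> \<bar>A $$ (i, j)\<bar> \<le> norm (emb A)"
  using ent_le_norm_fmat[of "emb A" i j] by (simp add: ent_emb)

lemma norm_emb_diff_le:
  assumes "A \<in> carrier_mat n k" "B \<in> carrier_mat n k" "real n \<le> M" "real k \<le> M" "0 \<le> c"
    and "\<And>i j. i < n \<Longrightarrow> j < k \<Longrightarrow> \<bar>A $$ (i, j) - B $$ (i, j)\<bar> \<le> 65 * M\<^sup>2 * u * c"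
  shows "norm (emb A - emb B) \<le> \<epsilon> * c"
  using assms by (intro norm_error_le[of n k]) (auto simp: ent_emb)

lemma const_le: "0 \<le> c \<Longrightarrow> a \<le> 65 * M\<^sup>2 \<Longrightarrow> a * u * c \<le> 65 * M\<^sup>2 * u * c"
  using u by (intro mult_right_mono) auto

lemma fl_dot_entry:
  assumes d: "fl_dot u (row A i) (col B j) y"
    and A: "A \<in> carrier_mat n l" and B: "B \<in> carrier_mat l k" and ij: "i < n" "j < k"
    and l: "real l \<le> M"
  shows "\<bar>y - (A * B) $$ (i, j)\<bar> \<le> 65 * M\<^sup>2 * u * (norm (emb A) * norm (emb B))"
proof -
  let ?c = "norm (emb A) * norm (emb B)"
  have "\<bar>y - row A i \<bullet> col B j\<bar> \<le> 2 * real l * u * (\<Sum>h<l. \<bar>row A i $ h\<bar> * \<bar>col B j $ h\<bar>)"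
    using fl_dot_error[OF d u] A B dim_u[OF l] by simp
  also have "\<dots> \<le> 2 * real l * u * (\<Sum>h<l. ?c)"
    using entry_le[OF A] entry_le[OF B] ij A B u
    by (intro mult_left_mono sum_mono mult_mono) auto
  also have "\<dots> = (2 * real l * real l) * u * ?c" by simp
  also have "\<dots> \<le> 65 * M\<^sup>2 * u * ?c"
  proof (rule const_le)
    have "real l * real l \<le> M * M" using l M by (intro mult_mono) auto
    moreover have "0 \<le> M * M" by simp
    ultimately show "2 * real l * real l \<le> 65 * M\<^sup>2" unfolding power2_eq_square mult.assoc by linarith
  qed simp
  finally show ?thesis using A B ij by simp
qed

lemma fl_mult_error:
  assumes f: "fl_mult u A B C" and A: "A \<in> carrier_mat n l" and B: "B \<in> carrier_mat l k"
    and dims: "real n \<le> M" "real l \<le> M" "real k \<le> M"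
  shows "C \<in> carrier_mat n k" "norm (emb C - emb A * emb B) \<le> \<epsilon> * (norm (emb A) * norm (emb B))"
proof -
  show C: "C \<in> carrier_mat n k" using f A B by (simp add: fl_mult_def)
  show "norm (emb C - emb A * emb B) \<le> \<epsilon> * (norm (emb A) * norm (emb B))"
    unfolding emb_mult[OF A B, symmetric]
    using f A B fl_dot_entry[OF _ A B _ _ dims(2)]
    by (intro norm_emb_diff_le[OF C mult_carrier_mat[OF A B] dims(1,3)]) (auto simp: fl_mult_def)
qed

text \<open>Mirroring makes the computed matrix exactly symmetric. The eigenvalue characterizations
  require this, and it lets the error of a Cholesky factor be read off the upper triangle.\<close>

lemma fl_gram_error:
  assumes f: "fl_gram u A G" and A: "A \<in> carrier_mat n k" and dims: "real n \<le> M" "real k \<le> M"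
  shows "G \<in> carrier_mat k k" "G\<^sup>T = G" "norm (emb G - star (emb A) * emb A) \<le> \<epsilon> * (norm (emb A))\<^sup>2"
proof -
  show G: "G \<in> carrier_mat k k" using f A by (simp add: fl_gram_def)
  have sym: "G $$ (j, i) = G $$ (i, j)" if "i < k" "j < k" for i j
    using f A that by (cases "i \<le> j") (auto simp: fl_gram_def)
  then show "G\<^sup>T = G" using G by (intro eq_matI) auto
  have At: "A\<^sup>T \<in> carrier_mat k n" using A by simp
  have eq: "emb (A\<^sup>T * A) = star (emb A) * emb A"
    using emb_mult[OF At A] by (simp add: emb_transpose)
  let ?b = "65 * M\<^sup>2 * u * (norm (emb A))\<^sup>2"
  have upper: "\<bar>G $$ (i, j) - (A\<^sup>T * A) $$ (i, j)\<bar> \<le> ?b" if "i \<le> j" "j < k" for i j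
    using fl_dot_entry[OF _ At A _ _ dims(1), of i j "G $$ (i, j)"] f A that
    by (auto simp: fl_gram_def emb_transpose power2_eq_square simp del: index_mult_mat)
  have symA: "(A\<^sup>T * A) $$ (j, i) = (A\<^sup>T * A) $$ (i, j)" if "i < k" "j < k" for i j
    using A that comm_scalar_prod[of "col A i" n "col A j"] by simp
  have ent: "\<bar>G $$ (i, j) - (A\<^sup>T * A) $$ (i, j)\<bar> \<le> ?b" if "i < k" "j < k" for i j
    using upper[of i j] upper[of j i] sym[of i j] symA[of i j] that by (cases "i \<le> j") auto
  show "norm (emb G - star (emb A) * emb A) \<le> \<epsilon> * (norm (emb A))\<^sup>2"
    unfolding eq[symmetric]
    using ent by (intro norm_emb_diff_le[OF G mult_carrier_mat[OF At A] dims(2,2)]) auto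
qed

lemma fl_entries_error:
  assumes D: "D \<in> carrier_mat n k" and C: "C \<in> carrier_mat n k" and dims: "real n \<le> M" "real k \<le> M"
    and f: "\<And>i j. i < n \<Longrightarrow> j < k \<Longrightarrow> fl u (D $$ (i, j)) (C $$ (i, j))"
    and c: "\<And>i j. i < n \<Longrightarrow> j < k \<Longrightarrow> \<bar>D $$ (i, j)\<bar> \<le> c" "0 \<le> c"
  shows "norm (emb C - emb D) \<le> \<epsilon> * c"
proof (rule norm_emb_diff_le[OF C D dims c(2)])
  have M2: "1 \<le> 65 * M\<^sup>2" using one_le_power[OF M, of 2] by linarith
  fix i j assume ij: "i < n" "j < k"
  have "u * \<bar>D $$ (i, j)\<bar> \<le> u * c" using c(1)[OF ij] u by (rule mult_left_mono)
  then show "\<bar>C $$ (i, j) - D $$ (i, j)\<bar> \<le> 65 * M\<^sup>2 * u * c"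
    using flD[OF f[OF ij]] const_le[OF c(2) M2] by simp
qed

lemma fl_plus_error:
  assumes A: "A \<in> carrier_mat n k" and B: "B \<in> carrier_mat n k" and dims: "real n \<le> M" "real k \<le> M"
    and f: "fl_plus u A B C"
  shows "C \<in> carrier_mat n k \<and> norm (emb C - (emb A + emb B)) \<le> \<epsilon> * (norm (emb A) + norm (emb B))"
proof
  show C: "C \<in> carrier_mat n k" using f A by (simp add: fl_plus_def)
  show "norm (emb C - (emb A + emb B)) \<le> \<epsilon> * (norm (emb A) + norm (emb B))"
    unfolding emb_add[OF A B, symmetric]
  proof (rule fl_entries_error[OF add_carrier_mat[OF B] C dims])
    fix i j assume ij: "i < n" "j < k"
    show "\<bar>(A + B) $$ (i, j)\<bar> \<le> norm (emb A) + norm (emb B)"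
      using entry_le[OF A ij] entry_le[OF B ij] A B ij by simp
  qed (use f A B in \<open>auto simp: fl_plus_def\<close>)
qed

lemma fl_minus_error:
  assumes A: "A \<in> carrier_mat n k" and B: "B \<in> carrier_mat n k" and dims: "real n \<le> M" "real k \<le> M"
    and f: "fl_minus u A B C"
  shows "C \<in> carrier_mat n k \<and> norm (emb C - (emb A - emb B)) \<le> \<epsilon> * (norm (emb A) + norm (emb B))"
proof
  show C: "C \<in> carrier_mat n k" using f A by (simp add: fl_minus_def)
  show "norm (emb C - (emb A - emb B)) \<le> \<epsilon> * (norm (emb A) + norm (emb B))"
    unfolding emb_minus[OF A B, symmetric]
  proof (rule fl_entries_error[OF minus_carrier_mat[OF B] C dims])
    fix i j assume ij: "i < n" "j < k"
    show "\<bar>(A - B) $$ (i, j)\<bar> \<le> norm (emb A) + norm (emb B)"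
      using entry_le[OF A ij] entry_le[OF B ij] A B ij by simp
  qed (use f A B in \<open>auto simp: fl_minus_def\<close>)
qed

lemma upper_triangular_mult_entry:
  assumes V: "V \<in> carrier_mat n s" and C: "C \<in> carrier_mat s s" and "upper_triangular C"
    and ij: "i < n" "j < s"
  shows "(V * C) $$ (i, j) = (\<Sum>l<j. V $$ (i, l) * C $$ (l, j)) + V $$ (i, j) * C $$ (j, j)"
proof -
  have "(V * C) $$ (i, j) = (\<Sum>l<s. V $$ (i, l) * C $$ (l, j))"
    using V C ij by (simp add: scalar_prod_def lessThan_atLeast0)
  also have "\<dots> = (\<Sum>l<Suc j. V $$ (i, l) * C $$ (l, j))"
    using assms by (intro sum.mono_neutral_right)
      (auto simp: not_less Suc_le_eq upper_triangularD[OF assms(3)])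
  finally show ?thesis by simp
qed

text \<open>Row-wise substitution has a small residual whatever the condition number of
  \<open>C\<close>; the conditioning enters only later, when the solution has to be bounded.\<close>

lemma fl_solve_error:
  assumes f: "fl_solve u C W V" and C: "C \<in> carrier_mat s s" and W: "W \<in> carrier_mat n s"
    and ut: "upper_triangular C" and diag: "\<And>j. j < s \<Longrightarrow> C $$ (j, j) \<noteq> 0"
    and dims: "real n \<le> M" "real s \<le> M"
  shows "V \<in> carrier_mat n s" "norm (emb V * emb C - emb W) \<le> \<epsilon> * (norm (emb V) * norm (emb C))"
proof -
  show V: "V \<in> carrier_mat n s" using f W by (simp add: fl_solve_def)
  let ?c = "norm (emb V) * norm (emb C)"
  have ent: "\<bar>(V * C) $$ (i, j) - W $$ (i, j)\<bar> \<le> 65 * M\<^sup>2 * u * ?c" if ij: "i < n" "j < s" for i j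
  proof -
    obtain r where r: "fl_resid u (W $$ (i, j)) j (\<lambda>l. V $$ (i, l)) (\<lambda>l. C $$ (l, j)) r"
      and v: "fl u (r / C $$ (j, j)) (V $$ (i, j))"
      using f W ij by (auto simp: fl_solve_def)
    have j: "real (Suc j) \<le> M" using ij dims by linarith
    have "\<bar>(V * C) $$ (i, j) - W $$ (i, j)\<bar> \<le> 8 * M * u *
        ((\<Sum>l<j. \<bar>V $$ (i, l)\<bar> * \<bar>C $$ (l, j)\<bar>) + \<bar>V $$ (i, j)\<bar> * \<bar>C $$ (j, j)\<bar>)"
      unfolding upper_triangular_mult_entry[OF V C ut ij]
      by (rule fl_resid_quotient_error[OF r v diag[OF ij(2)] u j Mu])
    also have "\<dots> = 8 * M * u * (\<Sum>l<Suc j. \<bar>V $$ (i, l)\<bar> * \<bar>C $$ (l, j)\<bar>)" by simp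
    also have "\<dots> \<le> 8 * M * u * (\<Sum>l<Suc j. ?c)"
      using entry_le[OF V] entry_le[OF C] ij u M by (intro mult_left_mono sum_mono mult_mono) auto
    also have "\<dots> = (8 * M * real (Suc j)) * u * ?c" by simp
    also have "\<dots> \<le> 65 * M\<^sup>2 * u * ?c"
      using j M mult_left_mono[OF j, of M] by (intro const_le) (auto simp: power2_eq_square)
    finally show ?thesis .
  qed
  show "norm (emb V * emb C - emb W) \<le> \<epsilon> * ?c"
    unfolding emb_mult[OF V C, symmetric]
    using ent by (intro norm_emb_diff_le[OF mult_carrier_mat[OF V C] W dims]) auto
qed

lemma fl_chol_pos_diag:
  assumes f: "fl_chol u D C" and D: "D \<in> carrier_mat s s" and dims: "real s \<le> M"
  shows "C \<in> carrier_mat s s" "upper_triangular C" "\<And>j. j < s \<Longrightarrow> 0 < C $$ (j, j)"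
proof -
  show "C \<in> carrier_mat s s" "upper_triangular C" using f D by (auto simp: fl_chol_def)
  show "0 < C $$ (j, j)" if j: "j < s" for j
  proof -
    obtain r where r: "r > 0" "fl_resid u (D $$ (j, j)) j (\<lambda>l. C $$ (l, j)) (\<lambda>l. C $$ (l, j)) r"
        "fl u (sqrt r) (C $$ (j, j))"
      using f D j by (auto simp: fl_chol_def)
    show ?thesis
      using fl_resid_sqrt_error(2)[OF r(2,3,1) u _ Mu] j dims by simp
  qed
qed

text \<open>The scalar bounds are relative to the computed factor. The diagonal of its Gram matrix
  is therefore first bounded by the data and then controls all off-diagonal products. The entrywise
  constant 65 is 64 for Cholesky plus 1 for the subtraction that forms \<open>D\<close>.\<close>

lemma fl_chol_error:
  assumes m: "fl_minus u \<Omega> H D" and f: "fl_chol u D C"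
    and \<Omega>: "\<Omega> \<in> carrier_mat s s" "\<Omega>\<^sup>T = \<Omega>" and H: "H \<in> carrier_mat s s" "H\<^sup>T = H"
    and dims: "real s \<le> M"
  shows "norm (star (emb C) * emb C - (emb \<Omega> - emb H)) \<le> \<epsilon> * (norm (emb \<Omega>) + norm (emb H))"
proof -
  let ?c = "norm (emb \<Omega>) + norm (emb H)"
  have D: "D \<in> carrier_mat s s" using m \<Omega> by (simp add: fl_minus_def)
  note C = fl_chol_pos_diag[OF f D dims]
  have Ct: "C\<^sup>T \<in> carrier_mat s s" using C by simp
  have u1: "u \<le> M * u" "32 * (M * u) \<le> 1" using Mu u M mult_right_mono[of 1 M u] by auto
  have Derr: "\<bar>D $$ (i, j) - (\<Omega> $$ (i, j) - H $$ (i, j))\<bar> \<le> u * ?c"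
    and Dle: "\<bar>D $$ (i, j)\<bar> \<le> 2 * ?c" if ij: "i < s" "j < s" for i j
  proof -
    have c: "\<bar>\<Omega> $$ (i, j) - H $$ (i, j)\<bar> \<le> ?c"
      using entry_le[OF \<Omega>(1) ij] entry_le[OF H(1) ij] by linarith
    have "fl u (\<Omega> $$ (i, j) - H $$ (i, j)) (D $$ (i, j))"
      using m \<Omega> ij by (simp add: fl_minus_def)
    then have "\<bar>D $$ (i, j) - (\<Omega> $$ (i, j) - H $$ (i, j))\<bar> \<le> u * \<bar>\<Omega> $$ (i, j) - H $$ (i, j)\<bar>"
      by (rule flD)
    also have "\<dots> \<le> u * ?c" using c u by (rule mult_left_mono)
    finally show err: "\<bar>D $$ (i, j) - (\<Omega> $$ (i, j) - H $$ (i, j))\<bar> \<le> u * ?c" .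
    have "u * ?c \<le> 1 * ?c" using u1 by (intro mult_right_mono) auto
    moreover have "\<bar>d\<bar> \<le> 2 * c" if "\<bar>d - x\<bar> \<le> e" "\<bar>x\<bar> \<le> c" "e \<le> 1 * c" for c d e x :: real
      using that by linarith
    ultimately show "\<bar>D $$ (i, j)\<bar> \<le> 2 * ?c" using err c by blast
  qed
  \<comment> \<open>By triangularity this is the j-th diagonal entry of the Gram matrix of
    \<open>C\<close>. Its relative error is at most 1/2, so it is at most twice the entry of
    \<open>D\<close>.\<close>
  define T where "T j = (\<Sum>l<j. C $$ (l, j) * C $$ (l, j)) + C $$ (j, j) * C $$ (j, j)" for j
  have T_mono: "(\<Sum>l<Suc i. C $$ (l, j) * C $$ (l, j)) \<le> T j" if "i \<le> j" for i j
  proof -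
    have "(\<Sum>l<Suc i. C $$ (l, j) * C $$ (l, j)) \<le> (\<Sum>l<Suc j. C $$ (l, j) * C $$ (l, j))"
      using that by (intro sum_mono2) auto
    then show ?thesis by (simp add: T_def)
  qed
  have Mu_T: "16 * M * u * T j \<le> 1 / 2 * T j" for j
    using u1 by (intro mult_right_mono) (auto simp: T_def intro!: add_nonneg_nonneg sum_nonneg)
  have diag: "\<bar>T j - D $$ (j, j)\<bar> \<le> 16 * M * u * T j" and T4: "T j \<le> 4 * ?c" if j: "j < s" for j
  proof -
    obtain r where r: "r > 0" "fl_resid u (D $$ (j, j)) j (\<lambda>l. C $$ (l, j)) (\<lambda>l. C $$ (l, j)) r"
        "fl u (sqrt r) (C $$ (j, j))"
      using f D j by (auto simp: fl_chol_def)
    show *: "\<bar>T j - D $$ (j, j)\<bar> \<le> 16 * M * u * T j"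
      using fl_resid_sqrt_error(1)[OF r(2,3,1) u _ Mu] j dims by (simp add: T_def)
    then show "T j \<le> 4 * ?c" using Mu_T[of j] Dle[OF j j] by linarith
  qed
  have CC: "(C\<^sup>T * C) $$ (i, j) = (\<Sum>l<i. C $$ (l, i) * C $$ (l, j)) + C $$ (i, j) * C $$ (i, i)"
    if ij: "i \<le> j" "j < s" for i j
  proof -
    have "(C\<^sup>T * C) $$ (i, j) = (\<Sum>l<s. C $$ (l, i) * C $$ (l, j))"
      using C(1) ij by (simp add: scalar_prod_def lessThan_atLeast0)
    also have "\<dots> = (\<Sum>l<Suc i. C $$ (l, i) * C $$ (l, j))"
      using C ij by (intro sum.mono_neutral_right) (auto simp: not_less Suc_le_eq)
    finally show ?thesis by (simp add: mult.commute)
  qed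
  have upper: "\<bar>(C\<^sup>T * C) $$ (i, j) - (\<Omega> $$ (i, j) - H $$ (i, j))\<bar> \<le> 65 * M\<^sup>2 * u * ?c"
    if ij: "i \<le> j" "j < s" for i j
  proof -
    have "\<bar>(C\<^sup>T * C) $$ (i, j) - D $$ (i, j)\<bar> \<le> 64 * M * u * ?c"
    proof (cases "i = j")
      case True
      have "\<bar>(C\<^sup>T * C) $$ (i, j) - D $$ (i, j)\<bar> = \<bar>T j - D $$ (j, j)\<bar>"
        unfolding CC[OF ij] using True by (simp add: T_def)
      also have "\<dots> \<le> 16 * M * u * T j" by (rule diag[OF ij(2)])
      also have "\<dots> \<le> 16 * M * u * (4 * ?c)"
        using T4[OF ij(2)] u M by (intro mult_left_mono) auto
      also have "\<dots> = 64 * M * u * ?c" by simp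
      finally show ?thesis .
    next
      case False
      then have lt: "i < j" using ij by simp
      obtain r where r: "fl_resid u (D $$ (i, j)) i (\<lambda>l. C $$ (l, i)) (\<lambda>l. C $$ (l, j)) r"
         and v: "fl u (r / C $$ (i, i)) (C $$ (i, j))"
        using f D ij lt by (auto simp: fl_chol_def)
      have nz: "C $$ (i, i) \<noteq> 0" using C(3)[of i] lt ij by simp
      have i: "real (Suc i) \<le> M" using ij lt dims by linarith
      have "\<bar>(C\<^sup>T * C) $$ (i, j) - D $$ (i, j)\<bar> \<le> 8 * M * u *
        ((\<Sum>l<i. \<bar>C $$ (l, i)\<bar> * \<bar>C $$ (l, j)\<bar>) + \<bar>C $$ (i, j)\<bar> * \<bar>C $$ (i, i)\<bar>)"
        unfolding CC[OF ij] by (rule fl_resid_quotient_error[OF r v nz u i Mu])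
      also have "\<dots> = 8 * M * u * (\<Sum>l<Suc i. \<bar>C $$ (l, i)\<bar> * \<bar>C $$ (l, j)\<bar>)" by (simp add: mult.commute)
      \<comment> \<open>Splitting each product into squares reduces an off-diagonal entry to the two
        diagonal quantities \<open>T i\<close> and \<open>T j\<close>.\<close>
      also have "\<dots> \<le> 8 * M * u * (\<Sum>l<Suc i. C $$ (l, i) * C $$ (l, i) + C $$ (l, j) * C $$ (l, j))"
      proof (intro mult_left_mono sum_mono)
        fix l
        have "\<bar>x\<bar> * \<bar>y\<bar> \<le> x * x + y * y" for x y :: real
        proof -
          have "0 \<le> (\<bar>x\<bar> - \<bar>y\<bar>)\<^sup>2" by simp
          then have "2 * (\<bar>x\<bar> * \<bar>y\<bar>) \<le> \<bar>x\<bar> * \<bar>x\<bar> + \<bar>y\<bar> * \<bar>y\<bar>" by (simp add: power2_eq_square algebra_simps)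
          moreover have "0 \<le> \<bar>x\<bar> * \<bar>y\<bar>" by simp
          ultimately have "\<bar>x\<bar> * \<bar>y\<bar> \<le> \<bar>x\<bar> * \<bar>x\<bar> + \<bar>y\<bar> * \<bar>y\<bar>" by linarith
          then show ?thesis by simp
        qed
        then show "\<bar>C $$ (l, i)\<bar> * \<bar>C $$ (l, j)\<bar> \<le> C $$ (l, i) * C $$ (l, i) + C $$ (l, j) * C $$ (l, j)" .
      qed (use u M in auto)
      also have "\<dots> \<le> 8 * M * u * (T i + T j)"
        using T_mono[of i i] T_mono[of i j] lt u M unfolding sum.distrib by (intro mult_left_mono add_mono) auto
      also have "\<dots> \<le> 8 * M * u * (4 * ?c + 4 * ?c)"
        using T4[of i] T4[of j] lt ij u M by (intro mult_left_mono add_mono) auto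
      finally show ?thesis by (simp add: algebra_simps)
    qed
    moreover have "\<bar>D $$ (i, j) - (\<Omega> $$ (i, j) - H $$ (i, j))\<bar> \<le> u * ?c" using Derr ij by simp
    moreover have "u * ?c \<le> M * u * ?c" using u1 by (intro mult_right_mono) auto
    ultimately have "\<bar>(C\<^sup>T * C) $$ (i, j) - (\<Omega> $$ (i, j) - H $$ (i, j))\<bar> \<le> 65 * M * u * ?c"
      by (simp only: mult.assoc)
    also have "\<dots> \<le> 65 * M\<^sup>2 * u * ?c"
      using M by (intro const_le) (auto simp: power2_eq_square)
    finally show ?thesis .
  qed
  have sym: "(C\<^sup>T * C) $$ (j, i) = (C\<^sup>T * C) $$ (i, j)" if "i < s" "j < s" for i j
    using C(1) that comm_scalar_prod[of "col C i" s "col C j"] by simp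
  have sym2: "\<Omega> $$ (j, i) = \<Omega> $$ (i, j)" "H $$ (j, i) = H $$ (i, j)" if "i < s" "j < s" for i j
    using arg_cong[OF \<Omega>(2), of "\<lambda>X. X $$ (i, j)"] arg_cong[OF H(2), of "\<lambda>X. X $$ (i, j)"] \<Omega>(1) H(1) that
    by simp_all
  have ent: "\<bar>(C\<^sup>T * C) $$ (i, j) - (\<Omega> $$ (i, j) - H $$ (i, j))\<bar> \<le> 65 * M\<^sup>2 * u * ?c"
    if "i < s" "j < s" for i j
    using upper[of i j] upper[of j i] sym[of i j] sym2[of i j] that by (cases "i \<le> j") auto
  have eq: "emb (C\<^sup>T * C) = star (emb C) * emb C"
    using emb_mult[OF Ct C(1)] by (simp add: emb_transpose)
  show ?thesis
    unfolding eq[symmetric]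
    unfolding emb_minus[OF \<Omega>(1) H(1), symmetric]
    using ent \<Omega>(1) H(1)
    by (intro norm_emb_diff_le[OF mult_carrier_mat[OF Ct C(1)] minus_carrier_mat[OF H(1)] dims dims]) auto
qed

end

section \<open>A single block step\<close>

lemma norm_add_bound: "norm (a :: 'a :: real_normed_vector) \<le> x \<Longrightarrow> norm b \<le> y \<Longrightarrow> norm (a + b) \<le> x + y"
  by (rule norm_triangle_le) simp

lemma norm_diff_bound: "norm (a :: 'a :: real_normed_vector) \<le> x \<Longrightarrow> norm b \<le> y \<Longrightarrow> norm (a - b) \<le> x + y"
  by (rule norm_triangle_le_diff) simp

lemma norm_mult_bound:
  "norm (a :: 'a :: real_normed_algebra) \<le> x \<Longrightarrow> norm b \<le> y \<Longrightarrow> norm (a * b) \<le> x * y"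
  by (rule order_trans[OF norm_mult_ineq])
    (auto intro: mult_mono order_trans[OF norm_ge_zero])

lemma norm_star_bound: "norm a \<le> x \<Longrightarrow> norm (star a) \<le> x"
  by simp

lemma norm_uminus_bound: "norm (a :: 'a :: real_normed_vector) \<le> x \<Longrightarrow> norm (- a) \<le> x"
  by simp

text \<open>As introduction rules these decompose a norm along its expression. The stated bounds
  therefore mirror the terms that they estimate, factors 1 included, and are simplified only in the
  following step.\<close>

lemmas norm_bounds = norm_add_bound norm_diff_bound norm_mult_bound norm_star_bound norm_uminus_bound

lemma norm_le_of_diff: "norm (a - b :: 'a :: real_normed_vector) \<le> d \<Longrightarrow> norm b \<le> c \<Longrightarrow> norm a \<le> c + d"
  using norm_triangle_sub[of a b] by linarith

text \<open>Weyl's perturbation inequality for the smallest singular value.\<close>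

lemma low_perturb:
  assumes "low s a c" "norm (b - a) \<le> d" shows "low s b (c - d)"
  unfolding low_def
proof (intro allI impI)
  fix v assume v: "pr s * v = v"
  have "norm ((b - a) * v) \<le> d * norm v" using assms(2) by (intro norm_mult_bound) auto
  moreover have "norm (a * v) \<le> norm (b * v) + norm ((b - a) * v)"
    using norm_triangle_ineq4[of "b * v" "(b - a) * v"] by (simp add: algebra_simps)
  ultimately show "(c - d) * norm v \<le> norm (b * v)"
    using lowD[OF assms(1) v] by (simp add: algebra_simps)
qed

lemma low_mono: "low s a c \<Longrightarrow> d \<le> c \<Longrightarrow> low s a d"
  unfolding low_def by (meson mult_right_mono norm_ge_zero order_trans)

lemma low_norm: "low s a c \<Longrightarrow> 0 < s \<Longrightarrow> a * pr s = a \<Longrightarrow> c \<le> norm a"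
  using lowD[of s a c "pr s"] by (simp add: norm_pr)

lemma low_mult_right:
  assumes "low s (a * b) c" "norm a \<le> h" "0 < h" shows "low s b (c / h)"
  unfolding low_def
proof (intro allI impI)
  fix v assume v: "pr s * v = v"
  have "c * norm v \<le> norm (a * (b * v))" using lowD[OF assms(1) v] by (simp add: mult.assoc)
  also have "\<dots> \<le> h * norm (b * v)" using assms(2) by (intro norm_mult_bound) auto
  finally show "c / h * norm v \<le> norm (b * v)" using assms(3) by (simp add: divide_simps mult.commute)
qed

lemma norm_almost_orthonormal:
  assumes "norm (star q * q - pr n) \<le> \<omega>" "\<omega> \<le> 1" shows "norm q \<le> 2"
proof -
  have "(norm q)\<^sup>2 \<le> 1 + \<omega>"
    using norm_le_of_diff[OF assms(1) norm_pr_le] by (simp add: norm_star_mult)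
  then have "(norm q)\<^sup>2 \<le> 2\<^sup>2" using assms(2) by simp
  then show ?thesis by (rule power2_le_imp_le) simp
qed

text \<open>No positivity is available in this algebra; instead \<open>t = norm (x - q q\<^sup>* x)\<close> satisfies
  \<open>t\<^sup>2 \<le> N t + 4 \<omega> N\<^sup>2\<close>.\<close>

lemma norm_project_out:
  assumes orth: "norm (star q * q - pr n) \<le> \<omega>" "\<omega> \<le> 1" and q: "q * pr n = q" and x: "norm x \<le> N"
  shows "norm (x - q * (star q * x)) \<le> N * (1 + 4 * \<omega>)"
proof (rule ccontr)
  define y where "y = x - q * (star q * x)"
  define t where "t = norm y"
  assume "\<not> ?thesis"
  then have t: "N * (1 + 4 * \<omega>) < t" by (simp add: y_def t_def)
  note nq = norm_almost_orthonormal[OF orth]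
  have \<omega>: "0 \<le> \<omega>" and N: "0 \<le> N" using orth(1) x norm_ge_zero order_trans by blast+
  have pq: "pr n * (star q * x) = star q * x"
    using arg_cong[OF q, of star] by (simp flip: mult.assoc)
  have "star y * y = star x * y + star (star q * x) * ((star q * q - pr n) * (star q * x))"
    unfolding y_def by (simp add: algebra_simps pq)
  also have "norm \<dots> \<le> N * t + (2 * N) * (\<omega> * (2 * N))"
    using nq x orth by (intro norm_bounds) (auto simp: t_def)
  finally have "t * t \<le> N * t + 4 * (\<omega> * (N * N))"
    by (simp add: norm_star_mult t_def power2_eq_square mult_ac)
  moreover have "N * (1 + 4 * \<omega>) * t \<le> t * t"
    using t by (intro mult_right_mono) (auto simp: t_def)
  moreover have "4 * (\<omega> * N) * N \<le> 4 * (\<omega> * N) * t"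
  proof (intro mult_left_mono)
    have "0 \<le> N * \<omega>" using N \<omega> by simp
    then show "N \<le> t" using t by (simp add: algebra_simps)
  qed (use N \<omega> in auto)
  ultimately have eq: "N * (1 + 4 * \<omega>) * t = t * t" by (simp add: algebra_simps)
  have "0 < t" using t N \<omega> by (smt (verit) mult_nonneg_nonneg)
  then show False using eq t by simp
qed

text \<open>Put z = Ri S v. Then q S v = q R z, which is X z up to \<rho> times the length of z, so
  the projected block applied to v is nearly X y with y = \<open>star J * v - z\<close>. The two
  parts of y live in different blocks: its J part is v and its first n rows are -z, hence y is at
  least as long as each of them. The lower bound \<sigma> of X at y then passes to v with a loss of
  only \<rho>.\<close>

lemma low_project_out:
  assumes low: "low L X \<sigma>" and \<rho>: "norm (X * pr n - q * R) \<le> \<rho>" "\<rho> \<le> \<sigma>"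
    and J: "J * star J = pr s" "J * pr n = 0" "norm J \<le> 1" "pr L * star J = star J" "pr L * pr n = pr n"
    and R: "R * Ri = pr n" "pr n * Ri = Ri" and S: "pr n * S = S"
  shows "low s (X * star J - q * S) (\<sigma> - \<rho>)"
  unfolding low_def
proof (intro allI impI)
  fix v assume v: "pr s * v = v"
  define z where "z = Ri * (S * v)"
  define y where "y = star J * v - z"
  have pz: "pr n * z = z" by (simp add: z_def R(2) flip: mult.assoc)
  have Rz: "R * z = S * v" by (simp add: z_def R(1) S flip: mult.assoc)
  have J': "pr n * star J = 0" using arg_cong[OF J(2), of star] by simp
  have "pr L * z = z" using pz J(5) by (metis mult.assoc)
  then have py: "pr L * y = y" by (simp add: y_def right_diff_distrib J(4) flip: mult.assoc)
  have "X * z = X * pr n * z" by (simp add: pz mult.assoc)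
  then have Xy: "X * y = (X * star J - q * S) * v - (X * pr n - q * R) * z"
    by (simp add: y_def algebra_simps Rz flip: mult.assoc) (simp add: mult.assoc Rz)
  have "pr n * y = - z" by (simp add: y_def right_diff_distrib pz J' flip: mult.assoc)
  then have nz: "norm z \<le> norm y"
    using norm_mult_bound[OF norm_pr_le order_refl, of n y] by simp
  have "J * z = J * pr n * z" by (simp add: pz mult.assoc)
  then have "J * y = v" by (simp add: y_def right_diff_distrib J(1,2) v flip: mult.assoc)
  then have nv: "norm v \<le> norm y"
    using norm_mult_bound[OF J(3) order_refl, of y] by simp
  have \<rho>0: "0 \<le> \<rho>" using \<rho>(1) norm_ge_zero order_trans by blast
  have "\<sigma> * norm y \<le> norm ((X * star J - q * S) * v) + \<rho> * norm z"
    using lowD[OF low py] unfolding Xy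
    using norm_triangle_ineq4[of "(X * star J - q * S) * v" "(X * pr n - q * R) * z"]
      norm_mult_bound[OF \<rho>(1) order_refl, of z] by linarith
  also have "\<dots> \<le> norm ((X * star J - q * S) * v) + \<rho> * norm y"
    using nz \<rho>0 by (simp add: mult_left_mono)
  finally have "(\<sigma> - \<rho>) * norm y \<le> norm ((X * star J - q * S) * v)" by (simp add: algebra_simps)
  moreover have "(\<sigma> - \<rho>) * norm v \<le> (\<sigma> - \<rho>) * norm y"
    using nv \<rho>(2) by (intro mult_left_mono) auto
  ultimately show "(\<sigma> - \<rho>) * norm v \<le> norm ((X * star J - q * S) * v)" by linarith
qed

text \<open>In the last bound the coefficient of N must tend to 1 with the errors, since \<kappa>(W)
  may exceed \<kappa>(X) only slightly. Hence \<open>norm_project_out\<close> is used there, while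
  the crude \<open>norm q \<le> 2\<close> is good enough for the error terms.\<close>

lemma residual_block_bounds:
  assumes orth: "norm (star q * q - pr n) \<le> \<omega>" "\<omega> \<le> 1" and q: "q * pr n = q" and x: "norm x \<le> N"
    and S: "norm (S - star q * x) \<le> a * N" "a \<le> 1"
    and eps: "0 \<le> \<epsilon>" "\<epsilon> \<le> 1"
    and G: "norm (G - q * S) \<le> \<epsilon> * (norm q * norm S)"
    and W: "norm (W - (x - G)) \<le> \<epsilon> * (norm x + norm G)"
  shows "norm S \<le> 3 * N"
    and "norm (W - (x - q * S)) \<le> 20 * \<epsilon> * N"
    and "norm W \<le> N * (1 + 4 * \<omega> + 2 * a + 20 * \<epsilon>)"
proof -
  note nq = norm_almost_orthonormal[OF orth]
  have N: "0 \<le> N" using x norm_ge_zero order_trans by blast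
  have "norm (star q * x) \<le> 2 * N" using nq x by (intro norm_bounds)
  from norm_le_of_diff[OF S(1) this] show nS: "norm S \<le> 3 * N"
    using mult_right_mono[OF S(2) N] by simp
  have qS: "norm (q * S) \<le> 6 * N" using norm_mult_bound[OF nq nS] by simp
  have "norm q * norm S \<le> 2 * (3 * N)" using nq nS by (intro mult_mono) auto
  then have G': "norm (G - q * S) \<le> \<epsilon> * (6 * N)"
    using G mult_left_mono[OF _ eps(1)] by fastforce
  have "norm G \<le> 6 * N + \<epsilon> * (6 * N)" by (rule norm_le_of_diff[OF G' qS])
  also have "\<epsilon> * (6 * N) \<le> 1 * (6 * N)" using eps N by (intro mult_right_mono) auto
  finally have "norm x + norm G \<le> 13 * N" using x by simp
  then have W': "norm (W - (x - G)) \<le> \<epsilon> * (13 * N)"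
    using W mult_left_mono[OF _ eps(1)] by fastforce
  have "W - (x - q * S) = (W - (x - G)) - (G - q * S)" by simp
  also have "norm \<dots> \<le> \<epsilon> * (13 * N) + \<epsilon> * (6 * N)" by (intro norm_bounds W' G')
  also have "\<dots> \<le> 20 * \<epsilon> * N" using eps N by simp
  finally show W20: "norm (W - (x - q * S)) \<le> 20 * \<epsilon> * N" .
  have "x - q * S = (x - q * (star q * x)) - q * (S - star q * x)" by (simp add: algebra_simps)
  also have "norm \<dots> \<le> N * (1 + 4 * \<omega>) + 2 * (a * N)"
    by (intro norm_bounds norm_project_out[OF orth q x] nq S(1))
  finally have "norm W \<le> N * (1 + 4 * \<omega>) + 2 * (a * N) + 20 * \<epsilon> * N"
    by (rule norm_le_of_diff[OF W20])
  then show "norm W \<le> N * (1 + 4 * \<omega> + 2 * a + 20 * \<epsilon>)" by (simp add: algebra_simps)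
qed


text \<open>Here \<open>x = X\<^bsub>k+1\<^esub>\<close>, \<open>S = S\<^bsub>1:k,k+1\<^esub>\<close>, \<open>C = S\<^bsub>k+1,k+1\<^esub>\<close>, \<open>Y = Y\<^bsub>1:k,k+1\<^esub>\<close>, \<open>D = Y\<^bsub>k+1,k+1\<^esub>\<close>, \<open>Q = Q\<^bsub>k+1\<^esub>\<close>,
  \<open>R = R\<^bsub>1:k,k+1\<^esub>\<close>, \<open>R' = R\<^bsub>k+1,k+1\<^esub>\<close>; \<open>W\<close>, \<open>W2\<close>, \<open>G\<close>, \<open>G3\<close> and \<open>H\<close> are intermediate results.\<close>

locale bgs_step =
  fixes \<epsilon> \<omega> K N \<sigma> \<eta> :: real and n s :: nat
    and q x S W U Y \<Omega> H G W2 Q G3 R R' :: fmat and C D :: "real mat"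
  assumes s: "0 < s" and K: "1 \<le> K" and eps0: "0 \<le> \<epsilon>" and eps: "260 * K\<^sup>2 * \<epsilon> \<le> 1"
    and N: "0 \<le> N" and \<sigma>: "0 < \<sigma>" and om1: "\<omega> \<le> 1"
    and eta: "2 * N / \<sigma> * (2 * \<omega> + 1100 * K\<^sup>2 * \<epsilon>) + 2 * \<epsilon> \<le> \<eta>" "\<eta> \<le> 1 / (2 * K)"
    and C: "C \<in> carrier_mat s s" and D: "D \<in> carrier_mat s s"
    and q: "q * pr n = q" and Us: "U * pr s = U" and Yn: "pr n * Y = Y" and Qs: "Q * pr s = Q"
    and orth: "norm (star q * q - pr n) \<le> \<omega>"
    and x: "norm x \<le> N" and S: "norm (S - star q * x) \<le> 260 * K\<^sup>2 * \<epsilon> * N"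
    and W: "norm (W - (x - q * S)) \<le> 20 * \<epsilon> * N" "norm W \<le> 2 * N" "low s W (3 / 4 * \<sigma>)"
    and U: "norm (U * emb C - W) \<le> 4 * K * \<epsilon> * N" "low s U (norm U / K)"
    and Y: "norm (Y - star q * U) \<le> \<epsilon> * (norm (star q) * norm U)"
    and \<Omega>: "norm (\<Omega> - star U * U) \<le> \<epsilon> * (norm U)\<^sup>2"
    and H: "norm (H - star Y * Y) \<le> \<epsilon> * (norm Y)\<^sup>2"
    and chol: "norm (star (emb D) * emb D - (\<Omega> - H)) \<le> \<epsilon> * (norm \<Omega> + norm H)"
    and G: "norm (G - q * Y) \<le> \<epsilon> * (norm q * norm Y)"
    and W2: "norm (W2 - (U - G)) \<le> \<epsilon> * (norm U + norm G)"
    and Q: "norm (Q * emb D - W2) \<le> \<epsilon> * (norm Q * norm (emb D))"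
    and G3: "norm (G3 - Y * emb C) \<le> \<epsilon> * (norm Y * norm (emb C))"
    and R: "norm (R - (S + G3)) \<le> \<epsilon> * (norm S + norm G3)"
    and R': "norm (R' - emb D * emb C) \<le> \<epsilon> * (norm (emb D) * norm (emb C))"
begin

abbreviation h :: real where "h \<equiv> norm U"
abbreviation c :: fmat where "c \<equiv> emb C"
abbreviation d :: fmat where "d \<equiv> emb D"

section \<open>Size and conditioning of the first orthogonalization\<close>

lemma K_eps: "\<epsilon> \<le> K * \<epsilon>" "K * \<epsilon> \<le> K\<^sup>2 * \<epsilon>" "260 * (K\<^sup>2 * \<epsilon>) \<le> 1"
  using mult_right_mono[OF K eps0] mult_right_mono[OF self_le_power[OF K, of 2] eps0] eps by auto

lemma omega_nonneg: "0 \<le> \<omega>" using orth norm_ge_zero order_trans by blast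

lemma norm_q_le: "norm q \<le> 2" by (rule norm_almost_orthonormal[OF orth om1])

lemma pr_star_q: "pr n * star q = star q" using arg_cong[OF q, of star] by simp

lemma norm_S_le: "norm S \<le> 3 * N"
proof -
  have "norm (star q * x) \<le> 2 * N" using norm_q_le x by (intro norm_bounds)
  from norm_le_of_diff[OF S this] show ?thesis
    using mult_right_mono[OF eps N] by simp
qed

text \<open>The constraints on \<open>\<eta>\<close> already contain a smallness condition relative
  to \<sigma>. It guarantees that the residual of U C = W destroys at most a third of the lower
  bound of W.\<close>

lemma small_sigma: "4 * (K * \<epsilon> * N) \<le> \<sigma> / 4"
proof -
  have "2 * N / \<sigma> * (1100 * (K\<^sup>2 * \<epsilon>)) \<le> 2 * N / \<sigma> * (2 * \<omega> + 1100 * K\<^sup>2 * \<epsilon>)"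
    using N \<sigma> omega_nonneg by (intro mult_left_mono) auto
  also have "\<dots> \<le> 1 / (2 * K)" using eta eps0 by linarith
  also have "\<dots> \<le> 1" using K by simp
  finally have "2200 * (K\<^sup>2 * \<epsilon> * N) \<le> \<sigma>" using \<sigma> by (simp add: divide_simps mult_ac)
  moreover have "K * \<epsilon> * N \<le> K\<^sup>2 * \<epsilon> * N" by (rule mult_right_mono[OF K_eps(2) N])
  ultimately show ?thesis using \<sigma> by linarith
qed

lemma low_UC: "low s (U * c) (\<sigma> / 2)"
  by (rule low_mono[OF low_perturb[OF W(3) U(1)]]) (use small_sigma in linarith)

lemma h: "0 < h"
proof -
  have "\<sigma> / 2 \<le> norm (U * c)"
    using low_norm[OF low_UC s] emb_pr[OF C] by (simp add: mult.assoc)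
  then have "U \<noteq> 0" using \<sigma> by auto
  then show ?thesis by simp
qed

lemma K_eps_N: "K * \<epsilon> * N \<le> N / 260" "\<epsilon> * N \<le> K * \<epsilon> * N" "0 \<le> \<epsilon> * N"
  using mult_right_mono[OF order_trans[OF K_eps(2), of "1 / 260"] N] K_eps N eps0
    mult_right_mono[OF K_eps(1) N] by auto

text \<open>Here the unknown scale of U drops out: only the product of the norms of U and C is
  bounded, because the conditioning of U relates it to the norm of U C.\<close>

lemma h_C: "h * norm c \<le> 3 * K * N"
proof -
  have "h / K * norm c \<le> norm (U * c)" by (rule lowD[OF U(2) pr_emb[OF C]])
  also have "\<dots> \<le> 2 * N + 4 * K * \<epsilon> * N" by (rule norm_le_of_diff[OF U(1) W(2)])
  also have "\<dots> \<le> 3 * N" using K_eps_N N by simp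
  finally show ?thesis using K by (simp add: divide_simps mult_ac)
qed

lemma ex_C_inverse: "\<exists>Ci. c * Ci = pr s \<and> norm Ci \<le> 2 * h / \<sigma>"
proof -
  have "low s c (\<sigma> / 2 / h)" by (rule low_mult_right[OF low_UC order_refl h])
  from low_inverse[OF C this] show ?thesis using h \<sigma> by auto
qed

text \<open>Multiplying by \<open>star q\<close> nearly annihilates x - q S, so
  \<open>star q * (U * c)\<close> consists of errors proportional to N alone. Undoing the factor c
  costs 2 h / \<sigma>, which produces the factor N / \<sigma> = \<kappa>(X).\<close>

lemma star_q_U: "norm (star q * U) \<le> (\<eta> - 2 * \<epsilon>) * h"
proof -
  obtain Ci where Ci: "c * Ci = pr s" "norm Ci \<le> 2 * h / \<sigma>" using ex_C_inverse by blast
  have "star q * (U * c) = star q * (U * c - W) + star q * (W - (x - q * S))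
      - (star q * q - pr n) * (star q * x) - star q * (q * (S - star q * x))"
    by (simp add: algebra_simps) (simp add: pr_star_q flip: mult.assoc)
  also have "norm \<dots> \<le> 2 * (4 * K * \<epsilon> * N) + 2 * (20 * \<epsilon> * N) + \<omega> * (2 * N) + 2 * (2 * (260 * K\<^sup>2 * \<epsilon> * N))"
    using norm_q_le by (intro norm_bounds U(1) W(1) orth S x) auto
  \<comment> \<open>The coefficients 8 K, 40 and 1040 K^2 add up to at most 1088 K^2, rounded up to
    1100.\<close>
  also have "\<dots> \<le> (2 * \<omega> + 1100 * K\<^sup>2 * \<epsilon>) * N"
    using mult_right_mono[OF K_eps(1) N] mult_right_mono[OF K_eps(2) N] K_eps_N(3) by (simp add: algebra_simps)
  finally have le: "norm (star q * (U * c)) \<le> (2 * \<omega> + 1100 * K\<^sup>2 * \<epsilon>) * N" .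
  have "star q * U = star q * (U * c) * Ci" by (simp add: mult.assoc Ci(1) Us)
  also have "norm \<dots> \<le> (2 * \<omega> + 1100 * K\<^sup>2 * \<epsilon>) * N * (2 * h / \<sigma>)"
    by (intro norm_mult_bound le Ci(2))
  also have "\<dots> = 2 * N / \<sigma> * (2 * \<omega> + 1100 * K\<^sup>2 * \<epsilon>) * h" by simp
  also have "\<dots> \<le> (\<eta> - 2 * \<epsilon>) * h" using eta by (intro mult_right_mono) auto
  finally show ?thesis .
qed

lemma Y_err: "norm (Y - star q * U) \<le> 2 * \<epsilon> * h"
proof -
  have "norm (star q) * h \<le> 2 * h" using norm_q_le by (intro mult_right_mono) auto
  then show ?thesis using Y mult_left_mono[OF _ eps0] by fastforce
qed

lemma norm_Y_le: "norm Y \<le> \<eta> * h"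
  using norm_le_of_diff[OF Y_err star_q_U] by (simp add: algebra_simps)

lemma eta_bounds: "0 \<le> \<eta>" "\<eta> \<le> 1 / 2" "\<eta> * K \<le> 1 / 2"
proof -
  have "0 \<le> 2 * N / \<sigma> * (2 * \<omega> + 1100 * K\<^sup>2 * \<epsilon>)"
    using N \<sigma> omega_nonneg eps0 K by (intro mult_nonneg_nonneg add_nonneg_nonneg divide_nonneg_nonneg) auto
  then show "0 \<le> \<eta>" using eta eps0 by linarith
  have "1 / (2 * K) \<le> 1 / 2" using K by simp
  then show "\<eta> \<le> 1 / 2" using eta(2) by linarith
  show "\<eta> * K \<le> 1 / 2" using eta(2) K by (simp add: divide_simps mult_ac)
qed

lemma norm_Y_le_h: "norm Y \<le> h"
  using norm_Y_le mult_right_mono[OF eta_bounds(2) norm_ge_zero[of U]] norm_ge_zero[of U] by linarith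

lemma eps_h: "\<epsilon> * h \<le> K * \<epsilon> * h" "K * \<epsilon> * h \<le> h / 260" "0 \<le> \<epsilon> * h" "0 \<le> K * \<epsilon> * h"
  using mult_right_mono[OF K_eps(1), of h] h eps0 K
    mult_right_mono[OF order_trans[OF K_eps(2), of "1 / 260"], of h] K_eps by auto

section \<open>The second orthogonalization\<close>

lemma gram_D: "norm (star d * d - (star U * U - star Y * Y)) \<le> 6 * \<epsilon> * h\<^sup>2"
proof -
  have eps1: "\<epsilon> \<le> 1" using K_eps by linarith
  have "norm (star U * U) \<le> h\<^sup>2" by (simp add: norm_star_mult)
  from norm_le_of_diff[OF \<Omega> this] have n\<Omega>: "norm \<Omega> \<le> 2 * h\<^sup>2"
    using mult_right_mono[OF eps1, of "h\<^sup>2"] by simp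
  have Y2: "(norm Y)\<^sup>2 \<le> h\<^sup>2" using norm_Y_le_h by (intro power_mono) auto
  have H': "norm (H - star Y * Y) \<le> \<epsilon> * h\<^sup>2"
    using H mult_left_mono[OF Y2 eps0] by linarith
  have "norm (star Y * Y) \<le> h\<^sup>2" using Y2 by (simp add: norm_star_mult)
  from norm_le_of_diff[OF H' this] have nH: "norm H \<le> 2 * h\<^sup>2"
    using mult_right_mono[OF eps1, of "h\<^sup>2"] by simp
  have "\<epsilon> * (norm \<Omega> + norm H) \<le> \<epsilon> * (4 * h\<^sup>2)"
    using n\<Omega> nH eps0 by (intro mult_left_mono) auto
  with chol have c': "norm (star d * d - (\<Omega> - H)) \<le> \<epsilon> * (4 * h\<^sup>2)" by linarith
  have "star d * d - (star U * U - star Y * Y) =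
      (star d * d - (\<Omega> - H)) + (\<Omega> - star U * U) - (H - star Y * Y)" by simp
  also have "norm \<dots> \<le> \<epsilon> * (4 * h\<^sup>2) + \<epsilon> * h\<^sup>2 + \<epsilon> * h\<^sup>2"
    by (intro norm_bounds c' \<Omega> H')
  finally show ?thesis by (simp add: algebra_simps)
qed

lemma norm_D_le: "norm d \<le> 2 * h"
proof -
  have "(norm Y)\<^sup>2 \<le> h\<^sup>2" using norm_Y_le_h by (intro power_mono) auto
  then have "norm (star U * U - star Y * Y) \<le> h\<^sup>2 + h\<^sup>2"
    by (intro norm_bounds) (auto simp: norm_star_mult)
  from norm_le_of_diff[OF gram_D this] have "(norm d)\<^sup>2 \<le> h\<^sup>2 + h\<^sup>2 + 6 * \<epsilon> * h\<^sup>2"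
    by (simp add: norm_star_mult)
  also have "6 * \<epsilon> * h\<^sup>2 \<le> 2 * h\<^sup>2" using K_eps by (intro mult_right_mono) auto
  finally have "(norm d)\<^sup>2 \<le> (2 * h)\<^sup>2" by simp
  then show ?thesis by (rule power2_le_imp_le) simp
qed

text \<open>A budget for squared lengths: U v supplies at least T, Y v removes at most T/4 because
  \<eta> \<le> 1/(2K), and rounding at most T/2. The remaining T/4 is left for d v.\<close>

lemma low_D: "low s d (h / (2 * K))"
  unfolding low_def
proof (intro allI impI)
  fix v assume v: "pr s * v = v"
  have "star (U * v) * (U * v) = star v * (star U * U) * v" by (simp add: mult.assoc)
  also have "\<dots> = star (d * v) * (d * v) + star (Y * v) * (Y * v)
       - star v * (star d * d - (star U * U - star Y * Y)) * v"
    by (simp add: algebra_simps)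
  also have "norm \<dots> \<le> (norm (d * v))\<^sup>2 + (norm (Y * v))\<^sup>2 + norm v * (6 * \<epsilon> * h\<^sup>2) * norm v"
    by (intro norm_bounds gram_D) (auto simp: norm_star_mult simp del: star_mult)
  finally have 1: "(norm (U * v))\<^sup>2 \<le> (norm (d * v))\<^sup>2 + (norm (Y * v))\<^sup>2 + 6 * \<epsilon> * (h * norm v)\<^sup>2"
    by (simp add: norm_star_mult power2_eq_square mult_ac del: star_mult)
  have "norm (Y * v) \<le> h * norm v / (2 * K)"
  proof -
    have "norm (Y * v) \<le> (1 / (2 * K)) * h * norm v"
      using norm_Y_le mult_right_mono[OF eta(2), of h] h by (intro norm_bounds) auto
    then show ?thesis by simp
  qed
  define T where "T = (h * norm v / K)\<^sup>2"
  have quarter: "(h * norm v / (2 * K))\<^sup>2 = T / 4"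
    by (simp add: T_def power2_eq_square)
  have 2: "(norm (Y * v))\<^sup>2 \<le> T / 4"
    unfolding quarter[symmetric] by (rule power_mono[OF \<open>norm (Y * v) \<le> _\<close> norm_ge_zero])
  have 3: "T \<le> (norm (U * v))\<^sup>2"
    unfolding T_def using lowD[OF U(2) v] K h by (intro power_mono) auto
  have "6 * \<epsilon> \<le> 1 / (2 * K\<^sup>2)"
    using eps K by (simp add: divide_simps mult_ac)
  then have "6 * \<epsilon> * (h * norm v)\<^sup>2 \<le> 1 / (2 * K\<^sup>2) * (h * norm v)\<^sup>2"
    by (rule mult_right_mono) simp
  also have "\<dots> = T / 2" by (simp add: T_def power_divide)
  finally have "T / 4 \<le> (norm (d * v))\<^sup>2"
    using 1 2 3 by linarith
  then have "h * norm v / (2 * K) \<le> norm (d * v)"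
    unfolding quarter[symmetric] by (rule power2_le_imp_le) simp
  then show "h / (2 * K) * norm v \<le> norm (d * v)" by simp
qed

lemma ex_D_inverse: "\<exists>Di. d * Di = pr s \<and> Di * d = pr s \<and> norm Di \<le> 2 * K / h"
proof -
  have "0 < h / (2 * K)" using h K by simp
  from low_inverse[OF D low_D this] show ?thesis by auto
qed

definition Di where "Di = (SOME Di. d * Di = pr s \<and> Di * d = pr s \<and> norm Di \<le> 2 * K / h)"

lemma Di: "d * Di = pr s" "Di * d = pr s" "norm Di \<le> 2 * K / h"
  using someI_ex[OF ex_D_inverse] by (auto simp: Di_def)

text \<open>The residual of the solve involves \<open>norm Q\<close>, about which nothing is known
  yet. Inverting d yields \<open>norm Q\<close> \<le> 8 K + \<open>norm Q\<close> / 2, and the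
  resulting crude bound is then put back into the residual.\<close>

lemma Q_D: "norm (Q * d - (U - q * Y)) \<le> 40 * K * \<epsilon> * h" and norm_Q_le: "norm Q \<le> 16 * K"
proof -
  have "norm q * norm Y \<le> 2 * h" using norm_q_le norm_Y_le_h by (intro mult_mono) auto
  with G mult_left_mono[OF this eps0] have G': "norm (G - q * Y) \<le> \<epsilon> * (2 * h)" by linarith
  have qY: "norm (q * Y) \<le> 2 * h" by (intro norm_bounds norm_q_le norm_Y_le_h)
  have "norm G \<le> 2 * h + \<epsilon> * (2 * h)" by (rule norm_le_of_diff[OF G' qY])
  then have "h + norm G \<le> 5 * h" using eps_h by simp
  with W2 mult_left_mono[OF this eps0] have W2': "norm (W2 - (U - G)) \<le> \<epsilon> * (5 * h)" by linarith
  have "norm Q * norm d \<le> norm Q * (2 * h)" using norm_D_le by (intro mult_left_mono) auto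
  with Q mult_left_mono[OF this eps0] have Q': "norm (Q * d - W2) \<le> \<epsilon> * (norm Q * (2 * h))" by linarith
  have "Q * d - (U - q * Y) = (Q * d - W2) + (W2 - (U - G)) - (G - q * Y)" by simp
  also have "norm \<dots> \<le> \<epsilon> * (norm Q * (2 * h)) + \<epsilon> * (5 * h) + \<epsilon> * (2 * h)"
    by (intro norm_bounds G' W2' Q')
  finally have e: "norm (Q * d - (U - q * Y)) \<le> \<epsilon> * (norm Q * (2 * h)) + \<epsilon> * (5 * h) + \<epsilon> * (2 * h)" .
  have "norm (U - q * Y) \<le> h + 2 * h" by (intro norm_bounds qY order_refl)
  from norm_le_of_diff[OF e this]
  have "norm (Q * d) \<le> 4 * h + \<epsilon> * norm Q * (2 * h)" using eps_h by (simp add: algebra_simps)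
  from norm_mult_bound[OF this Di(3)]
  have "norm (Q * d * Di) \<le> (4 * h + \<epsilon> * norm Q * (2 * h)) * (2 * K / h)" .
  also have "Q * d * Di = Q" by (simp add: mult.assoc Di Qs)
  also have "(4 * h + \<epsilon> * norm Q * (2 * h)) * (2 * K / h) = 8 * K + 4 * (K * \<epsilon>) * norm Q"
    using h by (simp add: field_simps)
  also have "4 * (K * \<epsilon>) * norm Q \<le> 1 / 2 * norm Q" using K_eps by (intro mult_right_mono) auto
  finally show norm_Q_le: "norm Q \<le> 16 * K" by simp
  have "\<epsilon> * (norm Q * (2 * h)) \<le> \<epsilon> * (16 * K * (2 * h))"
    using norm_Q_le h eps0 by (intro mult_left_mono mult_right_mono) auto
  then show "norm (Q * d - (U - q * Y)) \<le> 40 * K * \<epsilon> * h"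
    using e eps_h by (simp add: mult_ac)
qed

lemma star_Di: "star Di * star d = pr s" using arg_cong[OF Di(1), of star] by simp

text \<open>For exactly orthonormal q and Y = \<open>star q * U\<close>, Pythagoras gives U - q Y
  the Gram matrix \<open>star U * U - star Y * Y\<close>, which is nearly \<open>star d * d\<close>.
  The defect of q enters between two factors Y, so it contributes \<omega> \<eta> and not \<omega>.
  Multiplying by \<open>Di\<close> from both sides compares with the identity and costs (2 K /
  h)^2.\<close>

lemma orthogonality_Q: "norm (star Q * Q - pr s) \<le> 1160 * K ^ 3 * \<epsilon> + 4 * K\<^sup>2 * \<omega> * \<eta>"
proof -
  define e where "e = Q * d - (U - q * Y)"
  define f where "f = Y - star q * U"
  have e: "norm e \<le> 40 * K * \<epsilon> * h" using Q_D by (simp add: e_def)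
  have e1: "norm e \<le> h" using e eps_h by linarith
  have f: "norm f \<le> 2 * \<epsilon> * h" using Y_err by (simp add: f_def)
  have qU: "star q * U = Y - f" by (simp add: f_def)
  have Uq: "star U * q = star Y - star f" using arg_cong[OF qU, of star] by simp
  have Qd: "Q * d = U - q * Y + e" by (simp add: e_def)
  have Ups: "norm (U - q * Y) \<le> 3 * h"
    using norm_diff_bound[OF order_refl norm_mult_bound[OF norm_q_le norm_Y_le_h], of U] by simp
  have "star (Q * d) * (Q * d) - star d * d =
     - (star d * d - (star U * U - star Y * Y)) + (star f * Y + star Y * f + star Y * ((star q * q - pr n) * Y))
      + (star (U - q * Y) * e + star e * (U - q * Y) + star e * e)"
  proof -
    have "star (Q * d) * (Q * d) = star (U - q * Y) * (U - q * Y) + (star (U - q * Y) * e + star e * (U - q * Y) + star e * e)"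
      unfolding Qd by (simp add: algebra_simps)
    moreover have "star (U - q * Y) * (U - q * Y) = star U * U - star Y * Y + (star f * Y + star Y * f + star Y * ((star q * q - pr n) * Y))"
    proof -
      have "star (U - q * Y) * (U - q * Y) = star U * U - (star U * q) * Y - star Y * (star q * U) + star Y * (star q * q) * Y"
        by (simp add: algebra_simps)
      then show ?thesis unfolding Uq qU by (simp add: algebra_simps Yn)
    qed
    moreover have "a = b + z \<Longrightarrow> b = u - y + w \<Longrightarrow> a - v = - (v - (u - y)) + w + z" for a b u v w y z :: fmat
      by simp
    ultimately show ?thesis by blast
  qed
  also have "norm \<dots> \<le> 6 * \<epsilon> * h\<^sup>2 + (2 * \<epsilon> * h * h + h * (2 * \<epsilon> * h) + h * (\<omega> * (\<eta> * h)))
     + (3 * h * (40 * K * \<epsilon> * h) + 40 * K * \<epsilon> * h * (3 * h) + h * (40 * K * \<epsilon> * h))"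
    by (intro norm_bounds gram_D f norm_Y_le_h orth norm_Y_le Ups e e1)
  also have "\<dots> = (10 * \<epsilon> + 280 * (K * \<epsilon>) + \<omega> * \<eta>) * h\<^sup>2"
    by (simp add: algebra_simps power2_eq_square)
  also have "\<dots> \<le> (290 * (K * \<epsilon>) + \<omega> * \<eta>) * h\<^sup>2"
    using K_eps by (intro mult_right_mono) auto
  finally have le: "norm (star (Q * d) * (Q * d) - star d * d) \<le> (290 * (K * \<epsilon>) + \<omega> * \<eta>) * h\<^sup>2" .
  have "star Q * Q - pr s = star Di * (star (Q * d) * (Q * d) - star d * d) * Di"
  proof -
    have pq: "pr s * star Q = star Q" using arg_cong[OF Qs, of star] by simp
    have "star Di * (star (Q * d) * (Q * d)) * Di = (star Di * star d) * star Q * (Q * (d * Di))"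
      by (simp add: mult.assoc)
    also have "\<dots> = star Q * Q" by (simp only: star_Di Di(1) Qs pq)
    finally have 1: "star Di * (star (Q * d) * (Q * d)) * Di = star Q * Q" .
    have "star Di * (star d * d) * Di = (star Di * star d) * (d * Di)" by (simp add: mult.assoc)
    then have 2: "star Di * (star d * d) * Di = pr s" by (simp only: star_Di Di(1) pr_mult_pr)
    show ?thesis by (simp only: right_diff_distrib left_diff_distrib 1 2)
  qed
  also have "norm \<dots> \<le> 2 * K / h * ((290 * (K * \<epsilon>) + \<omega> * \<eta>) * h\<^sup>2) * (2 * K / h)"
    by (intro norm_bounds Di le)
  also have "\<dots> = 1160 * K ^ 3 * \<epsilon> + 4 * K\<^sup>2 * \<omega> * \<eta>"
    using h by (simp add: field_simps power2_eq_square power3_eq_cube)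
  finally show ?thesis .
qed

text \<open>Again the defect of q acts on Y only, since \<open>star q * (U - q * Y)\<close> is the
  error of Y minus the defect applied to Y.\<close>

lemma orthogonality_q_Q: "norm (star q * Q) \<le> 2 * K * \<omega> * \<eta> + 164 * K\<^sup>2 * \<epsilon>"
proof -
  have eq: "star q * (Q * d) = star q * (Q * d - (U - q * Y)) - (Y - star q * U) - (star q * q - pr n) * Y"
    by (simp add: algebra_simps Yn)
  have "norm (star q * (Q * d)) \<le> 2 * (40 * K * \<epsilon> * h) + 2 * \<epsilon> * h + \<omega> * (\<eta> * h)"
    unfolding eq by (intro norm_bounds norm_q_le Q_D Y_err orth norm_Y_le)
  also have "\<dots> \<le> (82 * (K * \<epsilon>) + \<omega> * \<eta>) * h"
    using eps_h by (simp add: algebra_simps)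
  finally have le: "norm (star q * (Q * d)) \<le> (82 * (K * \<epsilon>) + \<omega> * \<eta>) * h" .
  have "star q * Q = star q * (Q * d) * Di" by (simp add: mult.assoc Di Qs)
  also have "norm \<dots> \<le> (82 * (K * \<epsilon>) + \<omega> * \<eta>) * h * (2 * K / h)"
    by (intro norm_bounds le Di)
  also have "\<dots> = 2 * K * \<omega> * \<eta> + 164 * K\<^sup>2 * \<epsilon>"
    using h by (simp add: field_simps power2_eq_square)
  finally show ?thesis .
qed

text \<open>In exact arithmetic q (S + Y C) + Q D C = q S + (q Y + Q D) C = q S + U C = x. The proof
  writes the deviation as a sum with one term per rounded operation of this chain. Every term
  carries C either with d or with h, so \<open>h_C\<close> applies.\<close>

lemma residual: "norm (q * R + Q * R' - x) \<le> 300 * K\<^sup>2 * \<epsilon> * N"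
proof -
  have hC: "h * norm c \<le> 3 * K * N" by (rule h_C)
  have C_le: "\<epsilon> * (h * norm c) \<le> \<epsilon> * (3 * K * N)" using hC eps0 by (rule mult_left_mono)
  have "norm Y * norm c \<le> h * norm c" using norm_Y_le_h by (intro mult_right_mono) auto
  then have YC: "norm Y * norm c \<le> 3 * K * N" using hC by linarith
  then have nYC: "norm (Y * c) \<le> 3 * K * N" using norm_mult_ineq order_trans by blast
  have G3': "norm (G3 - Y * c) \<le> \<epsilon> * (3 * K * N)"
    using G3 mult_left_mono[OF YC eps0] by linarith
  have NK: "N \<le> K * N" using mult_right_mono[OF K N] by simp
  have "norm G3 \<le> 3 * K * N + \<epsilon> * (3 * K * N)" by (rule norm_le_of_diff[OF G3' nYC])
  then have "norm S + norm G3 \<le> 9 * K * N" using norm_S_le NK K_eps_N by (simp add: mult_ac)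
  then have R1: "norm (R - (S + G3)) \<le> \<epsilon> * (9 * K * N)"
    using R mult_left_mono[OF _ eps0] order_trans by blast
  have "norm d * norm c \<le> 2 * h * norm c" using norm_D_le by (intro mult_right_mono) auto
  then have "norm d * norm c \<le> 6 * K * N" using hC by simp
  then have R2: "norm (R' - d * c) \<le> \<epsilon> * (6 * K * N)"
    using R' mult_left_mono[OF _ eps0] order_trans by blast
  have "norm ((Q * d - (U - q * Y)) * c) \<le> 40 * K * \<epsilon> * h * norm c"
    by (intro norm_bounds Q_D order_refl)
  also have "\<dots> \<le> 40 * K * (\<epsilon> * (3 * K * N))"
    using mult_left_mono[OF C_le, of "40 * K"] K by (simp add: mult_ac)
  finally have Qdc: "norm ((Q * d - (U - q * Y)) * c) \<le> 40 * K * (\<epsilon> * (3 * K * N))" .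
  have "q * R + Q * R' - x = q * (R - (S + G3)) + q * (G3 - Y * c) + Q * (R' - d * c)
     + (Q * d - (U - q * Y)) * c + (U * c - W) + (W - (x - q * S))"
    by (simp add: algebra_simps)
  also have "norm \<dots> \<le> 2 * (\<epsilon> * (9 * K * N)) + 2 * (\<epsilon> * (3 * K * N)) + 16 * K * (\<epsilon> * (6 * K * N))
     + 40 * K * (\<epsilon> * (3 * K * N)) + 4 * K * \<epsilon> * N + 20 * \<epsilon> * N"
    by (intro norm_bounds norm_q_le R1 G3' norm_Q_le R2 Qdc U(1) W(1))
  also have "\<dots> = 28 * (K * \<epsilon> * N) + 20 * (\<epsilon> * N) + 216 * (K\<^sup>2 * \<epsilon> * N)"
    by (simp add: algebra_simps power2_eq_square)
  also have "\<dots> \<le> 300 * K\<^sup>2 * \<epsilon> * N"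
    using mult_right_mono[OF K_eps(2) N] K_eps_N mult_right_mono[OF K_eps(1) N] by (simp add: algebra_simps)
  finally show ?thesis .
qed

text \<open>Since Q D is nearly U - q Y, transposing gives that \<open>star d * star Q * y\<close>
  is nearly \<open>star U * y - star Y * (star q * y)\<close>, the quantity formed in part (a). All
  its errors scale with h, and inverting d costs 2 K / h, so the scale of U cancels. The bound on V
  absorbs half of its own norm; the resulting 250 for V and 2 for Z are rounded up to 260.\<close>

lemma next_S:
  assumes y: "norm y \<le> N"
    and Z: "norm (Z - star q * y) \<le> \<epsilon> * (norm (star q) * norm y)"
    and P: "norm (P - star U * y) \<le> \<epsilon> * (norm (star U) * norm y)"
    and G4: "norm (G4 - star Y * Z) \<le> \<epsilon> * (norm (star Y) * norm Z)"
    and W4: "norm (W4 - (P - G4)) \<le> \<epsilon> * (norm P + norm G4)"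
    and V: "norm (star V * d - star W4) \<le> \<epsilon> * (norm (star V) * norm d)" "pr s * V = V"
    and J: "norm J \<le> 1"
  shows "norm ((Z + star J * V) - star (q + Q * J) * y) \<le> 260 * K\<^sup>2 * \<epsilon> * N"
proof -
  have "norm (star q) * norm y \<le> 2 * N" using norm_q_le y by (intro mult_mono) auto
  with Z mult_left_mono[OF this eps0] have Z': "norm (Z - star q * y) \<le> \<epsilon> * (2 * N)" by linarith
  have "norm (star q * y) \<le> 2 * N" using norm_q_le y by (intro norm_bounds)
  from norm_le_of_diff[OF Z' this] have nZ: "norm Z \<le> 4 * N"
    using K_eps_N N by simp
  have "norm (star U) * norm y \<le> h * N" using y by (intro mult_mono) auto
  with P mult_left_mono[OF this eps0] have P': "norm (P - star U * y) \<le> \<epsilon> * (h * N)" by linarith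
  have "norm (star U * y) \<le> h * N" using y by (intro norm_bounds) auto
  have eps1: "\<epsilon> \<le> 1" using K_eps by linarith
  have hN: "0 \<le> h * N" using h N by simp
  from norm_le_of_diff[OF P' \<open>norm (star U * y) \<le> h * N\<close>] have nP: "norm P \<le> 2 * (h * N)"
    using mult_right_mono[OF eps1 hN] by simp
  have YZ: "norm (star Y) * norm Z \<le> h * (4 * N)" using norm_Y_le_h nZ by (intro mult_mono) auto
  with G4 mult_left_mono[OF this eps0] have G4': "norm (G4 - star Y * Z) \<le> \<epsilon> * (h * (4 * N))" by linarith
  have "norm (star Y * Z) \<le> h * (4 * N)" using norm_Y_le_h nZ by (intro norm_bounds)
  from norm_le_of_diff[OF G4' this] have nG4: "norm G4 \<le> 8 * (h * N)"
    using mult_right_mono[OF eps1 hN] by (simp add: mult_ac)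
  have "norm P + norm G4 \<le> 10 * (h * N)" using nP nG4 by simp
  with W4 mult_left_mono[OF this eps0] have W4': "norm (W4 - (P - G4)) \<le> \<epsilon> * (10 * (h * N))" by linarith
  have "norm (star V) * norm d \<le> norm V * (2 * h)" using norm_D_le by (intro mult_mono) auto
  with V(1) mult_left_mono[OF this eps0]
  have V1: "norm (star V * d - star W4) \<le> \<epsilon> * (norm V * (2 * h))" by linarith
  have V': "norm (star d * V - W4) \<le> \<epsilon> * (norm V * (2 * h))"
    using V1 norm_star[of "star V * d - star W4"] by simp
  have "norm (star (Q * d - (U - q * Y)) * y) \<le> 40 * K * \<epsilon> * h * N"
    by (intro norm_bounds Q_D y)
  have eq: "star d * (V - star Q * y) = (star d * V - W4) + (W4 - (P - G4)) + (P - star U * y) - (G4 - star Y * Z)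
      - star Y * (Z - star q * y) - star (Q * d - (U - q * Y)) * y"
    by (simp add: algebra_simps)
  have "norm (star d * (V - star Q * y)) \<le> \<epsilon> * (norm V * (2 * h)) + \<epsilon> * (10 * (h * N)) + \<epsilon> * (h * N)
      + \<epsilon> * (h * (4 * N)) + h * (\<epsilon> * (2 * N)) + 40 * K * \<epsilon> * h * N"
    unfolding eq by (intro norm_bounds V' W4' P' G4' norm_Y_le_h Z' Q_D y)
  also have "\<dots> = \<epsilon> * (norm V * (2 * h)) + 17 * (\<epsilon> * h) * N + 40 * K * \<epsilon> * h * N" by (simp add: algebra_simps)
  also have "\<dots> \<le> (2 * \<epsilon> * norm V + 57 * (K * \<epsilon>) * N) * h"
    using mult_right_mono[OF eps_h(1) N] by (simp add: algebra_simps)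
  finally have le: "norm (star d * (V - star Q * y)) \<le> (2 * \<epsilon> * norm V + 57 * (K * \<epsilon>) * N) * h" .
  have pq: "pr s * star Q = star Q" using arg_cong[OF Qs, of star] by simp
  have "V - star Q * y = star Di * (star d * (V - star Q * y))"
  proof -
    have "star Di * (star d * (V - star Q * y)) = pr s * (V - star Q * y)"
      using star_Di by (simp flip: mult.assoc)
    then show ?thesis by (simp add: right_diff_distrib V(2) pq flip: mult.assoc)
  qed
  also have "norm \<dots> \<le> 2 * K / h * ((2 * \<epsilon> * norm V + 57 * (K * \<epsilon>) * N) * h)"
    by (intro norm_bounds Di le)
  also have "\<dots> = 4 * (K * \<epsilon>) * norm V + 114 * (K\<^sup>2 * \<epsilon> * N)"
    using h by (simp add: field_simps power2_eq_square)
  finally have dV: "norm (V - star Q * y) \<le> 4 * (K * \<epsilon>) * norm V + 114 * (K\<^sup>2 * \<epsilon> * N)" .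
  have "norm (star Q * y) \<le> 16 * K * N" by (intro norm_bounds norm_Q_le y)
  from norm_le_of_diff[OF dV this]
  have "norm V \<le> 16 * K * N + 4 * (K * \<epsilon>) * norm V + 114 * (K\<^sup>2 * \<epsilon> * N)" by simp
  moreover have "4 * (K * \<epsilon>) * norm V \<le> 1 / 2 * norm V" using K_eps by (intro mult_right_mono) auto
  moreover have "K\<^sup>2 * \<epsilon> * N \<le> 1 / 260 * N" using K_eps N by (intro mult_right_mono) auto
  moreover have "N \<le> K * N" using mult_right_mono[OF K N] by simp
  ultimately have nV: "norm V \<le> 34 * (K * N)" using N by (simp add: mult.assoc)
  have "4 * (K * \<epsilon>) * norm V \<le> 4 * (K * \<epsilon>) * (34 * (K * N))"
    using nV K eps0 by (intro mult_left_mono) auto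
  then have dV': "norm (V - star Q * y) \<le> 250 * (K\<^sup>2 * \<epsilon> * N)"
    using dV by (simp add: power2_eq_square mult_ac)
  have "(Z + star J * V) - star (q + Q * J) * y = (Z - star q * y) + star J * (V - star Q * y)"
    by (simp add: algebra_simps)
  also have "norm \<dots> \<le> \<epsilon> * (2 * N) + 1 * (250 * (K\<^sup>2 * \<epsilon> * N))"
    by (intro norm_bounds Z' J dV')
  also have "\<dots> \<le> 260 * K\<^sup>2 * \<epsilon> * N"
    using mult_right_mono[OF order_trans[OF K_eps(1,2)] N] K_eps_N(3) by (simp add: algebra_simps)
  finally show ?thesis .
qed

end

section \<open>Block columns and the two versions of a step\<close>

text \<open>The matrix [0,...,0,I] for block number k counted from 0, whereas
  \<open>block_col\<close> counts from 1. Multiplying by its transpose on the right extracts a block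
  column, and multiplying by \<open>sel s k\<close> itself puts one in place.\<close>

definition sel :: "nat \<Rightarrow> nat \<Rightarrow> fmat" where
  "sel s k = emb (mat s (Suc k * s) (\<lambda>(i, j). if j = k * s + i then 1 else 0))"

lemma ent_sel: "ent (sel s k) i j = (if i < s \<and> j = k * s + i then 1 else 0)"
  by (auto simp: sel_def ent_emb)

lemma ent_sel_mult: "ent (sel s k * a) i j = (if i < s then ent a (k * s + i) j else 0)"
proof -
  have "ent (sel s k * a) i j = (\<Sum>l<Suc k * s. ent (sel s k) i l * ent a l j)"
    by (rule ent_mult_cols) (auto simp: ent_sel)
  also have "\<dots> = (\<Sum>l<Suc k * s. if l = k * s + i then if i < s then ent a (k * s + i) j else 0 else 0)"
    by (intro sum.cong) (auto simp: ent_sel)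
  also have "\<dots> = (if i < s then ent a (k * s + i) j else 0)"
    by (simp add: sum.delta)
  finally show ?thesis .
qed

lemma ent_star_sel_mult:
  "ent (star (sel s k) * a) i j = (if k * s \<le> i \<and> i < k * s + s then ent a (i - k * s) j else 0)"
proof -
  have "ent (star (sel s k) * a) i j = (\<Sum>l<s. ent (star (sel s k)) i l * ent a l j)"
    by (rule ent_mult_cols) (auto simp: ent_sel)
  also have "\<dots> = (\<Sum>l<s. if l = i - k * s then if k * s \<le> i then ent a (i - k * s) j else 0 else 0)"
    by (intro sum.cong) (auto simp: ent_sel)
  also have "\<dots> = (if k * s \<le> i \<and> i < k * s + s then ent a (i - k * s) j else 0)"
    by (auto simp: sum.delta)
  finally show ?thesis .
qed

lemma ent_mult_star_sel: "ent (a * star (sel s k)) i j = (if j < s then ent a i (k * s + j) else 0)"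
proof -
  have "ent (a * star (sel s k)) i j = ent (sel s k * star a) j i"
    by (metis ent_star star_mult star_simps(4))
  then show ?thesis by (simp add: ent_sel_mult)
qed

lemma ent_mult_sel:
  "ent (a * sel s k) i j = (if k * s \<le> j \<and> j < k * s + s then ent a i (j - k * s) else 0)"
proof -
  have "ent (a * sel s k) i j = ent (star (sel s k) * star a) j i"
    by (metis ent_star star_mult)
  then show ?thesis by (simp add: ent_star_sel_mult)
qed

lemma sel_star_sel: "sel s k * star (sel s k) = pr s"
  by (rule fmat_eqI) (auto simp: ent_mult_star_sel ent_sel ent_pr)

lemma sel_pr: "sel s k * pr (k * s) = 0"
  by (rule fmat_eqI) (auto simp: ent_sel)

lemma pr_Suc: "pr (Suc k * s) = pr (k * s) + star (sel s k) * sel s k"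
  by (rule fmat_eqI) (cases "s = 0"; auto simp: ent_star_sel_mult ent_sel ent_pr)

lemma pr_pr: "n \<le> l \<Longrightarrow> pr l * pr n = pr n"
  by (rule fmat_eqI) (auto simp: ent_pr)

lemma pr_star_sel: "k < p \<Longrightarrow> pr (p * s) * star (sel s k) = star (sel s k)"
proof (rule fmat_eqI)
  fix i j assume "k < p"
  then have "Suc k * s \<le> p * s" by (intro mult_le_mono1) simp
  then show "ent (pr (p * s) * star (sel s k)) i j = ent (star (sel s k)) i j"
    by (auto simp: ent_sel)
qed

lemma norm_sel_le: "norm (sel s k) \<le> 1"
proof -
  have "(norm (sel s k))\<^sup>2 = norm (pr s)"
    using norm_star_mult[of "star (sel s k)"] by (simp add: sel_star_sel)
  also have "\<dots> \<le> 1\<^sup>2" using norm_pr_le by simp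
  finally show ?thesis by (rule power2_le_imp_le) simp
qed

lemma emb_block_col:
  assumes "X \<in> carrier_mat m (p * s)" "k < p"
  shows "emb (block_col s X (Suc k)) = emb X * star (sel s k)"
proof (rule fmat_eqI)
  fix i j
  have "Suc k * s \<le> p * s" using assms(2) by (intro mult_le_mono1) simp
  then show "ent (emb (block_col s X (Suc k))) i j = ent (emb X * star (sel s k)) i j"
    using assms(1) by (auto simp: block_col_def ent_emb ent_mult_star_sel)
qed

lemma block_col_carrier: "X \<in> carrier_mat m n \<Longrightarrow> block_col s X k \<in> carrier_mat m s"
  by (simp add: block_col_def)

lemma emb_append_rows:
  assumes "Z \<in> carrier_mat (k * s) l" "V \<in> carrier_mat s l"
  shows "emb (Z @\<^sub>r V) = emb Z + star (sel s k) * emb V"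
  using assms
  by (intro fmat_eqI) (auto simp: append_rows_def ent_emb ent_star_sel_mult)

lemma qcat_carrier: "qcat m s a k \<in> carrier_mat m (k * s)"
  by (simp add: qcat_def)

lemma rcat_carrier: "rcat s a k \<in> carrier_mat (k * s) (k * s)"
  by (simp add: rcat_def)

lemma div_mod_block: "k * s \<le> j \<Longrightarrow> j < k * s + s \<Longrightarrow> j div s = k \<and> j mod s = j - k * s" for j k s :: nat
  by (metis add_diff_inverse_nat div_nat_eqI less_diff_conv2 modulo_nat_def mult.commute mult_Suc not_less add.commute)

lemma div_less_block: "j < k * s \<Longrightarrow> j div s < k" for j k s :: nat
  by (simp add: less_mult_imp_div_less)

lemma qcat_Suc:
  assumes "qb a (Suc k) \<in> carrier_mat m s"
  shows "emb (qcat m s a (Suc k)) = emb (qcat m s a k) + emb (qb a (Suc k)) * sel s k"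
proof (rule fmat_eqI)
  fix i j
  show "ent (emb (qcat m s a (Suc k))) i j = ent (emb (qcat m s a k) + emb (qb a (Suc k)) * sel s k) i j"
    using assms div_mod_block[of k s j] by (auto simp: qcat_def ent_emb ent_mult_sel)
qed

lemma rcat_Suc:
  assumes "rc a (Suc k) \<in> carrier_mat (k * s) s" "rd a (Suc k) \<in> carrier_mat s s"
  shows "emb (rcat s a (Suc k)) =
    emb (rcat s a k) + (emb (rc a (Suc k)) + star (sel s k) * emb (rd a (Suc k))) * sel s k"
proof (rule fmat_eqI)
  fix i j
  consider "j < k * s" | "k * s \<le> j" "j < k * s + s" | "k * s + s \<le> j" by linarith
  then show "ent (emb (rcat s a (Suc k))) i j =
    ent (emb (rcat s a k) + (emb (rc a (Suc k)) + star (sel s k) * emb (rd a (Suc k))) * sel s k) i j"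
  proof cases
    case 1
    then show ?thesis
      using div_less_block[of j k s] div_mod_block[of k s i] by (auto simp: rcat_def ent_emb ent_mult_sel)
  next
    case 2
    then show ?thesis
      using assms div_mod_block[of k s j] div_mod_block[of k s i] div_less_block[of i k s]
      by (auto simp: rcat_def ent_emb ent_mult_sel ent_star_sel_mult)
  next
    case 3
    then show ?thesis by (auto simp: rcat_def ent_emb ent_mult_sel)
  qed
qed

lemma qcat_1: "qb a 1 \<in> carrier_mat m s \<Longrightarrow> emb (qcat m s a 1) = emb (qb a 1)"
  by (rule fmat_eqI) (auto simp: qcat_def ent_emb)

lemma rcat_1: "rd a 1 \<in> carrier_mat s s \<Longrightarrow> emb (rcat s a 1) = emb (rd a 1)"
  by (rule fmat_eqI) (auto simp: rcat_def ent_emb)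

section \<open>Conditioning of U in the two versions\<close>

context fp_model
begin

text \<open>The test inspects the computed Gram matrix, which differs from the exact one by at most
  \<epsilon> h^2. Its largest eigenvalue is at least h^2 / 2, so failure of the test and 2 |cst|
  \<le> K make K^2 times the smallest at least 2 h^2. Subtracting the perturbation leaves more than
  the h^2 that is claimed.\<close>

lemma low_of_not_switch_test:
  assumes U: "U \<in> carrier_mat m s" and s: "0 < s" and dims: "real m \<le> M" "real s \<le> M"
    and \<Omega>: "fl_gram u U \<Omega>" and test: "\<not> switch_test cst \<Omega>"
    and K: "2 * \<bar>cst\<bar> \<le> K" "2 \<le> K" and eps: "260 * K\<^sup>2 * \<epsilon> \<le> 1"
  shows "low s (emb U) (norm (emb U) / K)"
proof -
  note g = fl_gram_error[OF \<Omega> U dims]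
  define h where "h = norm (emb U)"
  define E where "E = \<Omega> - U\<^sup>T * U"
  have Ut: "U\<^sup>T \<in> carrier_mat s m" and UtU: "U\<^sup>T * U \<in> carrier_mat s s" using U by auto
  have E: "E \<in> carrier_mat s s" unfolding E_def by (rule minus_carrier_mat[OF UtU])
  have nE: "norm (emb E) \<le> \<epsilon> * h\<^sup>2"
    using g(3) emb_minus[OF g(1) UtU] emb_mult[OF Ut U] by (simp add: E_def h_def emb_transpose)
  have quad: "\<bar>v \<bullet> (\<Omega> *\<^sub>v v) - (vnorm (U *\<^sub>v v))\<^sup>2\<bar> \<le> \<epsilon> * h\<^sup>2 * (v \<bullet> v)" if v: "v \<in> carrier_vec s" for v
  proof -
    have "v \<bullet> (E *\<^sub>v v) = v \<bullet> (\<Omega> *\<^sub>v v) - v \<bullet> ((U\<^sup>T * U) *\<^sub>v v)"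
      using v g(1) UtU by (simp add: E_def minus_mult_distrib_mat_vec[of _ s s] scalar_prod_minus_distrib[of _ s])
    then have "\<bar>v \<bullet> (\<Omega> *\<^sub>v v) - (vnorm (U *\<^sub>v v))\<^sup>2\<bar> \<le> norm (emb E) * (v \<bullet> v)"
      using abs_quad_form_le[OF E v] by (simp add: gram_quad_form[OF U v])
    also have "\<dots> \<le> \<epsilon> * h\<^sup>2 * (v \<bullet> v)"
      using nE by (intro mult_right_mono) (auto simp flip: vnorm_sq)
    finally show ?thesis .
  qed
  have "lambda_max (U\<^sup>T * U) \<le> lambda_max \<Omega> + \<epsilon> * h\<^sup>2"
  proof (rule lambda_max_le[OF gram_props[OF U s] s])
    fix v :: "real vec" assume v: "v \<in> carrier_vec s"
    show "v \<bullet> ((U\<^sup>T * U) *\<^sub>v v) \<le> (lambda_max \<Omega> + \<epsilon> * h\<^sup>2) * (v \<bullet> v)"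
      using le_lambda_max[OF g(1,2) s v] quad[OF v] by (simp add: gram_quad_form[OF U v] algebra_simps)
  qed
  then have max: "h\<^sup>2 - \<epsilon> * h\<^sup>2 \<le> lambda_max \<Omega>"
    by (simp add: lambda_max_gram[OF U s] h_def)
  have K2: "4 \<le> K\<^sup>2" using power_mono[OF K(2), of 2] by simp
  have e: "\<epsilon> * K\<^sup>2 \<le> 1 / 260" using eps by (simp add: mult_ac)
  have e2: "\<epsilon> \<le> 1 / 2" using mult_left_mono[OF K2 eps_nonneg] e eps_nonneg by linarith
  have "h\<^sup>2 / 2 \<le> lambda_max \<Omega>" using max mult_right_mono[OF e2, of "h\<^sup>2"] by simp
  also have "lambda_max \<Omega> < cst\<^sup>2 * lambda_min \<Omega>" using test by (simp add: switch_test_def)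
  finally have lt: "h\<^sup>2 / 2 < cst\<^sup>2 * lambda_min \<Omega>" .
  then have pos: "0 < lambda_min \<Omega>"
    by (smt (verit) divide_nonneg_nonneg mult_nonneg_nonpos zero_le_power2)
  have "4 * cst\<^sup>2 \<le> K\<^sup>2"
    using power_mono[OF K(1), of 2] by (simp add: power_mult_distrib)
  then have "4 * cst\<^sup>2 * lambda_min \<Omega> \<le> K\<^sup>2 * lambda_min \<Omega>"
    using pos by (intro mult_right_mono) auto
  then have min: "2 * h\<^sup>2 \<le> K\<^sup>2 * lambda_min \<Omega>" using lt by linarith
  show ?thesis
    unfolding low_emb_iff[OF U]
  proof
    fix v :: "real vec" assume v: "v \<in> carrier_vec s"
    have vv: "0 \<le> v \<bullet> v" by (simp flip: vnorm_sq)
    have "lambda_min \<Omega> * (v \<bullet> v) \<le> (vnorm (U *\<^sub>v v))\<^sup>2 + \<epsilon> * h\<^sup>2 * (v \<bullet> v)"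
      using lambda_min_le[OF g(1,2) s v] quad[OF v] by linarith
    then have "K\<^sup>2 * (lambda_min \<Omega> * (v \<bullet> v)) \<le> K\<^sup>2 * ((vnorm (U *\<^sub>v v))\<^sup>2 + \<epsilon> * h\<^sup>2 * (v \<bullet> v))"
      by (intro mult_left_mono) auto
    also have "\<dots> = K\<^sup>2 * (vnorm (U *\<^sub>v v))\<^sup>2 + \<epsilon> * K\<^sup>2 * (h\<^sup>2 * (v \<bullet> v))"
      by (simp add: algebra_simps)
    also have "\<epsilon> * K\<^sup>2 * (h\<^sup>2 * (v \<bullet> v)) \<le> 1 / 260 * (h\<^sup>2 * (v \<bullet> v))"
      using e vv by (intro mult_right_mono) auto
    finally have 1: "K\<^sup>2 * (lambda_min \<Omega> * (v \<bullet> v)) \<le>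
        K\<^sup>2 * (vnorm (U *\<^sub>v v))\<^sup>2 + 1 / 260 * (h\<^sup>2 * (v \<bullet> v))" by simp
    have 2: "2 * (h\<^sup>2 * (v \<bullet> v)) \<le> K\<^sup>2 * (lambda_min \<Omega> * (v \<bullet> v))"
      using mult_right_mono[OF min vv] by (simp add: mult.assoc)
    have "h\<^sup>2 * (v \<bullet> v) \<le> K\<^sup>2 * (vnorm (U *\<^sub>v v))\<^sup>2"
      using 1 2 mult_nonneg_nonneg[OF zero_le_power2[of h] vv] by linarith
    then have "(h * vnorm v)\<^sup>2 \<le> (K * vnorm (U *\<^sub>v v))\<^sup>2"
      by (simp add: power_mult_distrib vnorm_sq)
    then have "h * vnorm v \<le> K * vnorm (U *\<^sub>v v)"
      by (rule power2_le_imp_le) (use K in auto)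
    then show "norm (emb U) / K * vnorm v \<le> vnorm (U *\<^sub>v v)"
      using K by (simp add: h_def divide_simps mult.commute)
  qed
qed

text \<open>The residual of the solve is relative to the product of the norms of U and C. The
  conditioning of U bounds this product by K times the norm of U C, and the rounding part of that
  bound is absorbed, leaving 4 K N.\<close>

lemma step_1S_bounds:
  assumes st: "step_1S u m s X a k U C" and \<Omega>: "fl_gram u U \<Omega>" and test: "\<not> switch_test cst \<Omega>"
    and s: "0 < s" and dims: "real m \<le> M" "real s \<le> M" "real l \<le> M"
    and X: "X \<in> carrier_mat m n" and sc: "sc a (k + 1) \<in> carrier_mat l s"
    and K: "2 * \<bar>cst\<bar> \<le> K" "2 \<le> K" and eps: "260 * K\<^sup>2 * \<epsilon> \<le> 1"
    and W: "\<And>W. step_W u m s X a k W \<Longrightarrow> W \<in> carrier_mat m s \<and> norm (emb W) \<le> 2 * N"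
  shows "U \<in> carrier_mat m s \<and> C \<in> carrier_mat s s \<and> low s (emb U) (norm (emb U) / K) \<and>
    (\<exists>W. step_W u m s X a k W \<and> norm (emb U * emb C - emb W) \<le> 4 * K * \<epsilon> * N)"
proof -
  obtain T H D W where st: "fl_gram u (block_col s X (k + 1)) T" "fl_gram u (sc a (k + 1)) H"
    "fl_minus u T H D" "fl_chol u D C" "step_W u m s X a k W" "fl_solve u C W U"
    using st by (auto simp: step_1S_def)
  have T: "T \<in> carrier_mat s s" by (rule fl_gram_error(1)[OF st(1) block_col_carrier[OF X] dims(1,2)])
  have H: "H \<in> carrier_mat s s" by (rule fl_gram_error(1)[OF st(2) sc dims(3,2)])
  have D: "D \<in> carrier_mat s s" using fl_minus_error[OF T H dims(2,2) st(3)] by blast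
  note C = fl_chol_pos_diag[OF st(4) D dims(2)]
  have nW: "W \<in> carrier_mat m s" "norm (emb W) \<le> 2 * N" using W[OF st(5)] by auto
  have "C $$ (j, j) \<noteq> 0" if "j < s" for j using C(3)[OF that] by simp
  note sv = fl_solve_error[OF st(6) C(1) nW(1) C(2) this dims(1,2)]
  have low: "low s (emb U) (norm (emb U) / K)"
    by (rule low_of_not_switch_test[OF sv(1) s dims(1,2) \<Omega> test K eps])
  have "norm (emb U) / K * norm (emb C) \<le> norm (emb U * emb C)"
    by (rule lowD[OF low pr_emb[OF C(1)]])
  also have "\<dots> \<le> 2 * N + \<epsilon> * (norm (emb U) * norm (emb C))"
    by (rule norm_le_of_diff[OF sv(2) nW(2)])
  finally have 1: "norm (emb U) * norm (emb C) \<le> 2 * K * N + K * \<epsilon> * (norm (emb U) * norm (emb C))"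
    using K by (simp add: field_simps)
  have "2 * K \<le> 260 * K\<^sup>2" using K by (simp add: power2_eq_square)
  then have "2 * K * \<epsilon> \<le> 1" using mult_right_mono[OF _ eps_nonneg] eps by fastforce
  then have "K * \<epsilon> * (norm (emb U) * norm (emb C)) \<le> 1 / 2 * (norm (emb U) * norm (emb C))"
    by (intro mult_right_mono) auto
  then have "norm (emb U) * norm (emb C) \<le> 4 * K * N" using 1 by linarith
  then have "\<epsilon> * (norm (emb U) * norm (emb C)) \<le> \<epsilon> * (4 * K * N)"
    using eps_nonneg by (rule mult_left_mono)
  then have "norm (emb U * emb C - emb W) \<le> 4 * K * \<epsilon> * N" using sv(2) by (simp add: mult_ac)
  then show ?thesis using low sv(1) C(1) st(5) by blast
qed

text \<open>A loss of orthogonality of at most 1/2 puts the squared singular values of U between 1/2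
  and 3/2. Their ratio is at most 3, hence below K^2.\<close>

lemma step_2S_bounds:
  assumes st: "step_2S u m s IO1 X a k U C"
    and s: "0 < s" and K: "2 \<le> K" and b: "b1 \<le> \<epsilon>" "0 \<le> b2" "b2 * (\<tau> * \<kappa>) \<le> 1 / 2" and \<alpha>1: "\<alpha>1 \<le> 1"
    and W: "\<And>W. step_W u m s X a k W \<Longrightarrow> W \<in> carrier_mat m s \<and> norm (emb W) \<le> 2 * N \<and>
        0 < sigma_min W \<and> kappa W \<le> \<tau> * \<kappa>"
    and IO1: "\<And>B. B \<in> carrier_mat m s \<Longrightarrow> 0 < sigma_min B \<Longrightarrow> kappa B \<le> \<tau> * \<kappa> \<Longrightarrow>
        approx_qr B (IO1 B) b1 (b2 * kappa B powr \<alpha>1)"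
  shows "U \<in> carrier_mat m s \<and> C \<in> carrier_mat s s \<and> low s (emb U) (norm (emb U) / K) \<and>
    (\<exists>W. step_W u m s X a k W \<and> norm (emb U * emb C - emb W) \<le> 4 * K * \<epsilon> * N)"
proof -
  obtain W where st: "step_W u m s X a k W" "IO1 W = (U, C)" using st by (auto simp: step_2S_def)
  have W: "W \<in> carrier_mat m s" "norm (emb W) \<le> 2 * N" "0 < sigma_min W" "kappa W \<le> \<tau> * \<kappa>"
    using W[OF st(1)] by auto
  then obtain \<Delta>X where q: "U \<in> carrier_mat m s" "C \<in> carrier_mat s s" "\<Delta>X \<in> carrier_mat m s"
      "W + \<Delta>X = U * C" "mnorm \<Delta>X \<le> b1 * mnorm W" "mnorm (1\<^sub>m s - U\<^sup>T * U) \<le> b2 * kappa W powr \<alpha>1"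
    using IO1[OF W(1,3,4)] st(2) by (auto simp: approx_qr_def)
  \<comment> \<open>This allows the exponent \<alpha>1 \<le> 1, which may even be negative, to be
    replaced by 1.\<close>
  have "1 \<le> kappa W"
    using low_norm[OF low_sigma_min[OF W(1) s] s emb_pr[OF W(1)]] W(3)
    by (simp add: kappa_def sigma_max_eq[OF W(1) s] divide_simps)
  then have "kappa W powr \<alpha>1 \<le> kappa W powr 1" using \<alpha>1 by (intro powr_mono) auto
  also have "\<dots> \<le> \<tau> * \<kappa>" using \<open>1 \<le> kappa W\<close> W(4) by simp
  finally have "mnorm (1\<^sub>m s - U\<^sup>T * U) \<le> 1 / 2"
    using q(6) mult_left_mono[OF _ b(2)] b(3) by fastforce
  moreover have Ut: "U\<^sup>T \<in> carrier_mat s m" and UtU: "U\<^sup>T * U \<in> carrier_mat s s" using q(1) by auto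
  ultimately have orth: "norm (pr s - star (emb U) * emb U) \<le> 1 / 2"
    using mnorm_eq[OF minus_carrier_mat[OF UtU], of "1\<^sub>m s"] s emb_minus[OF one_carrier_mat UtU] emb_mult[OF Ut q(1)]
    by (simp add: pr_def emb_transpose)
  let ?h = "norm (emb U)"
  have "?h\<^sup>2 = norm (pr s - (pr s - star (emb U) * emb U))" by (simp add: norm_star_mult)
  also have "\<dots> \<le> 1 + 1 / 2" by (intro norm_diff_bound norm_pr_le orth)
  finally have h2: "?h\<^sup>2 \<le> 3 / 2" by simp
  have low: "low s (emb U) (?h / K)"
    unfolding low_def
  proof (intro allI impI)
    fix v assume v: "pr s * v = v"
    have "star v * v = star v * ((pr s - star (emb U) * emb U) * v) + star (emb U * v) * (emb U * v)"
      by (simp add: algebra_simps v)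
    also have "norm \<dots> \<le> norm v * (1 / 2 * norm v) + (norm (emb U * v))\<^sup>2"
      by (intro norm_bounds orth) (auto simp: norm_star_mult simp del: star_mult)
    finally have "(norm v)\<^sup>2 \<le> 2 * (norm (emb U * v))\<^sup>2"
      by (simp add: norm_star_mult power2_eq_square)
    moreover have "?h\<^sup>2 * (norm v)\<^sup>2 \<le> 3 / 2 * (norm v)\<^sup>2"
      using h2 by (intro mult_right_mono) auto
    ultimately have "?h\<^sup>2 * (norm v)\<^sup>2 \<le> 4 * (norm (emb U * v))\<^sup>2"
      using zero_le_power2[of "norm (emb U * v)"] by linarith
    then have "(?h * norm v)\<^sup>2 \<le> (2 * norm (emb U * v))\<^sup>2" by (simp add: power_mult_distrib)
    then have "?h * norm v \<le> 2 * norm (emb U * v)" by (rule power2_le_imp_le) simp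
    also have "\<dots> \<le> K * norm (emb U * v)" using K by (intro mult_right_mono) auto
    finally show "?h / K * norm v \<le> norm (emb U * v)" using K by (simp add: divide_simps mult.commute)
  qed
  have "norm (emb U * emb C - emb W) = norm (emb \<Delta>X)"
    using emb_add[OF W(1) q(3)] emb_mult[OF q(1,2)] q(4) by (metis add_diff_cancel_left')
  also have "\<dots> \<le> b1 * norm (emb W)" using q(5) mnorm_eq[OF q(3) s] mnorm_eq[OF W(1) s] by simp
  also have "\<dots> \<le> \<epsilon> * (2 * N)"
    using b(1) W(2) eps_nonneg by (intro mult_mono) auto
  also have "\<dots> \<le> 4 * K * \<epsilon> * N"
  proof -
    have "0 \<le> \<epsilon> * N" using W(2) norm_ge_zero[of "emb W"] eps_nonneg by (intro mult_nonneg_nonneg) linarith+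
    moreover have "2 * (\<epsilon> * N) \<le> 4 * K * (\<epsilon> * N)" using K \<open>0 \<le> \<epsilon> * N\<close> by (intro mult_right_mono) auto
    ultimately show ?thesis by simp
  qed
  finally show ?thesis using low q(1,2) st(1) by blast
qed

end

section \<open>Induction over the block columns\<close>

text \<open>The product in \<open>small\<close> buys several conditions at once, each factor being
  at least 1. With K^3 p \<epsilon> \<kappa>(X) as unit, K^2 p keeps the growth of
  \<open>\<omega>\<close> linear, \<tau> keeps the loss of orthogonality in the 2S version below
  1/2, and (\<tau> + 1)/(\<tau> - 1) keeps \<kappa>(W) below \<tau> \<kappa>(X).\<close>

locale bgs_run = fp_model +
  fixes m s p :: nat and X :: "real mat" and a :: bgs and K \<tau> :: real
  assumes ms: "0 < m" "0 < s" "0 < p" and dims: "real m \<le> M" "real (p * s) \<le> M"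
    and X: "X \<in> carrier_mat m (p * s)" and \<sigma>: "0 < sigma_min X" and K: "2 \<le> K" and \<tau>: "1 < \<tau>"
    and small: "10 ^ 6 * K ^ 5 * (real p)\<^sup>2 * \<tau> * ((\<tau> + 1) / (\<tau> - 1)) * (\<epsilon> * kappa X) \<le> 1 / 2"
begin

abbreviation N :: real where "N \<equiv> norm (emb X)"
abbreviation x :: "nat \<Rightarrow> fmat" where "x k \<equiv> emb (block_col s X k)"
abbreviation q :: "nat \<Rightarrow> fmat" where "q k \<equiv> emb (qcat m s a k)"
abbreviation r :: "nat \<Rightarrow> fmat" where "r k \<equiv> emb (rcat s a k)"
abbreviation \<omega> :: "nat \<Rightarrow> real" where "\<omega> k \<equiv> 3000 * K ^ 3 * real k * \<epsilon>"

text \<open>The common scale: \<open>\<omega> k\<close>, \<open>\<eta>\<close> and the residual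
  relative to \<open>sigma_min X\<close> are all bounded by numerical multiples of it.\<close>

definition y :: real where "y = K ^ 3 * real p * (\<epsilon> * kappa X)"

lemma ps: "0 < p * s" using ms by simp

lemma kappa_eq: "kappa X = N / sigma_min X"
  by (simp add: kappa_def sigma_max_eq[OF X ps])

lemma sigma_le_N: "sigma_min X \<le> N"
  by (rule low_norm[OF low_sigma_min[OF X ps] ps emb_pr[OF X]])

lemma kappa1: "1 \<le> kappa X"
  using sigma_le_N \<sigma> by (simp add: kappa_eq)

lemma N: "0 < N" using sigma_le_N \<sigma> by linarith

lemma p1: "1 \<le> real p" using ms by simp

lemma T1: "1 \<le> (\<tau> + 1) / (\<tau> - 1)" using \<tau> by (simp add: divide_simps)

lemma y0: "0 \<le> y"
  using K kappa1 eps_nonneg by (simp add: y_def)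

lemma y_small:
  "2000000 * (K\<^sup>2 * real p * y) \<le> 1" "2000000 * (K * y) \<le> 1" "2000000 * y \<le> 1"
  "2000000 * (\<tau> * y) \<le> 1" "2000000 * ((\<tau> + 1) / (\<tau> - 1) * y) \<le> 1"
proof -
  define T where "T = (\<tau> + 1) / (\<tau> - 1)"
  define A where "A = K\<^sup>2 * real p"
  have T: "1 \<le> T" using T1 by (simp add: T_def)
  have K2: "1 \<le> K\<^sup>2" using K by (simp add: one_le_power)
  have A: "1 \<le> A" unfolding A_def using mult_mono[OF K2 p1] by simp
  have \<tau>1: "1 \<le> \<tau>" using \<tau> by simp
  have eq: "10 ^ 6 * K ^ 5 * (real p)\<^sup>2 * \<tau> * T * (\<epsilon> * kappa X) = 1000000 * (A * \<tau> * T * y)"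
    by (simp add: y_def A_def power2_eq_square power3_eq_cube eval_nat_numeral mult_ac)
  have small': "2000000 * (A * \<tau> * T * y) \<le> 1" using small[folded T_def] unfolding eq by linarith
  have "1 \<le> \<tau> * T" "1 \<le> A * T" "1 \<le> A * \<tau>"
    using mult_mono[OF \<tau>1 T] mult_mono[OF A T] mult_mono[OF A \<tau>1] A \<tau>1 T by auto
  then have *: "A * 1 \<le> A * (\<tau> * T)" "\<tau> * 1 \<le> \<tau> * (A * T)" "T * 1 \<le> T * (A * \<tau>)"
    using A \<tau>1 T by (intro mult_left_mono; simp)+
  have "A * y \<le> A * \<tau> * T * y" "\<tau> * y \<le> A * \<tau> * T * y" "T * y \<le> A * \<tau> * T * y"
    using mult_right_mono[OF *(1) y0] mult_right_mono[OF *(2) y0] mult_right_mono[OF *(3) y0]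
    by (simp_all add: mult_ac)
  then show 1: "2000000 * (K\<^sup>2 * real p * y) \<le> 1" and "2000000 * (\<tau> * y) \<le> 1"
    and "2000000 * ((\<tau> + 1) / (\<tau> - 1) * y) \<le> 1"
    using small' unfolding T_def[symmetric] A_def[symmetric] by linarith+
  have "K * 1 \<le> K * (K * real p)" using mult_mono[of 1 K 1 "real p"] K p1 by (intro mult_left_mono) auto
  from mult_right_mono[OF this y0] show "2000000 * (K * y) \<le> 1" using 1 by (simp add: power2_eq_square)
  show "2000000 * y \<le> 1" using mult_right_mono[OF A y0] 1 by (simp add: A_def)
qed

lemma eps_le_y: "K ^ 3 * real k * \<epsilon> \<le> K ^ 3 * real p * \<epsilon>" "K ^ 3 * real p * \<epsilon> \<le> y" if "k \<le> p"
proof -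
  show "K ^ 3 * real k * \<epsilon> \<le> K ^ 3 * real p * \<epsilon>"
    using that K eps_nonneg by (intro mult_right_mono mult_left_mono) auto
  have "K ^ 3 * real p * (\<epsilon> * 1) \<le> K ^ 3 * real p * (\<epsilon> * kappa X)"
    using K kappa1 eps_nonneg by (intro mult_left_mono) auto
  then show "K ^ 3 * real p * \<epsilon> \<le> y" by (simp add: y_def)
qed

lemma K_pow_eps: "\<epsilon> \<le> K\<^sup>2 * \<epsilon>" "K\<^sup>2 * \<epsilon> \<le> K ^ 3 * real p * \<epsilon>" "K * \<epsilon> \<le> K\<^sup>2 * \<epsilon>"
proof -
  have "1 \<le> K\<^sup>2" "K\<^sup>2 \<le> K ^ 3" using K by (auto intro: one_le_power power_increasing)
  moreover have "K ^ 3 * 1 \<le> K ^ 3 * real p" using p1 K by (intro mult_left_mono) auto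
  ultimately have "1 \<le> K\<^sup>2" "K\<^sup>2 \<le> K ^ 3 * real p" by auto
  then show "\<epsilon> \<le> K\<^sup>2 * \<epsilon>" "K\<^sup>2 * \<epsilon> \<le> K ^ 3 * real p * \<epsilon>"
    using mult_right_mono[OF _ eps_nonneg] by fastforce+
  show "K * \<epsilon> \<le> K\<^sup>2 * \<epsilon>" using K eps_nonneg by (intro mult_right_mono) (auto simp: power2_eq_square)
qed

lemma eps260: "260 * K\<^sup>2 * \<epsilon> \<le> 1"
  using K_pow_eps(2) eps_le_y(2)[of p] y_small(3) by simp

lemma eps_N: "K ^ 3 * real p * \<epsilon> * N = y * sigma_min X"
  using \<sigma> by (simp add: y_def kappa_eq)

lemma dims': "real s \<le> M" "k \<le> p \<Longrightarrow> real (k * s) \<le> M"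
proof -
  have "s \<le> p * s" using ms by simp
  then show "real s \<le> M" using dims(2) by (meson of_nat_le_iff order_trans)
  assume "k \<le> p"
  then have "k * s \<le> p * s" by (rule mult_le_mono1)
  then show "real (k * s) \<le> M" using dims(2) by (meson of_nat_le_iff order_trans)
qed

lemma x_eq: "k < p \<Longrightarrow> x (Suc k) = emb X * star (sel s k)"
  by (rule emb_block_col[OF X])

lemma x_carrier: "block_col s X k \<in> carrier_mat m s"
  by (rule block_col_carrier[OF X])

lemma norm_x: "k < p \<Longrightarrow> norm (x (Suc k)) \<le> N"
  unfolding x_eq using norm_mult_bound[OF order_refl norm_star_bound[OF norm_sel_le], of "emb X" s k] by simp

text \<open>Multiplying by \<open>pr (k * s)\<close> blanks the later block columns, so that X keeps
  one size for all k. The last part is guarded because there are no coefficients beyond block p. The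
  factors 300 and 260 are those of \<open>residual\<close> and \<open>next_S\<close>, and 3000
  exceeds the growth of the loss of orthogonality per step.\<close>

definition accurate :: "nat \<Rightarrow> bool" where
  "accurate k \<longleftrightarrow> norm (emb X * pr (k * s) - q k * r k) \<le> 300 * K\<^sup>2 * real k * \<epsilon> * N \<and>
     norm (star (q k) * q k - pr (k * s)) \<le> \<omega> k \<and>
     (k < p \<longrightarrow> sc a (Suc k) \<in> carrier_mat (k * s) s \<and>
        norm (emb (sc a (Suc k)) - star (q k) * x (Suc k)) \<le> 260 * K\<^sup>2 * \<epsilon> * N)"

lemma om1: "k \<le> p \<Longrightarrow> \<omega> k \<le> 1"
  using eps_le_y[of k] y_small(3) by simp

lemma W_bounds:
  assumes k: "1 \<le> k" "k < p" and accurate: "accurate k" and st: "step_W u m s X a k W"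
  shows "W \<in> carrier_mat m s \<and>
    norm (emb W - (x (Suc k) - q k * emb (sc a (Suc k)))) \<le> 20 * \<epsilon> * N \<and> norm (emb W) \<le> 2 * N \<and>
    low s (emb W) (3 / 4 * sigma_min X) \<and> 0 < sigma_min W \<and> kappa W \<le> \<tau> * kappa X"
proof -
  let ?S = "emb (sc a (Suc k))" and ?\<sigma> = "sigma_min X"
  have sc: "sc a (Suc k) \<in> carrier_mat (k * s) s"
    and E1: "norm (emb X * pr (k * s) - q k * r k) \<le> 300 * K\<^sup>2 * real k * \<epsilon> * N"
    and E2: "norm (star (q k) * q k - pr (k * s)) \<le> \<omega> k"
    and E3: "norm (?S - star (q k) * x (Suc k)) \<le> 260 * K\<^sup>2 * \<epsilon> * N"
    using accurate k by (auto simp: accurate_def)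
  have kp: "k \<le> p" using k by simp
  obtain G where G: "fl_mult u (qcat m s a k) (sc a (Suc k)) G" and W: "fl_minus u (block_col s X (Suc k)) G W"
    using st by (auto simp: step_W_def)
  note G' = fl_mult_error[OF G qcat_carrier sc dims(1) dims'(2)[OF kp] dims'(1)]
  have W': "W \<in> carrier_mat m s" "norm (emb W - (x (Suc k) - emb G)) \<le> \<epsilon> * (norm (x (Suc k)) + norm (emb G))"
    using fl_minus_error[OF x_carrier G'(1) dims(1) dims'(1) W] by auto
  note b = residual_block_bounds[OF E2 om1[OF kp] emb_pr[OF qcat_carrier] norm_x[OF k(2)] E3 eps260
      eps_nonneg eps1 G'(2) W'(2)]
  \<comment> \<open>The constant collects 4 * 3000 + 2 * 260 + 20 = 12540, rounded up.\<close>
  define \<delta> where "\<delta> = 13000 * (K ^ 3 * real p * \<epsilon>)"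
  have \<delta>: "4 * \<omega> k + 2 * (260 * K\<^sup>2 * \<epsilon>) + 20 * \<epsilon> \<le> \<delta>"
    using eps_le_y(1)[OF kp] K_pow_eps eps_nonneg unfolding \<delta>_def by linarith
  have \<delta>y: "\<delta> \<le> 13000 * y" using eps_le_y(2)[OF kp] by (simp add: \<delta>_def)
  have nW: "norm (emb W) \<le> N * (1 + \<delta>)"
    by (rule order_trans[OF b(3)]) (use \<delta> N in \<open>intro mult_left_mono, auto\<close>)
  have \<rho>: "300 * K\<^sup>2 * real k * \<epsilon> * N \<le> 300 * (y * ?\<sigma>)"
  proof -
    have "K\<^sup>2 * real k * \<epsilon> \<le> K ^ 3 * real p * \<epsilon>"
      using kp K eps_nonneg by (intro mult_right_mono mult_mono power_increasing) auto
    from mult_right_mono[OF this, of N] show ?thesis using eps_N N by (simp add: mult_ac)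
  qed
  have y\<sigma>: "2000000 * (y * ?\<sigma>) \<le> ?\<sigma>" "0 \<le> y * ?\<sigma>"
    using mult_right_mono[OF y_small(3), of ?\<sigma>] \<sigma> y0 by auto
  have low_X: "low (k * s) (emb X * pr (k * s)) ?\<sigma>"
    unfolding low_def
  proof (intro allI impI)
    fix v assume v: "pr (k * s) * v = v"
    have "pr (p * s) * v = pr (p * s) * pr (k * s) * v" by (simp add: mult.assoc v)
    also have "\<dots> = v" using pr_pr[of "k * s" "p * s"] kp v by simp
    finally show "?\<sigma> * norm v \<le> norm (emb X * pr (k * s) * v)"
      using lowD[OF low_sigma_min[OF X ps], of v] by (simp add: mult.assoc v)
  qed
  have nq: "norm (q k) \<le> 2" by (rule norm_almost_orthonormal[OF E2 om1[OF kp]])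
  \<comment> \<open>The factor \<open>r k\<close> inherits invertibility from X: q r is close to the
    first k blocks and \<open>norm q \<le> 2\<close>. The inverse is what
    \<open>low_project_out\<close> needs to write S v as R z.\<close>
  have "low (k * s) (q k * r k) (?\<sigma> - 300 * K\<^sup>2 * real k * \<epsilon> * N)"
    by (rule low_perturb[OF low_X]) (use E1 in \<open>simp add: norm_minus_commute\<close>)
  then have "low (k * s) (q k * r k) (?\<sigma> / 2)"
    by (rule low_mono) (use \<rho> y\<sigma> \<sigma> in linarith)
  from low_mult_right[OF this nq] have "low (k * s) (r k) (?\<sigma> / 4)" by simp
  from low_inverse[OF rcat_carrier this] \<sigma> obtain Ri where Ri: "r k * Ri = pr (k * s)" "pr (k * s) * Ri = Ri"
    by auto
  have \<rho>\<sigma>: "300 * K\<^sup>2 * real k * \<epsilon> * N \<le> ?\<sigma>" using \<rho> y\<sigma> \<sigma> by linarith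
  have "low s (emb X * star (sel s k) - q k * ?S) (?\<sigma> - 300 * K\<^sup>2 * real k * \<epsilon> * N)"
    by (rule low_project_out[OF low_sigma_min[OF X ps] E1 \<rho>\<sigma> sel_star_sel sel_pr norm_sel_le
        pr_star_sel[OF k(2)] pr_pr[OF mult_le_mono1[OF kp]] Ri pr_emb[OF sc]])
  then have "low s (x (Suc k) - q k * ?S) (?\<sigma> - 300 * K\<^sup>2 * real k * \<epsilon> * N)"
    by (simp add: x_eq[OF k(2)])
  note low = low_perturb[OF this b(2)]
  have 20: "20 * \<epsilon> * N \<le> 20 * (y * ?\<sigma>)"
  proof -
    have "\<epsilon> \<le> K ^ 3 * real p * \<epsilon>" using K_pow_eps by linarith
    from mult_right_mono[OF this, of N] show ?thesis using eps_N N by simp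
  qed
  have lowW: "low s (emb W) (?\<sigma> - 320 * (y * ?\<sigma>))"
    by (rule low_mono[OF low]) (use 20 \<rho> in linarith)
  have sW: "?\<sigma> - 320 * (y * ?\<sigma>) \<le> sigma_min W"
    by (rule le_sigma_min[OF W'(1) ms(2) lowW])
  have pos: "0 < ?\<sigma> - 320 * (y * ?\<sigma>)" using y\<sigma> \<sigma> by linarith
  have "kappa W = norm (emb W) / sigma_min W"
    by (simp add: kappa_def sigma_max_eq[OF W'(1) ms(2)])
  \<comment> \<open>The loss 320 in the denominator is weakened to 13000 to match the numerator. The
    quotient is then at most \<tau> as soon as 13000 (\<tau> + 1) y \<le> \<tau> - 1, which is the
    origin of (\<tau> + 1)/(\<tau> - 1).\<close>
  also have "\<dots> \<le> N * (1 + 13000 * y) / (?\<sigma> - 13000 * (y * ?\<sigma>))"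
  proof (intro frac_le)
    show "0 < ?\<sigma> - 13000 * (y * ?\<sigma>)" using y\<sigma> \<sigma> by linarith
    show "?\<sigma> - 13000 * (y * ?\<sigma>) \<le> sigma_min W" using sW y\<sigma> by linarith
    have "N * (1 + \<delta>) \<le> N * (1 + 13000 * y)" using \<delta>y N by (intro mult_left_mono) auto
    then show "norm (emb W) \<le> N * (1 + 13000 * y)" using nW by linarith
    show "0 \<le> N * (1 + 13000 * y)" using N y0 by simp
  qed
  also have "\<dots> = (1 + 13000 * y) / (1 - 13000 * y) * kappa X"
    using \<sigma> by (simp add: kappa_eq field_simps)
  also have "\<dots> \<le> \<tau> * kappa X"
  proof (intro mult_right_mono)
    have "2000000 * ((\<tau> + 1) * y) \<le> \<tau> - 1"
      using y_small(5) \<tau> by (simp add: divide_simps mult_ac)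
    moreover have "0 \<le> (\<tau> + 1) * y" using \<tau> y0 by simp
    ultimately have "13000 * ((\<tau> + 1) * y) \<le> \<tau> - 1" by linarith
    then have "1 + 13000 * y \<le> \<tau> * (1 - 13000 * y)" by (simp add: algebra_simps)
    then show "(1 + 13000 * y) / (1 - 13000 * y) \<le> \<tau>"
      using y_small(3) y0 by (simp add: divide_simps)
  qed (use kappa1 in auto)
  finally have "kappa W \<le> \<tau> * kappa X" .
  moreover have "N * (1 + \<delta>) \<le> N * 2" using \<delta>y y_small(3) N by (intro mult_left_mono) auto
  then have "norm (emb W) \<le> 2 * N" using nW by linarith
  moreover have "low s (emb W) (3 / 4 * ?\<sigma>)"
    by (rule low_mono[OF lowW]) (use y\<sigma> in linarith)
  moreover have "0 < sigma_min W" using pos sW by linarith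
  ultimately show ?thesis using W'(1) b(2) by blast
qed

lemma accurate_Suc:
  assumes k: "1 \<le> k" "k < p" and accurate: "accurate k"
    and U: "ub a (Suc k) \<in> carrier_mat m s" "low s (emb (ub a (Suc k))) (norm (emb (ub a (Suc k))) / K)"
    and C: "sd a (Suc k) \<in> carrier_mat s s"
    and W: "step_W u m s X a k W" "norm (emb (ub a (Suc k)) * emb (sd a (Suc k)) - emb W) \<le> 4 * K * \<epsilon> * N"
    and fin: "step_finish u m s a k \<Omega>" and nxt: "Suc k < p \<longrightarrow> step_S u m s X a (Suc k)"
  shows "accurate (Suc k)"
proof -
  let ?S = "emb (sc a (Suc k))" and ?U = "emb (ub a (Suc k))" and ?Y = "emb (yc a (Suc k))"
  let ?Q = "emb (qb a (Suc k))" and ?R = "emb (rc a (Suc k))" and ?R' = "emb (rd a (Suc k))"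
  have sc: "sc a (Suc k) \<in> carrier_mat (k * s) s"
    and E1: "norm (emb X * pr (k * s) - q k * r k) \<le> 300 * K\<^sup>2 * real k * \<epsilon> * N"
    and E2: "norm (star (q k) * q k - pr (k * s)) \<le> \<omega> k"
    and E3: "norm (?S - star (q k) * x (Suc k)) \<le> 260 * K\<^sup>2 * \<epsilon> * N"
    using accurate k by (auto simp: accurate_def)
  have kp: "k \<le> p" using k by simp
  note d = dims(1) dims'(1) dims'(2)[OF kp]
  note Wb = W_bounds[OF k accurate W(1)]
  have qt: "(qcat m s a k)\<^sup>T \<in> carrier_mat (k * s) m" using qcat_carrier by simp
  obtain H D G W2 G3 where
    f: "fl_mult u ((qcat m s a k)\<^sup>T) (ub a (Suc k)) (yc a (Suc k))" "fl_gram u (ub a (Suc k)) \<Omega>"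
      "fl_gram u (yc a (Suc k)) H" "fl_minus u \<Omega> H D" "fl_chol u D (yd a (Suc k))"
      "fl_mult u (qcat m s a k) (yc a (Suc k)) G" "fl_minus u (ub a (Suc k)) G W2"
      "fl_solve u (yd a (Suc k)) W2 (qb a (Suc k))"
      "fl_mult u (yc a (Suc k)) (sd a (Suc k)) G3" "fl_plus u (sc a (Suc k)) G3 (rc a (Suc k))"
      "fl_mult u (yd a (Suc k)) (sd a (Suc k)) (rd a (Suc k))"
    using fin by (auto simp: step_finish_def)
  note Y = fl_mult_error[OF f(1) qt U(1) d(3,1,2)]
  note \<Omega> = fl_gram_error[OF f(2) U(1) d(1,2)]
  note H = fl_gram_error[OF f(3) Y(1) d(3,2)]
  have D: "D \<in> carrier_mat s s" using fl_minus_error[OF \<Omega>(1) H(1) d(2,2) f(4)] by blast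
  note yd = fl_chol_pos_diag[OF f(5) D d(2)]
  note ch = fl_chol_error[OF f(4,5) \<Omega>(1,2) H(1,2) d(2)]
  note G = fl_mult_error[OF f(6) qcat_carrier Y(1) d(1,3,2)]
  have W2: "W2 \<in> carrier_mat m s" "norm (emb W2 - (?U - emb G)) \<le> \<epsilon> * (norm ?U + norm (emb G))"
    using fl_minus_error[OF U(1) G(1) d(1,2) f(7)] by auto
  have "yd a (Suc k) $$ (j, j) \<noteq> 0" if "j < s" for j using yd(3)[OF that] by simp
  note Q = fl_solve_error[OF f(8) yd(1) W2(1) yd(2) this d(1,2)]
  note G3 = fl_mult_error[OF f(9) Y(1) C d(3,2,2)]
  have R: "rc a (Suc k) \<in> carrier_mat (k * s) s" "norm (?R - (?S + emb G3)) \<le> \<epsilon> * (norm ?S + norm (emb G3))"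
    using fl_plus_error[OF sc G3(1) d(3,2) f(10)] by auto
  note R' = fl_mult_error[OF f(11) yd(1) C d(2,2,2)]
  \<comment> \<open>The least value that the first constraint of \<open>bgs_step\<close> on \<eta>
    admits. The coefficient 15000 below comes from 2 * (2 * 3000 + 1100) = 14200 plus the term 2
    \<epsilon>.\<close>
  define \<eta> where "\<eta> = 2 * N / sigma_min X * (2 * \<omega> k + 1100 * K\<^sup>2 * \<epsilon>) + 2 * \<epsilon>"
  have \<eta>: "\<eta> \<le> 15000 * y"
  proof -
    have "2 * \<omega> k + 1100 * K\<^sup>2 * \<epsilon> \<le> 7100 * (K ^ 3 * real p * \<epsilon>)"
      using eps_le_y(1)[OF kp] K_pow_eps by simp
    from mult_left_mono[OF this, of "2 * N / sigma_min X"]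
    have "2 * N / sigma_min X * (2 * \<omega> k + 1100 * K\<^sup>2 * \<epsilon>) \<le> 14200 * y"
      using N \<sigma> by (simp add: y_def kappa_eq mult_ac)
    moreover have "\<epsilon> \<le> y" using K_pow_eps eps_le_y(2)[OF kp] by linarith
    ultimately show ?thesis using y0 unfolding \<eta>_def by linarith
  qed
  have \<eta>K: "\<eta> \<le> 1 / (2 * K)"
  proof -
    have "2 * K * \<eta> \<le> 2 * K * (15000 * y)" using \<eta> K by (intro mult_left_mono) auto
    also have "\<dots> \<le> 1" using y_small(2) K y0 by simp
    finally show ?thesis using K by (simp add: field_simps)
  qed
  interpret st: bgs_step \<epsilon> "\<omega> k" K N "sigma_min X" \<eta> "k * s" s "q k" "x (Suc k)" ?S "emb W" ?U ?Y
    "emb \<Omega>" "emb H" "emb G" "emb W2" ?Q "emb G3" ?R ?R' "sd a (Suc k)" "yd a (Suc k)"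
    by unfold_locales
      (use ms K eps_nonneg eps260 N \<sigma> om1[OF kp] \<eta>K C yd(1) emb_pr[OF qcat_carrier] emb_pr[OF U(1)]
        pr_emb[OF Y(1)] emb_pr[OF Q(1)] E2 E3 norm_x[OF k(2)] Wb W(2) U(2) Y(2) \<Omega>(3) H(3) ch G(2) W2(2) Q(2)
        G3(2) R(2) R'(2) in \<open>auto simp: \<eta>_def emb_transpose\<close>)
  let ?J = "sel s k"
  have qS: "q (Suc k) = q k + ?Q * ?J" by (rule qcat_Suc[OF Q(1)])
  have rS: "r (Suc k) = r k + (?R + star ?J * ?R') * ?J" by (rule rcat_Suc[OF R(1) R'(1)])
  have J0: "pr (k * s) * star ?J = 0" using arg_cong[OF sel_pr[of s k], of star] by simp
  have qJ: "q k * star ?J = 0"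
  proof -
    have "q k * star ?J = q k * pr (k * s) * star ?J" by (simp only: emb_pr[OF qcat_carrier])
    then show ?thesis by (simp add: mult.assoc J0)
  qed
  have Jr: "?J * r k = 0"
  proof -
    have "?J * r k = ?J * (pr (k * s) * r k)" by (simp only: pr_emb[OF rcat_carrier])
    then show ?thesis by (simp add: sel_pr flip: mult.assoc)
  qed
  have JR: "?J * ?R = 0"
  proof -
    have "?J * ?R = ?J * (pr (k * s) * ?R)" by (simp only: pr_emb[OF R(1)])
    then show ?thesis by (simp add: sel_pr flip: mult.assoc)
  qed
  have JJR: "?J * (star ?J * ?R') = ?R'"
    by (simp add: sel_star_sel pr_emb[OF R'(1)] flip: mult.assoc)
  have prod: "q (Suc k) * r (Suc k) = q k * r k + (q k * ?R + ?Q * ?R') * ?J"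
  proof -
    \<comment> \<open>All mixed products vanish: \<open>q k\<close> has no columns in block k
      (counted from 0), and \<open>r k\<close> and the new off-diagonal part have no rows
      there.\<close>
    have "q (Suc k) * r (Suc k) = q k * r k + q k * ?R * ?J + (q k * star ?J) * ?R' * ?J
        + ?Q * (?J * r k) + ?Q * (?J * ?R) * ?J + ?Q * (?J * (star ?J * ?R')) * ?J"
      unfolding qS rS by (simp only: distrib_left distrib_right mult.assoc add_ac)
    then show ?thesis unfolding qJ Jr JR JJR by (simp add: distrib_right)
  qed
  have "emb X * pr (Suc k * s) = emb X * pr (k * s) + x (Suc k) * ?J"
    unfolding pr_Suc x_eq[OF k(2)] by (simp add: distrib_left mult.assoc)
  then have "emb X * pr (Suc k * s) - q (Suc k) * r (Suc k) =
      (emb X * pr (k * s) - q k * r k) - (q k * ?R + ?Q * ?R' - x (Suc k)) * ?J"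
    unfolding prod by (simp add: algebra_simps)
  also have "norm \<dots> \<le> 300 * K\<^sup>2 * real k * \<epsilon> * N + 300 * K\<^sup>2 * \<epsilon> * N * 1"
    by (intro norm_bounds E1 st.residual norm_sel_le)
  also have "\<dots> = 300 * K\<^sup>2 * real (Suc k) * \<epsilon> * N" by (simp add: algebra_simps)
  finally have I1: "norm (emb X * pr (Suc k * s) - q (Suc k) * r (Suc k)) \<le> 300 * K\<^sup>2 * real (Suc k) * \<epsilon> * N" .
  have "star ?J * pr s = star ?J"
  proof -
    have "star ?J * pr s = star (pr s * ?J)" by simp
    moreover have "pr s * ?J = ?J" by (rule fmat_eqI) (simp add: ent_sel)
    ultimately show ?thesis by simp
  qed
  then have "star ?J * ?J = star ?J * pr s * ?J" by simp
  \<comment> \<open>The summands are the old diagonal block, the new diagonal block and two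
    off-diagonal blocks that are transposes of each other.\<close>
  then have "star (q (Suc k)) * q (Suc k) - pr (Suc k * s) =
      (star (q k) * q k - pr (k * s)) + star ?J * (star ?Q * ?Q - pr s) * ?J
      + (star (q k) * ?Q) * ?J + star ?J * star (star (q k) * ?Q)"
    unfolding qS pr_Suc by (simp add: algebra_simps)
  also have "norm \<dots> \<le> \<omega> k + 1 * (1160 * K ^ 3 * \<epsilon> + 4 * K\<^sup>2 * \<omega> k * \<eta>) * 1
      + (2 * K * \<omega> k * \<eta> + 164 * K\<^sup>2 * \<epsilon>) * 1 + 1 * (2 * K * \<omega> k * \<eta> + 164 * K\<^sup>2 * \<epsilon>)"
    by (intro norm_bounds E2 st.orthogonality_Q st.orthogonality_q_Q norm_sel_le)
  also have "\<dots> \<le> \<omega> (Suc k)"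
  proof -
    define w where "w = \<omega> k * \<eta>"
    define e where "e = K ^ 3 * \<epsilon>"
    have e: "0 \<le> e" using K eps_nonneg by (simp add: e_def)
    have "0 \<le> w" unfolding w_def by (rule mult_nonneg_nonneg[OF st.omega_nonneg st.eta_bounds(1)])
    moreover have "K \<le> K\<^sup>2" using K by (simp add: power2_eq_square)
    ultimately have 1: "K * w \<le> K\<^sup>2 * w" by (intro mult_right_mono)
    have "w \<le> 3000 * (K ^ 3 * real p * \<epsilon>) * (15000 * y)"
      unfolding w_def
    proof (rule mult_mono[OF _ \<eta> _ st.eta_bounds(1)])
      show "\<omega> k \<le> 3000 * (K ^ 3 * real p * \<epsilon>)" using eps_le_y(1)[OF kp] by linarith
      show "0 \<le> 3000 * (K ^ 3 * real p * \<epsilon>)" using K eps_nonneg by simp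
    qed
    then have "K\<^sup>2 * w \<le> K\<^sup>2 * (3000 * (K ^ 3 * real p * \<epsilon>) * (15000 * y))"
      by (rule mult_left_mono) simp
    \<comment> \<open>Both \<open>\<omega> k\<close> and \<eta> carry a factor p. The smallness of
      K^2 p y removes them, so the increment is a multiple of K^3 \<epsilon> independent of k: 1160
      + 8 * 23 + 328 = 1672, within the allowed 3000.\<close>
    also have "\<dots> = 45000000 * (K\<^sup>2 * real p * y) * e" by (simp add: e_def)
    also have "\<dots> \<le> 23 * e"
      by (rule mult_right_mono[OF _ e]) (use y_small(1) in linarith)
    finally have 2: "K\<^sup>2 * w \<le> 23 * e" .
    have 3: "K\<^sup>2 * \<epsilon> \<le> e"
      unfolding e_def using K eps_nonneg by (intro mult_right_mono power_increasing) auto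
    have "\<omega> k + 1 * (1160 * K ^ 3 * \<epsilon> + 4 * K\<^sup>2 * \<omega> k * \<eta>) * 1
      + (2 * K * \<omega> k * \<eta> + 164 * K\<^sup>2 * \<epsilon>) * 1 + 1 * (2 * K * \<omega> k * \<eta> + 164 * K\<^sup>2 * \<epsilon>)
      = \<omega> k + 1160 * e + 4 * (K\<^sup>2 * w) + 4 * (K * w) + 328 * (K\<^sup>2 * \<epsilon>)"
      by (simp add: w_def e_def algebra_simps)
    also have "\<dots> \<le> \<omega> k + 3000 * e" using 1 2 3 e by linarith
    also have "\<dots> = \<omega> (Suc k)" by (simp add: e_def algebra_simps)
    finally show ?thesis .
  qed
  finally have I2: "norm (star (q (Suc k)) * q (Suc k) - pr (Suc k * s)) \<le> \<omega> (Suc k)" .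
  have I3: "sc a (Suc (Suc k)) \<in> carrier_mat (Suc k * s) s \<and>
    norm (emb (sc a (Suc (Suc k))) - star (q (Suc k)) * x (Suc (Suc k))) \<le> 260 * K\<^sup>2 * \<epsilon> * N" if kp': "Suc k < p"
  proof -
    \<comment> \<open>The next step has index at least 2, so the second case of
      \<open>step_S\<close> applies; the first case belongs to \<open>accurate_1\<close>.\<close>
    have "\<exists>Z P G W V. fl_mult u ((qcat m s a k)\<^sup>T) (block_col s X (Suc (Suc k))) Z \<and>
        fl_mult u ((ub a (Suc k))\<^sup>T) (block_col s X (Suc (Suc k))) P \<and>
        fl_mult u ((yc a (Suc k))\<^sup>T) Z G \<and> fl_minus u P G W \<and>
        fl_solve u (yd a (Suc k)) (W\<^sup>T) (V\<^sup>T) \<and> sc a (Suc (Suc k)) = Z @\<^sub>r V"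
      using nxt kp' k by (simp add: step_S_def)
    then obtain Z P G4 W4 V where
      g: "fl_mult u ((qcat m s a k)\<^sup>T) (block_col s X (Suc (Suc k))) Z"
        "fl_mult u ((ub a (Suc k))\<^sup>T) (block_col s X (Suc (Suc k))) P"
        "fl_mult u ((yc a (Suc k))\<^sup>T) Z G4" "fl_minus u P G4 W4"
        "fl_solve u (yd a (Suc k)) (W4\<^sup>T) (V\<^sup>T)" "sc a (Suc (Suc k)) = Z @\<^sub>r V"
      by blast
    have Ut: "(ub a (Suc k))\<^sup>T \<in> carrier_mat s m" and Yt: "(yc a (Suc k))\<^sup>T \<in> carrier_mat s (k * s)"
      using U(1) Y(1) by auto
    note Z = fl_mult_error[OF g(1) qt x_carrier d(3,1,2)]
    note P = fl_mult_error[OF g(2) Ut x_carrier d(2,1,2)]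
    note G4 = fl_mult_error[OF g(3) Yt Z(1) d(2,3,2)]
    have W4: "W4 \<in> carrier_mat s s" "norm (emb W4 - (emb P - emb G4)) \<le> \<epsilon> * (norm (emb P) + norm (emb G4))"
      using fl_minus_error[OF P(1) G4(1) d(2,2) g(4)] by auto
    have W4t: "W4\<^sup>T \<in> carrier_mat s s" using W4(1) by simp
    have "yd a (Suc k) $$ (j, j) \<noteq> 0" if "j < s" for j using yd(3)[OF that] by simp
    note V = fl_solve_error[OF g(5) yd(1) W4t yd(2) this d(2,2)]
    have Vc: "V \<in> carrier_mat s s" using V(1) by simp
    have "emb (sc a (Suc (Suc k))) = emb Z + star ?J * emb V"
      unfolding g(6) by (rule emb_append_rows[OF Z(1) Vc])
    moreover have "sc a (Suc (Suc k)) \<in> carrier_mat (Suc k * s) s"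
      unfolding g(6) using carrier_append_rows[OF Z(1) Vc] by (simp add: add.commute)
    moreover have "norm ((emb Z + star ?J * emb V) - star (q k + ?Q * ?J) * x (Suc (Suc k))) \<le> 260 * K\<^sup>2 * \<epsilon> * N"
      by (rule st.next_S[OF norm_x[OF kp'] Z(2)[unfolded emb_transpose] P(2)[unfolded emb_transpose]
          G4(2)[unfolded emb_transpose] W4(2) V(2)[unfolded emb_transpose] pr_emb[OF Vc] norm_sel_le])
    ultimately show ?thesis unfolding qS by simp
  qed
  show ?thesis unfolding accurate_def using I1 I2 I3 by blast
qed

end

section \<open>Initialization, induction and the final factorization\<close>

lemma add_minus_cancel_mat:
  fixes A B :: "real mat"
  assumes "A \<in> carrier_mat n k" "B \<in> carrier_mat n k" shows "A + (B - A) = B"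
  using assms by (intro eq_matI) auto

context bgs_run
begin

text \<open>Restricting X to a block of columns cannot lower the smallest or raise the largest
  singular value, so the hypothesis on the initial routine covers the first block.\<close>

lemma first_block: "0 < sigma_min (block_col s X 1)" "kappa (block_col s X 1) \<le> kappa X"
proof -
  have x1: "x 1 = emb X * star (sel s 0)" using x_eq[of 0] ms by simp
  have "low s (x 1) (sigma_min X)"
    unfolding low_def x1
  proof (intro allI impI)
    fix v assume v: "pr s * v = v"
    have "sel s 0 * (star (sel s 0) * v) = v" by (simp add: sel_star_sel v flip: mult.assoc)
    then have "norm v \<le> norm (star (sel s 0) * v)"
      using norm_mult_bound[OF norm_sel_le order_refl, of s 0 "star (sel s 0) * v"] by simp
    then have "sigma_min X * norm v \<le> sigma_min X * norm (star (sel s 0) * v)"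
      using \<sigma> by (intro mult_left_mono) auto
    also have "\<dots> \<le> norm (emb X * (star (sel s 0) * v))"
      using ms(3) by (intro lowD[OF low_sigma_min[OF X ps]]) (simp add: pr_star_sel flip: mult.assoc)
    finally show "sigma_min X * norm v \<le> norm (emb X * star (sel s 0) * v)" by (simp add: mult.assoc)
  qed
  then have le: "sigma_min X \<le> sigma_min (block_col s X 1)"
    by (rule le_sigma_min[OF x_carrier ms(2)])
  then show "0 < sigma_min (block_col s X 1)" using \<sigma> by linarith
  have "norm (x 1) \<le> N" using norm_x[of 0] ms by simp
  then have "norm (x 1) / sigma_min (block_col s X 1) \<le> N / sigma_min X"
    using le \<sigma> by (intro frac_le) auto
  then show "kappa (block_col s X 1) \<le> kappa X"
    unfolding kappa_eq by (simp only: kappa_def sigma_max_eq[OF x_carrier ms(2)])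
qed

lemma accurate_1:
  assumes qr: "approx_qr (block_col s X 1) (qb a 1, rd a 1) e1 e2" and e: "e1 \<le> \<epsilon>" "e2 \<le> \<epsilon>"
    and nxt: "1 < p \<longrightarrow> step_S u m s X a 1"
  shows "accurate 1"
proof -
  obtain \<Delta>X where qr: "qb a 1 \<in> carrier_mat m s" "rd a 1 \<in> carrier_mat s s" "\<Delta>X \<in> carrier_mat m s"
    "block_col s X 1 + \<Delta>X = qb a 1 * rd a 1" "mnorm \<Delta>X \<le> e1 * mnorm (block_col s X 1)"
    "mnorm (1\<^sub>m s - (qb a 1)\<^sup>T * qb a 1) \<le> e2"
    using qr unfolding approx_qr_def prod.case carrier_matD[OF x_carrier] by blast
  have q1: "q 1 = emb (qb a 1)" and r1: "r 1 = emb (rd a 1)"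
    by (rule qcat_1[OF qr(1)], rule rcat_1[OF qr(2)])
  have "emb X * pr s = emb X * star (sel s 0)"
    by (rule fmat_eqI) (simp add: ent_mult_star_sel)
  then have x1: "emb X * pr s = x 1" using x_eq[of 0] ms by simp
  have nx1: "norm (x 1) \<le> N" using norm_x[of 0] ms by simp
  have "x 1 + emb \<Delta>X = emb (qb a 1) * emb (rd a 1)"
    by (simp only: emb_add[OF x_carrier qr(3), symmetric] qr(4) emb_mult[OF qr(1,2)])
  then have "emb X * pr (1 * s) - q 1 * r 1 = - emb \<Delta>X"
    unfolding q1 r1 by (simp add: x1 algebra_simps)
  then have "norm (emb X * pr (1 * s) - q 1 * r 1) \<le> e1 * norm (x 1)"
    using qr(5) mnorm_eq[OF qr(3) ms(2)] mnorm_eq[OF x_carrier ms(2)] by simp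
  also have "\<dots> \<le> \<epsilon> * N" using e nx1 eps_nonneg by (intro mult_mono) auto
  also have "\<dots> \<le> 300 * K\<^sup>2 * real 1 * \<epsilon> * N"
  proof -
    have "\<epsilon> \<le> 300 * (K\<^sup>2 * \<epsilon>)" using K_pow_eps(1) eps_nonneg by linarith
    from mult_right_mono[OF this, of N] show ?thesis using N by (simp add: mult.assoc)
  qed
  finally have E1: "norm (emb X * pr (1 * s) - q 1 * r 1) \<le> 300 * K\<^sup>2 * real 1 * \<epsilon> * N" .
  have Qt: "(qb a 1)\<^sup>T \<in> carrier_mat s m" using qr(1) by simp
  have QtQ: "(qb a 1)\<^sup>T * qb a 1 \<in> carrier_mat s s" using qr(1) by simp
  have "norm (pr s - star (q 1) * q 1) \<le> e2"
    using qr(6) mnorm_eq[OF minus_carrier_mat[OF QtQ], of "1\<^sub>m s"] ms emb_minus[OF one_carrier_mat QtQ]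
      emb_mult[OF Qt qr(1)] unfolding q1 by (simp add: pr_def emb_transpose)
  also have "e2 \<le> 3000 * (K ^ 3 * real 1 * \<epsilon>)"
  proof -
    have "K\<^sup>2 * \<epsilon> \<le> K ^ 3 * \<epsilon>" using K eps_nonneg by (intro mult_right_mono power_increasing) auto
    then show ?thesis using e K_pow_eps(1) eps_nonneg by simp
  qed
  finally have E2: "norm (star (q 1) * q 1 - pr (1 * s)) \<le> \<omega> 1" by (simp add: norm_minus_commute)
  have om: "\<omega> 1 \<le> 1" using om1[of 1] ms by simp
  have nq: "norm (q 1) \<le> 2" by (rule norm_almost_orthonormal[OF E2 om])
  have E3: "sc a (Suc 1) \<in> carrier_mat (1 * s) s \<and>
    norm (emb (sc a (Suc 1)) - star (q 1) * x (Suc 1)) \<le> 260 * K\<^sup>2 * \<epsilon> * N" if p: "1 < p"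
  proof -
    have "fl_mult u ((qb a 1)\<^sup>T) (block_col s X 2) (sc a 2)"
      using nxt p by (simp add: step_S_def)
    note f = fl_mult_error[OF this Qt x_carrier dims'(1) dims(1) dims'(1)]
    have "norm (emb ((qb a 1)\<^sup>T)) * norm (x 2) \<le> 2 * N"
      using nq norm_x[of 1] p unfolding q1 by (intro mult_mono) (auto simp: emb_transpose numeral_2_eq_2)
    then have "norm (emb (sc a 2) - emb ((qb a 1)\<^sup>T) * x 2) \<le> \<epsilon> * (2 * N)"
      using f(2) mult_left_mono[OF _ eps_nonneg] by fastforce
    also have "\<dots> \<le> 260 * K\<^sup>2 * \<epsilon> * N"
    proof -
      have "2 * \<epsilon> \<le> 260 * (K\<^sup>2 * \<epsilon>)" using K_pow_eps(1) eps_nonneg by linarith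
      from mult_right_mono[OF this, of N] show ?thesis using N by (simp add: mult_ac)
    qed
    finally show ?thesis using f(1) unfolding q1 by (simp add: emb_transpose numeral_2_eq_2)
  qed
  show ?thesis unfolding accurate_def using E1 E2 E3 by blast
qed

lemma accurate_final:
  assumes "accurate p"
  shows "(\<exists>\<Delta>X \<in> carrier_mat m (p * s). X + \<Delta>X = qcat m s a p * rcat s a p \<and>
      mnorm \<Delta>X \<le> 300 * K\<^sup>2 * real p * \<epsilon> * mnorm X) \<and>
    mnorm (1\<^sub>m (p * s) - (qcat m s a p)\<^sup>T * qcat m s a p) \<le> 3000 * K ^ 3 * real p * \<epsilon>"
proof
  let ?Q = "qcat m s a p" and ?R = "rcat s a p"
  note Q = qcat_carrier[of m s a p]
  note R = rcat_carrier[of s a p]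
  have QR: "?Q * ?R \<in> carrier_mat m (p * s)" using Q R by simp
  have D: "?Q * ?R - X \<in> carrier_mat m (p * s)" by (rule minus_carrier_mat[OF X])
  have "X + (?Q * ?R - X) = ?Q * ?R" by (rule add_minus_cancel_mat[OF X QR])
  moreover have "mnorm (?Q * ?R - X) \<le> 300 * K\<^sup>2 * real p * \<epsilon> * mnorm X"
    using assms unfolding mnorm_eq[OF D ps] mnorm_eq[OF X ps] emb_minus[OF QR X] emb_mult[OF Q R]
    by (simp add: accurate_def emb_pr[OF X] norm_minus_commute)
  ultimately show "\<exists>\<Delta>X \<in> carrier_mat m (p * s). X + \<Delta>X = ?Q * ?R \<and>
      mnorm \<Delta>X \<le> 300 * K\<^sup>2 * real p * \<epsilon> * mnorm X" using D by blast
  have Qt: "?Q\<^sup>T \<in> carrier_mat (p * s) m" and QtQ: "?Q\<^sup>T * ?Q \<in> carrier_mat (p * s) (p * s)" using Q by auto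
  show "mnorm (1\<^sub>m (p * s) - ?Q\<^sup>T * ?Q) \<le> 3000 * K ^ 3 * real p * \<epsilon>"
    using assms unfolding mnorm_eq[OF minus_carrier_mat[OF QtQ] ps] emb_minus[OF one_carrier_mat QtQ]
      emb_mult[OF Qt Q] emb_transpose
    by (simp add: accurate_def norm_minus_commute pr_def)
qed

text \<open>Both versions are reduced to the same facts about U and C, so the induction step is the
  same before and after the switch.\<close>

lemma bcgsi_accurate:
  assumes cst: "2 * \<bar>cst\<bar> \<le> K" and \<alpha>1: "\<alpha>1 \<le> 1"
    and e: "e1 \<le> \<epsilon>" "e2 \<le> \<epsilon>" "b1 \<le> \<epsilon>" "0 \<le> b2" "b2 \<le> \<epsilon>"
    and IOA: "\<And>B. B \<in> carrier_mat m s \<Longrightarrow> 0 < sigma_min B \<Longrightarrow> kappa B \<le> kappa X \<Longrightarrow> approx_qr B (IOA B) e1 e2"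
    and IO1: "\<And>B. B \<in> carrier_mat m s \<Longrightarrow> 0 < sigma_min B \<Longrightarrow> kappa B \<le> \<tau> * kappa X \<Longrightarrow>
        approx_qr B (IO1 B) b1 (b2 * kappa B powr \<alpha>1)"
    and first: "IOA (block_col s X 1) = (qb a 1, rd a 1)"
    and steps: "\<And>k. k \<in> {1..<p} \<Longrightarrow> step_S u m s X a k \<and>
        (if k + 1 < d
         then step_1S u m s X a k (ub a (k + 1)) (sd a (k + 1)) \<and>
              (\<exists>\<Omega>. step_finish u m s a k \<Omega> \<and> \<not> switch_test cst \<Omega>)
         else step_2S u m s IO1 X a k (ub a (k + 1)) (sd a (k + 1)) \<and>
              (\<exists>\<Omega>. step_finish u m s a k \<Omega>))"
  shows "accurate p"
proof -
  have "k \<le> p \<longrightarrow> accurate k" if "1 \<le> k" for k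
    using that
  proof (induction k rule: dec_induct)
    case base
    have "approx_qr (block_col s X 1) (qb a 1, rd a 1) e1 e2"
      using IOA[OF x_carrier first_block] first by simp
    then show ?case using accurate_1 e steps[of 1] by auto
  next
    case (step k)
    show ?case
    proof
      assume kp: "Suc k \<le> p"
      then have k: "1 \<le> k" "k < p" "k \<in> {1..<p}" using step by auto
      have acc: "accurate k" using step k by simp
      note W = W_bounds[OF k(1,2) acc]
      have sc: "sc a (k + 1) \<in> carrier_mat (k * s) s" using acc k by (simp add: accurate_def)
      \<comment> \<open>This prepares the bound 1/2 on the loss of orthogonality of the 2S routine,
        whose argument may have condition number up to \<tau> \<kappa>(X).\<close>
      have "\<epsilon> * kappa X \<le> y"
      proof -
        have "1 \<le> K ^ 3" using K by (intro one_le_power) auto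
        then have "1 * 1 \<le> K ^ 3 * real p" using p1 K by (intro mult_mono) auto
        then show ?thesis
          unfolding y_def using mult_right_mono[of 1 "K ^ 3 * real p" "\<epsilon> * kappa X"] eps_nonneg kappa1 by simp
      qed
      then have "b2 * kappa X \<le> y" using mult_right_mono[OF e(5), of "kappa X"] kappa1 by linarith
      then have "\<tau> * (b2 * kappa X) \<le> \<tau> * y" using \<tau> by (intro mult_left_mono) auto
      then have b2: "b2 * (\<tau> * kappa X) \<le> 1 / 2" using y_small(4) by (simp add: mult_ac)
      obtain \<Omega> where fin: "step_finish u m s a k \<Omega>" and
        U: "ub a (k + 1) \<in> carrier_mat m s \<and> sd a (k + 1) \<in> carrier_mat s s \<and>
          low s (emb (ub a (k + 1))) (norm (emb (ub a (k + 1))) / K) \<and>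
          (\<exists>W. step_W u m s X a k W \<and>
             norm (emb (ub a (k + 1)) * emb (sd a (k + 1)) - emb W) \<le> 4 * K * \<epsilon> * N)"
      proof (cases "k + 1 < d")
        case True
        then obtain \<Omega> where \<Omega>: "step_1S u m s X a k (ub a (k + 1)) (sd a (k + 1))"
          "step_finish u m s a k \<Omega>" "\<not> switch_test cst \<Omega>"
          using steps[OF k(3)] by auto
        have g: "fl_gram u (ub a (k + 1)) \<Omega>" using \<Omega>(2) by (simp add: step_finish_def)
        show ?thesis
          by (rule that[OF \<Omega>(2) step_1S_bounds[OF \<Omega>(1) g \<Omega>(3) ms(2) dims(1) dims'(1) dims'(2) X sc cst K eps260]])
            (use k W in auto)
      next
        case False
        then obtain \<Omega> where \<Omega>: "step_2S u m s IO1 X a k (ub a (k + 1)) (sd a (k + 1))"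
          "step_finish u m s a k \<Omega>"
          using steps[OF k(3)] by auto
        show ?thesis
          by (rule that[OF \<Omega>(2) step_2S_bounds[OF \<Omega>(1) ms(2) K e(3,4) b2 \<alpha>1 _ IO1]]) (use W in auto)
      qed
      have "Suc k < p \<longrightarrow> step_S u m s X a (Suc k)" using steps[of "Suc k"] by auto
      then show "accurate (Suc k)"
        using accurate_Suc[OF k(1,2) acc _ _ _ _ _ fin] U by auto
    qed
  qed
  then show ?thesis using ms by simp
qed

end

section \<open>Closure properties of polynomial constants\<close>

lemma poly_const_nonneg: "poly_const c \<Longrightarrow> 0 < m \<Longrightarrow> 0 < s \<Longrightarrow> 0 < p \<Longrightarrow> 0 \<le> c m s p"
  by (auto simp: poly_const_def)

lemma poly_const_const: "0 \<le> c \<Longrightarrow> poly_const (\<lambda>m s p. c)"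
  unfolding poly_const_def by (rule exI[of _ c], rule exI[of _ 0]) auto

lemma poly_const_dims: "poly_const (\<lambda>m s p. real (m * s * p))"
  unfolding poly_const_def by (rule exI[of _ 1], rule exI[of _ 1]) auto

lemma poly_const_blocks: "poly_const (\<lambda>m s p. real p)"
  unfolding poly_const_def
proof (intro exI allI impI)
  fix m s p :: nat assume "0 < m \<and> 0 < s \<and> 0 < p"
  then have "1 * p \<le> m * s * p" by (intro mult_le_mono1) (simp add: Suc_le_eq)
  then have "real p \<le> real (m * s * p)" by (simp only: mult_1 of_nat_le_iff)
  then show "0 \<le> real p \<and> real p \<le> 1 * real (m * s * p) ^ 1" by simp
qed

lemma poly_const_add:
  assumes "poly_const c" "poly_const d" shows "poly_const (\<lambda>m s p. c m s p + d m s p)"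
proof -
  obtain K N K' N' where
    c: "\<And>m s p. 0 < m \<and> 0 < s \<and> 0 < p \<Longrightarrow> 0 \<le> c m s p \<and> c m s p \<le> K * real (m * s * p) ^ N" and
    d: "\<And>m s p. 0 < m \<and> 0 < s \<and> 0 < p \<Longrightarrow> 0 \<le> d m s p \<and> d m s p \<le> K' * real (m * s * p) ^ N'"
    using assms unfolding poly_const_def by metis
  show ?thesis unfolding poly_const_def
  proof (intro exI allI impI)
    fix m s p :: nat assume pos: "0 < m \<and> 0 < s \<and> 0 < p"
    define D where "D = real (m * s * p)"
    have "0 < m * s * p" using pos by simp
    then have D: "1 \<le> D" unfolding D_def by linarith
    have "K * D ^ N \<le> \<bar>K\<bar> * D ^ (N + N')" "K' * D ^ N' \<le> \<bar>K'\<bar> * D ^ (N + N')"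
      using D by (auto intro!: mult_mono power_increasing)
    then show "0 \<le> c m s p + d m s p \<and> c m s p + d m s p \<le> (\<bar>K\<bar> + \<bar>K'\<bar>) * real (m * s * p) ^ (N + N')"
      using c[OF pos] d[OF pos] unfolding D_def[symmetric] by (simp add: ring_distribs)
  qed
qed

lemma poly_const_mult:
  assumes "poly_const c" "poly_const d" shows "poly_const (\<lambda>m s p. c m s p * d m s p)"
proof -
  obtain K N K' N' where
    c: "\<And>m s p. 0 < m \<and> 0 < s \<and> 0 < p \<Longrightarrow> 0 \<le> c m s p \<and> c m s p \<le> K * real (m * s * p) ^ N" and
    d: "\<And>m s p. 0 < m \<and> 0 < s \<and> 0 < p \<Longrightarrow> 0 \<le> d m s p \<and> d m s p \<le> K' * real (m * s * p) ^ N'"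
    using assms unfolding poly_const_def by metis
  show ?thesis unfolding poly_const_def
  proof (intro exI allI impI)
    fix m s p :: nat assume pos: "0 < m \<and> 0 < s \<and> 0 < p"
    have "c m s p * d m s p \<le> (K * real (m * s * p) ^ N) * (K' * real (m * s * p) ^ N')"
      using c[OF pos] d[OF pos] by (intro mult_mono) auto
    then show "0 \<le> c m s p * d m s p \<and> c m s p * d m s p \<le> (K * K') * real (m * s * p) ^ (N + N')"
      using c[OF pos] d[OF pos] by (simp add: power_add mult_ac)
  qed
qed

lemma poly_const_power:
  assumes "poly_const c" shows "poly_const (\<lambda>m s p. c m s p ^ n)"
proof (induction n)
  case 0
  show ?case using poly_const_const[of 1] by simp
next
  case (Suc n)
  show ?case using poly_const_mult[OF assms Suc] by simp
qed

text \<open>The blocks W handed to the second routine are computed ones, and rounding may push their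
  condition number above \<kappa>(X). The hypothesis on that routine therefore reaches up to \<tau>
  \<kappa>(X) for an arbitrary fixed \<tau> > 1; the chosen \<open>c0\<close> grows like 1/(\<tau> -
  1) as \<tau> tends to 1. The constants are chosen before the dimensions, the matrix, u and the
  routines.\<close>

theorem theorem3:
  fixes cst \<tau> :: real
    and a1 a2 b1 b2 :: "nat \<Rightarrow> nat \<Rightarrow> nat \<Rightarrow> real"
  assumes "poly_const a1" "poly_const a2" "poly_const b1" "poly_const b2"
    and "1 < \<tau>"
  shows "\<exists>c0 c1 c2 :: nat \<Rightarrow> nat \<Rightarrow> nat \<Rightarrow> real.
    poly_const c0 \<and> poly_const c1 \<and> poly_const c2 \<and>
    (\<forall>(m :: nat) (s :: nat) (p :: nat) (u :: real) (\<alpha>1 :: real) (X :: real mat)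
        (IOA :: real mat \<Rightarrow> real mat \<times> real mat) (IO1 :: real mat \<Rightarrow> real mat \<times> real mat)
        (Q :: real mat) (R :: real mat).
      0 < m \<longrightarrow> 0 < s \<longrightarrow> 0 < p \<longrightarrow> 0 < u \<longrightarrow> u < 1 \<longrightarrow> \<alpha>1 \<le> 1 \<longrightarrow>
      X \<in> carrier_mat m (p * s) \<longrightarrow> 0 < sigma_min X \<longrightarrow>
      (\<forall>B \<in> carrier_mat m s. 0 < sigma_min B \<and> kappa B \<le> kappa X \<longrightarrow>
         approx_qr B (IOA B) (a1 m s p * u) (a2 m s p * u)) \<longrightarrow>
      (\<forall>B \<in> carrier_mat m s. 0 < sigma_min B \<and> kappa B \<le> \<tau> * kappa X \<longrightarrow>
         approx_qr B (IO1 B) (b1 m s p * u) (b2 m s p * u * kappa B powr \<alpha>1)) \<longrightarrow>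
      c0 m s p * u * kappa X \<le> 1 / 2 \<longrightarrow>
      bcgsi_p_1s_2s u cst m s p IOA IO1 X Q R \<longrightarrow>
      (\<exists>\<Delta>X \<in> carrier_mat m (p * s). X + \<Delta>X = Q * R \<and> mnorm \<Delta>X \<le> c1 m s p * u * mnorm X) \<and>
      mnorm (1\<^sub>m (p * s) - Q\<^sup>T * Q) \<le> c2 m s p * u)"
proof -
  \<comment> \<open>K must be at least 2 |cst| for the 1S version and at least 2 for both
    versions.\<close>
  define K where "K = 2 + 2 * \<bar>cst\<bar>"
  define T where "T = (\<tau> + 1) / (\<tau> - 1)"
  \<comment> \<open>All multiples of u are merged into one, so that \<epsilon> = g u dominates the
    rounding errors of the matrix operations and the four errors allowed to the routines.\<close>
  define g where "g = (\<lambda>m s p. 65 * real (m * s * p) ^ 4 + (a1 m s p + (a2 m s p + (b1 m s p + b2 m s p))))"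
  define L where "L = 10 ^ 6 * K ^ 5 * \<tau> * T"
  have K: "2 \<le> K" "2 * \<bar>cst\<bar> \<le> K" by (auto simp: K_def)
  have T: "1 \<le> T" using assms(5) by (simp add: T_def divide_simps)
  have L1: "1 \<le> L"
  proof -
    have "1 \<le> K ^ 5" using K by (intro one_le_power) auto
    then have "1 \<le> 10 ^ 6 * K ^ 5" by simp
    moreover have "1 * 1 \<le> \<tau> * T" using assms(5) T by (intro mult_mono) auto
    ultimately have "1 * (1 * 1) \<le> (10 ^ 6 * K ^ 5) * (\<tau> * T)" using K by (intro mult_mono[of 1 "10 ^ 6 * K ^ 5"]) auto
    then show ?thesis by (simp add: L_def mult.assoc)
  qed
  have g: "poly_const g"
    unfolding g_def
    by (rule poly_const_add[OF poly_const_mult[OF poly_const_const poly_const_power[OF poly_const_dims]]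
        poly_const_add[OF assms(1) poly_const_add[OF assms(2) poly_const_add[OF assms(3,4)]]]]) simp
  define c0 where "c0 = (\<lambda>m s p. L * real p ^ 2 * g m s p)"
  define c1 where "c1 = (\<lambda>m s p. 300 * K\<^sup>2 * real p * g m s p)"
  define c2 where "c2 = (\<lambda>m s p. 3000 * K ^ 3 * real p * g m s p)"
  show ?thesis
  proof (rule exI[of _ c0], rule exI[of _ c1], rule exI[of _ c2], intro conjI allI impI)
    show "poly_const c0"
      unfolding c0_def using L1
      by (intro poly_const_mult[OF poly_const_mult[OF poly_const_const poly_const_power[OF poly_const_blocks]] g]) simp
    show "poly_const c1"
      unfolding c1_def by (intro poly_const_mult[OF poly_const_mult[OF poly_const_const poly_const_blocks] g]) simp
    show "poly_const c2"
      unfolding c2_def using K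
      by (intro poly_const_mult[OF poly_const_mult[OF poly_const_const poly_const_blocks] g]) simp
    fix m s p :: nat and u \<alpha>1 :: real and X :: "real mat"
      and IOA IO1 :: "real mat \<Rightarrow> real mat \<times> real mat" and Q R :: "real mat"
    assume ms: "0 < m" "0 < s" "0 < p" and u: "0 < u" "u < 1" and \<alpha>1: "\<alpha>1 \<le> 1"
      and X: "X \<in> carrier_mat m (p * s)" and \<sigma>: "0 < sigma_min X"
      and IOA: "\<forall>B \<in> carrier_mat m s. 0 < sigma_min B \<and> kappa B \<le> kappa X \<longrightarrow>
         approx_qr B (IOA B) (a1 m s p * u) (a2 m s p * u)"
      and IO1: "\<forall>B \<in> carrier_mat m s. 0 < sigma_min B \<and> kappa B \<le> \<tau> * kappa X \<longrightarrow>
         approx_qr B (IO1 B) (b1 m s p * u) (b2 m s p * u * kappa B powr \<alpha>1)"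
      and small: "c0 m s p * u * kappa X \<le> 1 / 2"
      and run: "bcgsi_p_1s_2s u cst m s p IOA IO1 X Q R"
    define \<epsilon> where "\<epsilon> = g m s p * u"
    from run obtain a d where first: "IOA (block_col s X 1) = (qb a 1, rd a 1)"
      and steps: "\<forall>k\<in>{1..<p}. step_S u m s X a k \<and>
        (if k + 1 < d
         then step_1S u m s X a k (ub a (k + 1)) (sd a (k + 1)) \<and>
              (\<exists>\<Omega>. step_finish u m s a k \<Omega> \<and> \<not> switch_test cst \<Omega>)
         else step_2S u m s IO1 X a k (ub a (k + 1)) (sd a (k + 1)) \<and>
              (\<exists>\<Omega>. step_finish u m s a k \<Omega>))"
      and QR: "Q = qcat m s a p" "R = rcat s a p"
      unfolding bcgsi_p_1s_2s_def by (elim exE conjE)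
    have nonneg: "0 \<le> a1 m s p" "0 \<le> a2 m s p" "0 \<le> b1 m s p" "0 \<le> b2 m s p"
      using assms(1-4) ms by (auto intro: poly_const_nonneg)
    \<comment> \<open>The product of the dimensions bounds m and p s and is itself an admissible
      polynomial.\<close>
    define M where "M = real (m * s * p)"
    have M: "1 \<le> M" "real m \<le> M" "real (p * s) \<le> M"
    proof -
      have "0 < m * s * p" using ms by simp
      then show "1 \<le> M" unfolding M_def by linarith
      have "m * 1 \<le> m * (s * p)" using ms by (intro mult_le_mono2) (simp add: Suc_le_eq)
      then show "real m \<le> M" unfolding M_def by (simp only: of_nat_le_iff mult_1_right mult.assoc)
      have "1 * (p * s) \<le> m * (p * s)" using ms by (intro mult_le_mono1) (simp add: Suc_le_eq)
      then show "real (p * s) \<le> M" unfolding M_def by (simp only: of_nat_le_iff mult_1_left mult_ac)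
    qed
    have M4: "0 \<le> M ^ 4" by simp
    have eps: "65 * M ^ 4 * u \<le> \<epsilon>" "a1 m s p * u \<le> \<epsilon>" "a2 m s p * u \<le> \<epsilon>" "b1 m s p * u \<le> \<epsilon>" "b2 m s p * u \<le> \<epsilon>"
      unfolding \<epsilon>_def g_def M_def[symmetric] using nonneg M4 u by (intro mult_right_mono; linarith)+
    have eps0: "0 \<le> \<epsilon>" using eps(2) nonneg u by (meson mult_nonneg_nonneg order_trans less_imp_le)
    have ps: "0 < p * s" using ms by simp
    have \<kappa>: "1 \<le> kappa X"
      using low_norm[OF low_sigma_min[OF X ps] ps emb_pr[OF X]] \<sigma>
      by (simp add: kappa_def sigma_max_eq[OF X ps])
    have small': "L * real p ^ 2 * (\<epsilon> * kappa X) \<le> 1 / 2"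
      using small by (simp add: c0_def \<epsilon>_def mult_ac)
    \<comment> \<open>Since L, p^2 and \<kappa>(X) are all at least 1, the smallness hypothesis
      alone yields \<epsilon> \<le> 1, as \<open>fp_model\<close> requires.\<close>
    have "1 \<le> real p ^ 2" using ms by (intro one_le_power) simp
    then have "1 * 1 \<le> L * real p ^ 2" using L1 by (intro mult_mono) auto
    then have "1 * \<epsilon> \<le> L * real p ^ 2 * (\<epsilon> * kappa X)"
      using \<kappa> eps0 mult_left_mono[OF \<kappa> eps0] by (intro mult_mono) auto
    then have eps1: "\<epsilon> \<le> 1" using small' by linarith
    interpret run: bgs_run u M \<epsilon> m s p X a K \<tau>
    proof unfold_locales
      show "10 ^ 6 * K ^ 5 * (real p)\<^sup>2 * \<tau> * ((\<tau> + 1) / (\<tau> - 1)) * (\<epsilon> * kappa X) \<le> 1 / 2"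
        using small' unfolding T_def[symmetric] by (simp add: L_def mult_ac)
    qed (rule less_imp_le[OF u(1)] M eps(1) eps1 ms X \<sigma> K(1) assms(5))+
    have "0 \<le> b2 m s p * u" using nonneg u by simp
    have IOA': "\<And>B. B \<in> carrier_mat m s \<Longrightarrow> 0 < sigma_min B \<Longrightarrow> kappa B \<le> kappa X \<Longrightarrow>
        approx_qr B (IOA B) (a1 m s p * u) (a2 m s p * u)"
      using IOA by blast
    have IO1': "\<And>B. B \<in> carrier_mat m s \<Longrightarrow> 0 < sigma_min B \<Longrightarrow> kappa B \<le> \<tau> * kappa X \<Longrightarrow>
        approx_qr B (IO1 B) (b1 m s p * u) (b2 m s p * u * kappa B powr \<alpha>1)"
      using IO1 by blast
    have "run.accurate p"
      by (rule run.bcgsi_accurate[OF K(2) \<alpha>1 eps(2-4) \<open>0 \<le> b2 m s p * u\<close> eps(5) IOA' IO1' first bspec[OF steps]])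
    note final = run.accurate_final[OF this]
    have c: "c1 m s p * u = 300 * K\<^sup>2 * real p * \<epsilon>" "c2 m s p * u = 3000 * K ^ 3 * real p * \<epsilon>"
      unfolding c1_def c2_def \<epsilon>_def by (rule mult.assoc)+
    show "\<exists>\<Delta>X \<in> carrier_mat m (p * s). X + \<Delta>X = Q * R \<and> mnorm \<Delta>X \<le> c1 m s p * u * mnorm X"
      unfolding QR c by (rule conjunct1[OF final])
    show "mnorm (1\<^sub>m (p * s) - Q\<^sup>T * Q) \<le> c2 m s p * u"
      unfolding QR c by (rule conjunct2[OF final])
  qed
qed

end
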